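(* Let $c\neq 0$ and let $\Sigma^2$ be a biconservative surface with constant mean curvature (CMC surface) in $M^3(c)\times\mathbb{R}$, with mean curvature vector field $H\neq 0$ orthogonal to $\xi$ and with $|T|\in(0,1)$ on $\Sigma^2$, where $T$ is the tangent component of $\xi$. Then $\Sigma^2$ is flat and it is locally given by $X=X(u,v)$, where $X:D\subset\mathbb{R}^2\to M^3(c)\times\mathbb{R}$ is an isometric immersion, $D$ is an open set in $\mathbb{R}^2$, and either (1) $\Sigma^2$ is pseudo-umbilical, $c<0$, $|H|^2=-c(1-|T|^2)$, the integral curve of $X_u$ is a helix such that $\langle X_u,\xi\rangle=|T|$, with curvatures $\kappa_1^1=|H|$ and $\kappa_2^1=\sqrt{-c}\,|T|$, and the integral curve of $X_v$ is a circle such that $\langle X_v,\xi\rangle=0$, with curvature $\kappa_1^2=|H|$; or (2) $|H|^2>-c(1-|T|^2)$ and the integral curves of $X_u$ and $X_v$ are helices in $M^3(c)\times\mathbb{R}$ satisfying $\langle X_u,\xi\rangle=a$ and $\langle X_v,\xi\rangle=b$, where $a$ and $b$ are two real constants such that $$0<a^2+b^2=|T|^2<1\quad\text{and}\quad |H|^2+c(1-a^2-b^2)>0,$$ and with curvatures $$\kappa_1^1=|H|+\sqrt{|H|^2+c(1-a^2-b^2)},\qquad \kappa_2^1=\frac{|a|}{\sqrt{1-a^2-b^2}}\,\kappa_1^1$$ and $$\kappa_1^2=\Big||H|-\sqrt{|H|^2+c(1-a^2-b^2)}\Big|,\qquad \kappa_2^2=\frac{|b|}{\sqrt{1-a^2-b^2}}\,\kappa_1^2,$$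 respectively.
   Context: $M^3(c)$ is the simply-connected $3$-dimensional space form of constant sectional curvature $c$, and $\xi$ is the unit vector field on $M^3(c)\times\mathbb{R}$ tangent to $\mathbb{R}$. Surfaces are connected and isometrically immersed. $\sigma$ is the second fundamental form, $A$ the shape operator, $H=\frac12\mathrm{trace}\,\sigma$ the mean curvature vector field; CMC means $|H|$ is constant. $\Sigma^2$ is pseudo-umbilical if $A_H=|H|^2\,\mathrm{I}$. The surface is biconservative if the tangent part of its bitension field $\tau_2(\psi)=\Delta\tau(\psi)-\mathrm{trace}\,\bar R(d\psi,\tau(\psi))d\psi$ vanishes, where $\tau(\psi)=\mathrm{trace}\,\nabla d\psi=2H$, $\Delta=\mathrm{trace}(\nabla^\psi)^2$, $\bar R(X,Y)Z=[\bar\nabla_X,\bar\nabla_Y]Z-\bar\nabla_{[X,Y]}Z$; equivalently $$\mathrm{grad}|H|^2+2\,\mathrm{trace}A_{\nabla^\perp_{\cdot}H}(\cdot)+2\,\mathrm{trace}(\bar R(\cdot,H)\cdot)^\top=0.$$ A Frenet curve of osculating order $r$ is a unit-speed curve $\gamma$ with orthonormal fields $X_1=\gamma',\dots,X_r$ along it such that $\bar\nabla_{X_1}X_1=\kappa_1X_2$, $\bar\nabla_{X_1}X_i=-\kappa_{i-1}X_{i-1}+\kappa_iX_{i+1}$ for $2\le i\le r-1$, $\bar\nabla_{X_1}X_r=-\kappa_{r-1}X_{r-1}$, with positive functions $\kappa_i$ (the curvatures). It is a helix of order $r$ if all $\kappa_i$ are positive constants; a circle is a helix of order $2$, and "helix"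 without qualification means order $3$. In case (2), when a second curvature $\kappa_2^i$ is $0$ (i.e. $a=0$ or $b=0$), the corresponding "helix" is understood to be a circle with curvature $\kappa_1^i$. *)

theory Defs
  imports "HOL-Analysis.Analysis"
begin

section \<open>Smooth maps\<close>

text \<open>Only used on open sets \<open>S\<close>.\<close>

primrec times_differentiable_on ::
    "nat \<Rightarrow> ('a::real_normed_vector \<Rightarrow> 'b::real_normed_vector) \<Rightarrow> 'a set \<Rightarrow> bool" where
  "times_differentiable_on 0 f S \<longleftrightarrow> continuous_on S f"
| "times_differentiable_on (Suc n) f S \<longleftrightarrow>
     (\<forall>x\<in>S. f differentiable (at x)) \<and>
     (\<forall>v. times_differentiable_on n (\<lambda>x. frechet_derivative f (at x) v) S)"

definition smooth_on ::
    "'a set \<Rightarrow> ('a::real_normed_vector \<Rightarrow> 'b::real_normed_vector) \<Rightarrow> bool" where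
  "smooth_on S f \<longleftrightarrow> (\<forall>n. times_differentiable_on n f S)"

section \<open>The ambient space\<close>

text \<open>
  For \<open>c \<noteq> 0\<close> the simply connected space form of curvature \<open>c\<close> is realised as the standard
  quadric in four-space with the form \<open>x \<bullet> x + sgn c * s\<^sup>2\<close>: the round sphere of radius
  \<open>1 / sqrt c\<close> if \<open>c > 0\<close>, and the upper sheet of the hyperboloid in Minkowski space if \<open>c < 0\<close>.
  A point of the Riemannian product with the line is written \<open>((x, s), t)\<close>.  The form \<open>ip c\<close> is
  possibly indefinite on the whole vector space, but positive definite on tangent spaces of
  \<open>MxR c\<close>.
\<close>

type_synonym ambient = "((real ^ 3) \<times> real) \<times> real"

definition ipM :: "real \<Rightarrow> (real ^ 3) \<times> real \<Rightarrow> (real ^ 3) \<times> real \<Rightarrow> real" where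
  "ipM c p q = fst p \<bullet> fst q + sgn c * (snd p * snd q)"

definition space_form :: "real \<Rightarrow> ((real ^ 3) \<times> real) set" where
  "space_form c = {p. ipM c p p = 1 / c \<and> (c < 0 \<longrightarrow> snd p > 0)}"

definition MxR :: "real \<Rightarrow> ambient set" where
  "MxR c = space_form c \<times> UNIV"

definition ip :: "real \<Rightarrow> ambient \<Rightarrow> ambient \<Rightarrow> real" where
  "ip c v w = ipM c (fst v) (fst w) + snd v * snd w"

definition len :: "real \<Rightarrow> ambient \<Rightarrow> real" where
  "len c v = sqrt (ip c v v)"

definition \<xi> :: ambient where
  "\<xi> = (0, 1)"

text \<open>
  On \<open>MxR c\<close>, \<open>proj c q\<close> is the \<open>ip c\<close>-orthogonal projection onto the tangent space at \<open>q\<close>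
  (recall \<open>ipM c (fst q) (fst q) = 1 / c\<close>).  The Levi-Civita connection of \<open>MxR c\<close> is the
  projection of the flat derivative.
\<close>

definition proj :: "real \<Rightarrow> ambient \<Rightarrow> ambient \<Rightarrow> ambient" where
  "proj c q w = w - (c * ipM c (fst q) (fst w)) *\<^sub>R (fst q, 0)"

definition cov :: "real \<Rightarrow> (ambient \<Rightarrow> ambient) \<Rightarrow> (ambient \<Rightarrow> ambient) \<Rightarrow> ambient \<Rightarrow> ambient" where
  "cov c V W q = proj c q (frechet_derivative W (at q) (V q))"

definition lie_bracket :: "(ambient \<Rightarrow> ambient) \<Rightarrow> (ambient \<Rightarrow> ambient) \<Rightarrow> ambient \<Rightarrow> ambient" where
  "lie_bracket V W q =
     frechet_derivative W (at q) (V q) - frechet_derivative V (at q) (W q)"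

text \<open>
  The curvature tensor at \<open>q\<close> on tangent vectors \<open>x\<close>, \<open>y\<close>, \<open>z\<close>, computed with the tangent fields
  \<open>\<lambda>p. proj c p x\<close> etc. extending them; by tensoriality the extension is immaterial.
\<close>

definition curv :: "real \<Rightarrow> ambient \<Rightarrow> ambient \<Rightarrow> ambient \<Rightarrow> ambient \<Rightarrow> ambient" where
  "curv c q x y z =
     (let X = (\<lambda>p. proj c p x); Y = (\<lambda>p. proj c p y); Z = (\<lambda>p. proj c p z)
      in cov c X (cov c Y Z) q - cov c Y (cov c X Z) q - cov c (lie_bracket X Y) Z q)"

section \<open>Extrinsic geometry of a parametrised patch\<close>

text \<open>
  Below, \<open>f\<close> is an immersion of an open subset of the plane into \<open>MxR c\<close>.  Tangent vectors of the
  surface at \<open>f x\<close> are represented by vectors of the parameter plane (to which \<open>df f x\<close> is applied).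
\<close>

type_synonym plane = "real \<times> real"

definition df :: "(plane \<Rightarrow> ambient) \<Rightarrow> plane \<Rightarrow> plane \<Rightarrow> ambient" where
  "df f x v = frechet_derivative f (at x) v"

definition metric :: "real \<Rightarrow> (plane \<Rightarrow> ambient) \<Rightarrow> plane \<Rightarrow> plane \<Rightarrow> plane \<Rightarrow> real" where
  "metric c f x v w = ip c (df f x v) (df f x w)"

abbreviation e\<^sub>1 :: plane where "e\<^sub>1 \<equiv> (1, 0)"
abbreviation e\<^sub>2 :: plane where "e\<^sub>2 \<equiv> (0, 1)"

definition gram :: "real \<Rightarrow> (plane \<Rightarrow> ambient) \<Rightarrow> plane \<Rightarrow> real" where
  "gram c f x = metric c f x e\<^sub>1 e\<^sub>1 * metric c f x e\<^sub>2 e\<^sub>2 - (metric c f x e\<^sub>1 e\<^sub>2)\<^sup>2"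

text \<open>The vector dual to a covector, i.e. the components \<open>g\<^sup>i\<^sup>j \<alpha>\<^sub>j\<close>.\<close>

definition sharp :: "real \<Rightarrow> (plane \<Rightarrow> ambient) \<Rightarrow> plane \<Rightarrow> (plane \<Rightarrow> real) \<Rightarrow> plane" where
  "sharp c f x \<alpha> = (1 / gram c f x) *\<^sub>R
     (metric c f x e\<^sub>2 e\<^sub>2 * \<alpha> e\<^sub>1 - metric c f x e\<^sub>1 e\<^sub>2 * \<alpha> e\<^sub>2,
      metric c f x e\<^sub>1 e\<^sub>1 * \<alpha> e\<^sub>2 - metric c f x e\<^sub>1 e\<^sub>2 * \<alpha> e\<^sub>1)"

text \<open>The metric trace \<open>g\<^sup>i\<^sup>j \<beta>(e\<^sub>i, e\<^sub>j)\<close> of a bilinear form.\<close>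

definition tr :: "real \<Rightarrow> (plane \<Rightarrow> ambient) \<Rightarrow> plane \<Rightarrow>
    (plane \<Rightarrow> plane \<Rightarrow> ambient) \<Rightarrow> ambient" where
  "tr c f x \<beta> = (1 / gram c f x) *\<^sub>R
     (metric c f x e\<^sub>2 e\<^sub>2 *\<^sub>R \<beta> e\<^sub>1 e\<^sub>1
      - metric c f x e\<^sub>1 e\<^sub>2 *\<^sub>R (\<beta> e\<^sub>1 e\<^sub>2 + \<beta> e\<^sub>2 e\<^sub>1)
      + metric c f x e\<^sub>1 e\<^sub>1 *\<^sub>R \<beta> e\<^sub>2 e\<^sub>2)"

text \<open>
  \<open>tang c f x w\<close> is the component of \<open>w\<close> tangent to the surface, as a vector of the parameter
  plane; as an ambient vector it is \<open>df f x (tang c f x w)\<close>.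
\<close>

definition tang :: "real \<Rightarrow> (plane \<Rightarrow> ambient) \<Rightarrow> plane \<Rightarrow> ambient \<Rightarrow> plane" where
  "tang c f x w = sharp c f x (\<lambda>v. ip c w (df f x v))"

text \<open>
  \<open>nab\<close> is the pull-back connection on sections along \<open>f\<close>; \<open>LC\<close> is the Levi-Civita connection of the
  induced metric (Gauss formula).  The direction is the last argument.
\<close>

definition nab :: "real \<Rightarrow> (plane \<Rightarrow> ambient) \<Rightarrow> (plane \<Rightarrow> ambient) \<Rightarrow> plane \<Rightarrow> plane \<Rightarrow> ambient" where
  "nab c f W x v = proj c (f x) (frechet_derivative W (at x) v)"

definition LC :: "real \<Rightarrow> (plane \<Rightarrow> ambient) \<Rightarrow> (plane \<Rightarrow> plane) \<Rightarrow> plane \<Rightarrow> plane \<Rightarrow> plane" where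
  "LC c f Z x v = tang c f x (nab c f (\<lambda>y. df f y (Z y)) x v)"

definition sff :: "real \<Rightarrow> (plane \<Rightarrow> ambient) \<Rightarrow> plane \<Rightarrow> plane \<Rightarrow> plane \<Rightarrow> ambient" where
  "sff c f x v w = nab c f (\<lambda>y. df f y w) x v - df f x (LC c f (\<lambda>_. w) x v)"

definition mean_curv :: "real \<Rightarrow> (plane \<Rightarrow> ambient) \<Rightarrow> plane \<Rightarrow> ambient" where
  "mean_curv c f x = (1 / 2) *\<^sub>R tr c f x (sff c f x)"

definition shape :: "real \<Rightarrow> (plane \<Rightarrow> ambient) \<Rightarrow> plane \<Rightarrow> ambient \<Rightarrow> plane \<Rightarrow> plane" where
  "shape c f x \<eta> v = sharp c f x (\<lambda>w. ip c (sff c f x v w) \<eta>)"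

definition tan_xi :: "real \<Rightarrow> (plane \<Rightarrow> ambient) \<Rightarrow> plane \<Rightarrow> ambient" where
  "tan_xi c f x = df f x (tang c f x \<xi>)"

text \<open>Curvature of \<open>LC\<close>; constant vector fields of the parameter plane commute.\<close>

definition surf_curv :: "real \<Rightarrow> (plane \<Rightarrow> ambient) \<Rightarrow> plane \<Rightarrow> plane \<Rightarrow> plane \<Rightarrow> plane \<Rightarrow> plane" where
  "surf_curv c f x v w z =
     LC c f (\<lambda>y. LC c f (\<lambda>_. z) y w) x v - LC c f (\<lambda>y. LC c f (\<lambda>_. z) y v) x w"

definition tension :: "real \<Rightarrow> (plane \<Rightarrow> ambient) \<Rightarrow> plane \<Rightarrow> ambient" where
  "tension c f x = tr c f x (sff c f x)"

definition rough_laplacian ::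
    "real \<Rightarrow> (plane \<Rightarrow> ambient) \<Rightarrow> (plane \<Rightarrow> ambient) \<Rightarrow> plane \<Rightarrow> ambient" where
  "rough_laplacian c f W x =
     tr c f x (\<lambda>v w. nab c f (\<lambda>y. nab c f W y w) x v - nab c f W x (LC c f (\<lambda>_. w) x v))"

definition bitension :: "real \<Rightarrow> (plane \<Rightarrow> ambient) \<Rightarrow> plane \<Rightarrow> ambient" where
  "bitension c f x =
     rough_laplacian c f (tension c f) x
     - tr c f x (\<lambda>v w. curv c (f x) (df f x v) (tension c f x) (df f x w))"

section \<open>Immersed surfaces\<close>

text \<open>
  Charts are given by their inverses: a parametrisation \<open>(D, \<phi>)\<close> is a homeomorphism \<open>\<phi>\<close> of an
  open subset \<open>D\<close> of the plane onto an open subset of the surface.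
\<close>

type_synonym 'p param = "plane set \<times> (plane \<Rightarrow> 'p)"

definition parametrisation :: "'p topology \<Rightarrow> 'p param \<Rightarrow> bool" where
  "parametrisation S = (\<lambda>(D, \<phi>).
     open D \<and> openin S (\<phi> ` D) \<and>
     homeomorphic_map (top_of_set D) (subtopology S (\<phi> ` D)) \<phi>)"

definition smooth_transition :: "'p param \<Rightarrow> 'p param \<Rightarrow> bool" where
  "smooth_transition = (\<lambda>(D, \<phi>) (D', \<phi>').
     smooth_on {x \<in> D. \<phi> x \<in> \<phi>' ` D'} (\<lambda>x. inv_into D' \<phi>' (\<phi> x)))"

definition smooth_surface :: "'p topology \<Rightarrow> 'p param set \<Rightarrow> bool" where
  "smooth_surface S \<A> \<longleftrightarrow>
     Hausdorff_space S \<and> second_countable S \<and>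
     (\<forall>P\<in>\<A>. parametrisation S P) \<and>
     (\<forall>P\<in>\<A>. \<forall>Q\<in>\<A>. smooth_transition P Q) \<and>
     (\<Union>(D, \<phi>)\<in>\<A>. \<phi> ` D) = topspace S"

definition immersion_into :: "real \<Rightarrow> plane set \<Rightarrow> (plane \<Rightarrow> ambient) \<Rightarrow> bool" where
  "immersion_into c D f \<longleftrightarrow> f ` D \<subseteq> MxR c \<and> smooth_on D f \<and> (\<forall>x\<in>D. inj (df f x))"

text \<open>The surface carries the metric induced by the immersion \<open>\<psi>\<close>.\<close>

definition immersed_surface ::
    "real \<Rightarrow> 'p topology \<Rightarrow> 'p param set \<Rightarrow> ('p \<Rightarrow> ambient) \<Rightarrow> bool" where
  "immersed_surface c S \<A> \<psi> \<longleftrightarrow>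
     smooth_surface S \<A> \<and> connected_space S \<and> topspace S \<noteq> {} \<and>
     (\<forall>(D, \<phi>)\<in>\<A>. immersion_into c D (\<psi> \<circ> \<phi>))"

text \<open>
  A pointwise property \<open>Q f x\<close> of patches, independent of the parametrisation, holds on the
  whole surface.
\<close>

definition everywhere ::
    "'p param set \<Rightarrow> ('p \<Rightarrow> ambient) \<Rightarrow> ((plane \<Rightarrow> ambient) \<Rightarrow> plane \<Rightarrow> bool) \<Rightarrow> bool" where
  "everywhere \<A> \<psi> Q \<longleftrightarrow> (\<forall>(D, \<phi>)\<in>\<A>. \<forall>x\<in>D. Q (\<psi> \<circ> \<phi>) x)"

definition biconservative :: "real \<Rightarrow> 'p param set \<Rightarrow> ('p \<Rightarrow> ambient) \<Rightarrow> bool" where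
  "biconservative c \<A> \<psi> \<longleftrightarrow> everywhere \<A> \<psi> (\<lambda>f x. df f x (tang c f x (bitension c f x)) = 0)"

definition pseudo_umbilical :: "real \<Rightarrow> 'p param set \<Rightarrow> ('p \<Rightarrow> ambient) \<Rightarrow> bool" where
  "pseudo_umbilical c \<A> \<psi> \<longleftrightarrow> everywhere \<A> \<psi>
     (\<lambda>f x. \<forall>v. shape c f x (mean_curv c f x) v = (len c (mean_curv c f x))\<^sup>2 *\<^sub>R v)"

definition flat :: "real \<Rightarrow> 'p param set \<Rightarrow> ('p \<Rightarrow> ambient) \<Rightarrow> bool" where
  "flat c \<A> \<psi> \<longleftrightarrow> everywhere \<A> \<psi> (\<lambda>f x. \<forall>v w z. surf_curv c f x v w z = 0)"

definition isometric_immersion :: "real \<Rightarrow> plane set \<Rightarrow> (plane \<Rightarrow> ambient) \<Rightarrow> bool" where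
  "isometric_immersion c D X \<longleftrightarrow>
     immersion_into c D X \<and> (\<forall>x\<in>D. \<forall>v w. metric c X x v w = v \<bullet> w)"

text \<open>
  Each point of the surface lies in the image of a parametrisation \<open>\<theta>\<close>, compatible with the
  atlas, for which \<open>X = \<psi> \<circ> \<theta>\<close> is an isometric immersion of \<open>D\<close> satisfying \<open>Q\<close>.
\<close>

definition locally_given :: "real \<Rightarrow> 'p topology \<Rightarrow> 'p param set \<Rightarrow> ('p \<Rightarrow> ambient) \<Rightarrow>
    (plane set \<Rightarrow> (plane \<Rightarrow> ambient) \<Rightarrow> bool) \<Rightarrow> bool" where
  "locally_given c S \<A> \<psi> Q \<longleftrightarrow>
     (\<forall>p\<in>topspace S. \<exists>D \<theta>. p \<in> \<theta> ` D \<and> parametrisation S (D, \<theta>) \<and>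
        (\<forall>P\<in>\<A>. smooth_transition (D, \<theta>) P \<and> smooth_transition P (D, \<theta>)) \<and>
        isometric_immersion c D (\<psi> \<circ> \<theta>) \<and> Q D (\<psi> \<circ> \<theta>))"

section \<open>Frenet curves and helices\<close>

text \<open>The derivative of a field along a curve, with respect to the connection of \<open>MxR c\<close>.\<close>

definition nab_curve :: "real \<Rightarrow> (real \<Rightarrow> ambient) \<Rightarrow> (real \<Rightarrow> ambient) \<Rightarrow> real \<Rightarrow> ambient" where
  "nab_curve c \<gamma> V t = proj c (\<gamma> t) (vector_derivative V (at t))"

definition frenet_curve :: "real \<Rightarrow> nat \<Rightarrow> (nat \<Rightarrow> real \<Rightarrow> real) \<Rightarrow>
    (nat \<Rightarrow> real \<Rightarrow> ambient) \<Rightarrow> real set \<Rightarrow> (real \<Rightarrow> ambient) \<Rightarrow> bool" where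
  "frenet_curve c r \<kappa> E I \<gamma> \<longleftrightarrow>
     1 \<le> r \<and> \<gamma> ` I \<subseteq> MxR c \<and> smooth_on I \<gamma> \<and> (\<forall>i\<in>{1..r}. smooth_on I (E i)) \<and>
     (\<forall>t\<in>I.
        E 1 t = vector_derivative \<gamma> (at t) \<and>
        (\<forall>i\<in>{1..r}. proj c (\<gamma> t) (E i t) = E i t) \<and>
        (\<forall>i\<in>{1..r}. \<forall>j\<in>{1..r}. ip c (E i t) (E j t) = (if i = j then 1 else 0)) \<and>
        (\<forall>i\<in>{1..<r}. \<kappa> i t > 0) \<and>
        (\<forall>i\<in>{1..r}. nab_curve c \<gamma> (E i) t =
           (if i = 1 then 0 else - \<kappa> (i - 1) t *\<^sub>R E (i - 1) t) +
           (if i = r then 0 else \<kappa> i t *\<^sub>R E (i + 1) t)))"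

definition helix_of_order ::
    "real \<Rightarrow> nat \<Rightarrow> (nat \<Rightarrow> real) \<Rightarrow> real set \<Rightarrow> (real \<Rightarrow> ambient) \<Rightarrow> bool" where
  "helix_of_order c r k I \<gamma> \<longleftrightarrow> (\<exists>E. frenet_curve c r (\<lambda>i t. k i) E I \<gamma>)"

definition circle :: "real \<Rightarrow> real \<Rightarrow> real set \<Rightarrow> (real \<Rightarrow> ambient) \<Rightarrow> bool" where
  "circle c k1 I \<gamma> \<longleftrightarrow> helix_of_order c 2 (\<lambda>_. k1) I \<gamma>"

definition helix :: "real \<Rightarrow> real \<Rightarrow> real \<Rightarrow> real set \<Rightarrow> (real \<Rightarrow> ambient) \<Rightarrow> bool" where
  "helix c k1 k2 I \<gamma> \<longleftrightarrow> helix_of_order c 3 (\<lambda>i. if i = 1 then k1 else k2) I \<gamma>"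

definition helix_or_circle :: "real \<Rightarrow> real \<Rightarrow> real \<Rightarrow> real set \<Rightarrow> (real \<Rightarrow> ambient) \<Rightarrow> bool" where
  "helix_or_circle c k1 k2 I \<gamma> \<longleftrightarrow> (if k2 = 0 then circle c k1 I \<gamma> else helix c k1 k2 I \<gamma>)"

text \<open>
  \<open>F\<close> holds for every integral curve \<open>X \<circ> \<gamma>\<close> of the coordinate field \<open>df X _ w\<close>, defined on any
  nonempty open interval.
\<close>

definition integral_curves_satisfy :: "plane set \<Rightarrow> (plane \<Rightarrow> ambient) \<Rightarrow> plane \<Rightarrow>
    (real set \<Rightarrow> (real \<Rightarrow> ambient) \<Rightarrow> bool) \<Rightarrow> bool" where
  "integral_curves_satisfy D X w F \<longleftrightarrow>
     (\<forall>I \<gamma>. open I \<and> is_interval I \<and> I \<noteq> {} \<and> \<gamma> ` I \<subseteq> D \<and>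
        (\<forall>t\<in>I. (\<gamma> has_vector_derivative w) (at t)) \<longrightarrow> F I (X \<circ> \<gamma>))"

end

theory Submission
  imports Defs
begin

text \<open>
  The normal bundle is spanned by \<open>H\<close> and the normal part \<open>N\<close> of \<open>\<xi>\<close>, and since \<open>\<xi>\<close> is parallel,
  \<open>\<nabla>\<^sub>X T = A\<^sub>N X\<close>, while \<open>\<nabla>\<^sup>\<bottom>\<^sub>X H\<close> is the multiple \<open>\<langle>A\<^sub>H X, T\<rangle> / |N|\<^sup>2\<close> of \<open>N\<close>.  The biconservative equation thus reads
  \<open>A\<^sub>N A\<^sub>H T = 0\<close>.  As \<open>A\<^sub>N\<close> has trace zero, it is zero or invertible; the second case contradicts the
  Codazzi equation.  So \<open>A\<^sub>N = 0\<close>: the field \<open>T\<close> is parallel, the surface is flat, the Gauss equation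
  fixes \<open>det A\<^sub>H\<close>, hence the eigenvalues of \<open>A\<^sub>H\<close>, and Codazzi makes the eigendirections parallel.  They are
  the coordinate directions of flat coordinates, and their Frenet frames are \<open>X\<^sub>i, H/|H|, N/|N|\<close> up to
  sign.  All computations use the orthonormal frame \<open>T/|T|\<close>, a tangent \<open>e\<^sub>2\<close>, \<open>H/|H|\<close>, \<open>N/|N|\<close> and the normal of the
  quadric, as maps from the parameter plane into the flat space containing \<open>MxR c\<close>.
\<close>

section \<open>Calculus of smooth maps\<close>

text \<open>The Gauss and Codazzi equations need no general theory: each is the symmetry of the
  second derivative of a frame vector, viewed as a map into flat space and paired with another frame
  vector. A symmetric trace-free matrix of size two squares to a multiple of the identity, whence
  the alternative for \<open>A\<^sub>N\<close>.

  Diagonalising \<open>A\<^sub>H\<close> would break down at umbilic points. Instead its entries are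
  taken in the frame with first vector \<open>T/|T|\<close>, which is parallel once
  \<open>A\<^sub>N = 0\<close>. There Codazzi becomes a Cauchy-Riemann system for the entries and
  Gauss fixes the modulus of the resulting holomorphic function, so the entries are constant.

  A further obstacle is that one pair of constants must serve all charts, whose domains may be
  disconnected. The vector \<open>T\<close> is canonical, so |T| and \<langle>\<sigma>(T, T),
  H\<rangle> descend to the connected surface. The off-diagonal entry is determined only up to sign,
  because the second tangent vector is; a reflection of the principal basis absorbs this.\<close>

abbreviation dd :: "('a::real_normed_vector \<Rightarrow> 'b::real_normed_vector) \<Rightarrow> 'a \<Rightarrow> 'a \<Rightarrow> 'b" where
  "dd f x v \<equiv> frechet_derivative f (at x) v"

lemma dd_eqI: "(f has_derivative f') (at x) \<Longrightarrow> dd f x v = f' v"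
  using frechet_derivative_at by metis

lemma dd_works: "f differentiable at x \<Longrightarrow> (f has_derivative (\<lambda>v. dd f x v)) (at x)"
  using frechet_derivative_works by (metis eta_contract_eq)

text \<open>Equality holds even where neither map is differentiable:
  \<open>frechet_derivative\<close> is a choice among the derivatives at the point, and maps that
  agree nearby have the same derivatives there.\<close>

lemma dd_cong:
  assumes "open S" "x \<in> S" "\<And>y. y \<in> S \<Longrightarrow> f y = g y"
  shows "dd f x v = dd g x v"
  by (cases "f differentiable at x \<or> g differentiable at x")
    (smt (verit, ccfv_threshold) assms frechet_derivative_at has_derivative_transform_within_open
       frechet_derivative_works frechet_derivative_def Eps_cong)+

lemma differentiable_cong_open:
  assumes "f differentiable at x" "open S" "x \<in> S" "\<And>y. y \<in> S \<Longrightarrow> f y = g y"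
  shows "g differentiable at x"
  using assms has_derivative_transform_within_open unfolding differentiable_def by blast

lemma times_differentiable_on_cong:
  assumes "open S" "\<And>x. x \<in> S \<Longrightarrow> f x = g x" "times_differentiable_on n f S"
  shows "times_differentiable_on n g S"
  using assms(2,3)
proof (induction n arbitrary: f g)
  case 0
  then show ?case using continuous_on_cong by (metis times_differentiable_on.simps(1))
next
  case (Suc n)
  have "\<forall>x\<in>S. g differentiable at x"
    using Suc.prems differentiable_cong_open[OF _ assms(1)] by (metis times_differentiable_on.simps(2))
  moreover have "times_differentiable_on n (\<lambda>x. dd g x v) S" for v
  proof (rule Suc.IH[of "\<lambda>x. dd f x v"])
    show "dd f x v = dd g x v" if "x \<in> S" for x
      by (rule dd_cong[OF assms(1) that]) (rule Suc.prems(1))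
  qed (use Suc.prems in simp)
  ultimately show ?case by simp
qed

lemma smooth_on_cong:
  assumes "open S" "\<And>x. x \<in> S \<Longrightarrow> f x = g x" "smooth_on S f"
  shows "smooth_on S g"
  using assms times_differentiable_on_cong unfolding smooth_on_def by blast

lemma times_differentiable_on_pred:
  "times_differentiable_on (Suc n) f S \<Longrightarrow> times_differentiable_on n f S"
proof (induction n arbitrary: f)
  case 0
  then show ?case
    by (simp add: continuous_at_imp_continuous_on differentiable_imp_continuous_within)
next
  case (Suc n)
  then show ?case by (metis times_differentiable_on.simps(2))
qed

lemma times_differentiable_on_subset:
  "times_differentiable_on n f S \<Longrightarrow> T \<subseteq> S \<Longrightarrow> times_differentiable_on n f T"
  by (induction n arbitrary: f) (auto intro: continuous_on_subset)

lemma smooth_on_subset: "smooth_on S f \<Longrightarrow> T \<subseteq> S \<Longrightarrow> smooth_on T f"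
  using times_differentiable_on_subset unfolding smooth_on_def by blast

lemma smooth_on_dd: "smooth_on S f \<Longrightarrow> smooth_on S (\<lambda>x. dd f x v)"
  unfolding smooth_on_def by (metis times_differentiable_on.simps(2))

lemma smooth_on_differentiable: "smooth_on S f \<Longrightarrow> x \<in> S \<Longrightarrow> f differentiable (at x)"
  unfolding smooth_on_def by (metis times_differentiable_on.simps(2))

lemma smooth_on_has_derivative:
  "smooth_on S f \<Longrightarrow> x \<in> S \<Longrightarrow> (f has_derivative (\<lambda>v. dd f x v)) (at x)"
  using dd_works smooth_on_differentiable by blast

lemma smooth_on_linear:
  assumes "smooth_on S f" "x \<in> S"
  shows "bounded_linear (\<lambda>v. dd f x v)"
  using has_derivative_bounded_linear smooth_on_has_derivative[OF assms] by blast

lemma smooth_on_continuous: "smooth_on S f \<Longrightarrow> continuous_on S f"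
  unfolding smooth_on_def by (metis times_differentiable_on.simps(1))

text \<open>Differentiability together with order \<open>n\<close> for the directional derivatives
  is order \<open>n + 1\<close>, which contains order \<open>n\<close>. So a map is smooth as soon
  as its derivatives are recognised as smooth maps through an explicit formula.\<close>

lemma smooth_onI:
  assumes "\<And>x. x \<in> S \<Longrightarrow> f differentiable (at x)" "\<And>v. smooth_on S (\<lambda>x. dd f x v)"
  shows "smooth_on S f"
  unfolding smooth_on_def
proof
  fix n
  have "times_differentiable_on (Suc n) f S" using assms unfolding smooth_on_def by simp
  then show "times_differentiable_on n f S" by (rule times_differentiable_on_pred)
qed

lemma times_differentiable_on_const: "times_differentiable_on n (\<lambda>x. k) S"
  by (induction n arbitrary: k) auto

lemma smooth_on_const [simp]: "smooth_on S (\<lambda>x. k)"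
  by (simp add: smooth_on_def times_differentiable_on_const)

lemma smooth_on_bounded_linear:
  assumes "bounded_linear f" shows "smooth_on S f"
proof (rule smooth_onI)
  have d: "(f has_derivative f) (at x)" for x
    by (rule bounded_linear_imp_has_derivative[OF assms])
  show "f differentiable (at x)" for x using d unfolding differentiable_def by blast
  show "smooth_on S (\<lambda>x. dd f x v)" for v
    using dd_eqI[OF d] by simp
qed

lemma smooth_on_id [simp]: "smooth_on S (\<lambda>x. x)"
  by (rule smooth_on_bounded_linear) (rule bounded_linear_ident)

lemma times_differentiable_on_add:
  assumes "open S"
  shows "times_differentiable_on n f S \<Longrightarrow> times_differentiable_on n g S \<Longrightarrow>
    times_differentiable_on n (\<lambda>x. f x + g x) S"
proof (induction n arbitrary: f g)
  case 0 then show ?case by (simp add: continuous_on_add)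
next
  case (Suc n)
  have d: "((\<lambda>x. f x + g x) has_derivative (\<lambda>v. dd f x v + dd g x v)) (at x)" if "x \<in> S" for x
    using Suc.prems that by (auto intro!: has_derivative_add dd_works)
  have "times_differentiable_on n (\<lambda>x. dd (\<lambda>x. f x + g x) x v) S" for v
    by (rule times_differentiable_on_cong[OF assms _ Suc.IH[of "\<lambda>x. dd f x v" "\<lambda>x. dd g x v"]])
      (use d Suc.prems dd_eqI in fastforce)+
  moreover have "\<forall>x\<in>S. (\<lambda>x. f x + g x) differentiable at x"
    using d unfolding differentiable_def by blast
  ultimately show ?case by simp
qed

text \<open>One Leibniz rule for every product that occurs: scaling, multiplication, the Euclidean
  inner product and the indefinite form \<open>ip c\<close>.\<close>

lemma times_differentiable_on_bilinear:
  assumes "open S" and B: "bounded_bilinear B"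
  shows "times_differentiable_on n f S \<Longrightarrow> times_differentiable_on n g S \<Longrightarrow>
    times_differentiable_on n (\<lambda>x. B (f x) (g x)) S"
proof (induction n arbitrary: f g)
  case 0 then show ?case by (simp add: bounded_bilinear.continuous_on[OF B])
next
  case (Suc n)
  have d: "((\<lambda>x. B (f x) (g x)) has_derivative (\<lambda>v. B (f x) (dd g x v) + B (dd f x v) (g x))) (at x)"
    if "x \<in> S" for x
    using Suc.prems that by (auto intro!: bounded_bilinear.FDERIV[OF B] dd_works)
  have "times_differentiable_on n (\<lambda>x. dd (\<lambda>x. B (f x) (g x)) x v) S" for v
  proof (rule times_differentiable_on_cong[OF assms(1)])
    show "B (f x) (dd g x v) + B (dd f x v) (g x) = dd (\<lambda>x. B (f x) (g x)) x v" if "x \<in> S" for x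
      using dd_eqI[OF d[OF that]] by simp
    show "times_differentiable_on n (\<lambda>x. B (f x) (dd g x v) + B (dd f x v) (g x)) S"
      by (intro times_differentiable_on_add[OF assms(1)] Suc.IH)
        (use Suc.prems times_differentiable_on_pred in \<open>auto simp del: times_differentiable_on.simps(2)\<close>,
         (use Suc.prems in simp)+)
  qed
  moreover have "\<forall>x\<in>S. (\<lambda>x. B (f x) (g x)) differentiable at x"
    using d unfolding differentiable_def by blast
  ultimately show ?case by simp
qed

lemma times_differentiable_on_sum:
  assumes "open S" "\<And>b. b \<in> A \<Longrightarrow> times_differentiable_on n (f b) S"
  shows "times_differentiable_on n (\<lambda>x. \<Sum>b\<in>A. f b x) S"
  using assms(2)
  by (induction A rule: infinite_finite_induct)
    (auto intro: times_differentiable_on_add[OF assms(1)] times_differentiable_on_const)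

lemma dd_compose:
  assumes "g differentiable at x" "f differentiable at (g x)"
  shows "dd (\<lambda>x. f (g x)) x v = dd f (g x) (dd g x v)"
  by (rule dd_eqI) (use has_derivative_compose[OF dd_works[OF assms(1)] dd_works[OF assms(2)]] in auto)

lemma dd_basis:
  fixes f :: "'b::euclidean_space \<Rightarrow> 'c::real_normed_vector"
  assumes "f differentiable at y"
  shows "dd f y v = (\<Sum>b\<in>Basis. (v \<bullet> b) *\<^sub>R dd f y b)"
proof -
  have l: "linear (\<lambda>v. dd f y v)"
    using linear_frechet_derivative[OF assms] by simp
  have "dd f y v = dd f y (\<Sum>b\<in>Basis. (v \<bullet> b) *\<^sub>R b)"
    by (simp add: euclidean_representation)
  also have "\<dots> = (\<Sum>b\<in>Basis. (v \<bullet> b) *\<^sub>R dd f y b)"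
    by (simp add: linear_sum[OF l] linear_cmul[OF l])
  finally show ?thesis .
qed

text \<open>The differentiability class only records derivatives in fixed directions, while the
  chain rule evaluates the derivative of \<open>f\<close> in the moving direction
  \<open>dd g x v\<close>. Expanding that direction in a basis of the intermediate space restores
  fixed directions.\<close>

lemma times_differentiable_on_compose:
  fixes g :: "'a::real_normed_vector \<Rightarrow> 'b::euclidean_space" and f :: "'b \<Rightarrow> 'c::real_normed_vector"
  assumes "open S" "g ` S \<subseteq> T"
  shows "times_differentiable_on n f T \<Longrightarrow> times_differentiable_on n g S \<Longrightarrow>
    times_differentiable_on n (\<lambda>x. f (g x)) S"
proof (induction n arbitrary: f)
  case 0 then show ?case using assms(2) by (auto intro: continuous_on_compose2)
next
  case (Suc n)
  have d: "g differentiable at x" "f differentiable at (g x)" if "x \<in> S" for x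
    using Suc.prems that assms(2) by auto
  have "times_differentiable_on n (\<lambda>x. dd (\<lambda>x. f (g x)) x v) S" for v
  proof (rule times_differentiable_on_cong[OF assms(1)])
    show "(\<Sum>b\<in>Basis. (dd g x v \<bullet> b) *\<^sub>R dd f (g x) b) = dd (\<lambda>x. f (g x)) x v" if "x \<in> S" for x
      using dd_compose[OF d[OF that]] dd_basis[OF d(2)[OF that]] by metis
    show "times_differentiable_on n (\<lambda>x. \<Sum>b\<in>Basis. (dd g x v \<bullet> b) *\<^sub>R dd f (g x) b) S"
    proof (intro times_differentiable_on_sum[OF assms(1)]
        times_differentiable_on_bilinear[OF assms(1) bounded_bilinear_scaleR]
        times_differentiable_on_bilinear[OF assms(1) bounded_bilinear_inner]
        times_differentiable_on_const Suc.IH times_differentiable_on_pred[OF Suc.prems(2)])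
    qed (use Suc.prems in simp_all)
  qed
  moreover have "\<forall>x\<in>S. (\<lambda>x. f (g x)) differentiable at x"
    using d differentiable_compose by blast
  ultimately show ?case by simp
qed

lemma smooth_on_compose:
  fixes g :: "'a::real_normed_vector \<Rightarrow> 'b::euclidean_space" and f :: "'b \<Rightarrow> 'c::real_normed_vector"
  assumes "smooth_on T f" "smooth_on S g" "open S" "g ` S \<subseteq> T"
  shows "smooth_on S (\<lambda>x. f (g x))"
  using assms times_differentiable_on_compose unfolding smooth_on_def by blast

lemma smooth_on_add:
  "open S \<Longrightarrow> smooth_on S f \<Longrightarrow> smooth_on S g \<Longrightarrow> smooth_on S (\<lambda>x. f x + g x)"
  using times_differentiable_on_add unfolding smooth_on_def by blast

lemma smooth_on_bilinear:
  "bounded_bilinear B \<Longrightarrow> open S \<Longrightarrow> smooth_on S f \<Longrightarrow> smooth_on S g \<Longrightarrow> smooth_on S (\<lambda>x. B (f x) (g x))"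
  using times_differentiable_on_bilinear unfolding smooth_on_def by blast

lemmas smooth_on_scaleR = smooth_on_bilinear[OF bounded_bilinear_scaleR]
lemmas smooth_on_mult = smooth_on_bilinear[OF bounded_bilinear_mult]

lemma smooth_on_minus: "open S \<Longrightarrow> smooth_on S f \<Longrightarrow> smooth_on S (\<lambda>x. - f x)"
  using smooth_on_scaleR[of S "\<lambda>_. -1" f] by simp

lemma smooth_on_diff:
  "open S \<Longrightarrow> smooth_on S f \<Longrightarrow> smooth_on S g \<Longrightarrow> smooth_on S (\<lambda>x. f x - g x)"
  using smooth_on_add[OF _ _ smooth_on_minus] by fastforce

text \<open>A linear map is a bilinear map whose scalar argument is frozen at 1.\<close>

lemma smooth_on_linear_image:
  assumes "bounded_linear L" "open S" "smooth_on S f" shows "smooth_on S (\<lambda>x. L (f x))"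
proof -
  have B: "bounded_bilinear (\<lambda>(r::real) v. r *\<^sub>R L v)"
    using bounded_bilinear.comp[OF bounded_bilinear_scaleR bounded_linear_ident assms(1)] .
  show ?thesis using smooth_on_bilinear[OF B assms(2) smooth_on_const[of S 1] assms(3)] by simp
qed

lemma smooth_on_Pair:
  assumes "open S" "smooth_on S f" "smooth_on S g" shows "smooth_on S (\<lambda>x. (f x, g x))"
proof -
  have "smooth_on S (\<lambda>x. (f x, 0) + (0, g x))"
    by (intro smooth_on_add assms(1) smooth_on_linear_image[OF _ assms(1,2)]
        smooth_on_linear_image[OF _ assms(1,3)] bounded_linear_Pair bounded_linear_ident bounded_linear_zero)
  then show ?thesis by simp
qed

text \<open>The derivative is a polynomial in the inverse itself, so each order follows from the
  previous one.\<close>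

lemma times_differentiable_on_inverse:
  "times_differentiable_on n (inverse :: real \<Rightarrow> real) (-{0})"
proof (induction n)
  case 0 show ?case by (auto intro!: continuous_intros)
next
  case (Suc n)
  have o: "open (-{0::real})" by auto
  have d: "(inverse has_derivative (\<lambda>v. v * - (inverse x * inverse x))) (at x)" if "x \<noteq> 0" for x::real
    using that by (auto intro!: derivative_eq_intros)
  have "times_differentiable_on n (\<lambda>x. dd inverse x v) (-{0::real})" for v
  proof (rule times_differentiable_on_cong[OF o])
    show "v * (- 1 * (inverse x * inverse x)) = dd inverse x v" if "x \<in> -{0}" for x
      using dd_eqI[OF d] that by simp
    show "times_differentiable_on n (\<lambda>x. v * (- 1 * (inverse x * inverse x))) (-{0})"
      by (intro times_differentiable_on_bilinear[OF o bounded_bilinear_mult] times_differentiable_on_const Suc)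
  qed
  moreover have "\<forall>x\<in>-{0}. inverse differentiable at (x::real)"
    using d unfolding differentiable_def by blast
  ultimately show ?case by simp
qed

lemma smooth_on_inverse:
  fixes f :: "'a::real_normed_vector \<Rightarrow> real"
  assumes "open S" "smooth_on S f" "\<And>x. x \<in> S \<Longrightarrow> f x \<noteq> 0"
  shows "smooth_on S (\<lambda>x. inverse (f x))"
  by (rule smooth_on_compose[where T="-{0}"])
    (use assms times_differentiable_on_inverse in \<open>auto simp: smooth_on_def\<close>)

lemma smooth_on_divide:
  fixes f :: "'a::real_normed_vector \<Rightarrow> real"
  assumes "open S" "smooth_on S f" "smooth_on S g" "\<And>x. x \<in> S \<Longrightarrow> g x \<noteq> 0"
  shows "smooth_on S (\<lambda>x. f x / g x)"
  unfolding divide_inverse using assms by (intro smooth_on_mult smooth_on_inverse) auto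

text \<open>The derivative is half the inverse of the square root itself, so the induction closes
  with the smoothness of inversion.\<close>

lemma times_differentiable_on_sqrt: "times_differentiable_on n sqrt {0<..}"
proof (induction n)
  case 0 show ?case by (auto intro!: continuous_intros)
next
  case (Suc n)
  have o: "open ({0<..}::real set)" by auto
  have d: "(sqrt has_derivative (\<lambda>v. v * (inverse (sqrt x) / 2))) (at x)" if "x > 0" for x
    using that by (auto intro!: derivative_eq_intros simp: field_simps)
  have "times_differentiable_on n (\<lambda>x. dd sqrt x v) {0<..}" for v
  proof (rule times_differentiable_on_cong[OF o])
    show "v / 2 * inverse (sqrt x) = dd sqrt x v" if "x \<in> {0<..}" for x
      using dd_eqI[OF d] that by simp
    show "times_differentiable_on n (\<lambda>x. v / 2 * inverse (sqrt x)) {0<..}"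
      by (intro times_differentiable_on_bilinear[OF o bounded_bilinear_mult] times_differentiable_on_const
        times_differentiable_on_compose[OF o _ times_differentiable_on_inverse Suc]) auto
  qed
  moreover have "\<forall>x\<in>{0<..}. sqrt differentiable at x"
    using d unfolding differentiable_def by blast
  ultimately show ?case by simp
qed

lemma smooth_on_sqrt:
  assumes "open S" "smooth_on S f" "\<And>x. x \<in> S \<Longrightarrow> f x > 0"
  shows "smooth_on S (\<lambda>x. sqrt (f x))"
  by (rule smooth_on_compose[where T="{0<..}"])
    (use assms times_differentiable_on_sqrt in \<open>auto simp: smooth_on_def\<close>)

lemma dd_linear:
  assumes "f differentiable at x"
  shows "dd f x (v + w) = dd f x v + dd f x w" "dd f x (r *\<^sub>R v) = r *\<^sub>R dd f x v"
    "dd f x (v - w) = dd f x v - dd f x w" "dd f x 0 = 0" "dd f x (- v) = - dd f x v"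
  using linear_frechet_derivative[OF assms]
  by (auto simp: linear_add linear_cmul linear_diff linear_0 linear_neg)

lemma dd_add:
  assumes "f differentiable at x" "g differentiable at x"
  shows "dd (\<lambda>y. f y + g y) x v = dd f x v + dd g x v"
  by (rule dd_eqI) (auto intro!: has_derivative_add dd_works assms)

lemma dd_diff:
  assumes "f differentiable at x" "g differentiable at x"
  shows "dd (\<lambda>y. f y - g y) x v = dd f x v - dd g x v"
  by (rule dd_eqI) (auto intro!: has_derivative_diff dd_works assms)

lemma dd_bilinear:
  assumes "bounded_bilinear B" "f differentiable at x" "g differentiable at x"
  shows "dd (\<lambda>y. B (f y) (g y)) x v = B (dd f x v) (g x) + B (f x) (dd g x v)"
  by (subst dd_eqI[OF bounded_bilinear.FDERIV[OF assms(1) dd_works[OF assms(2)] dd_works[OF assms(3)]]])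
    (rule add.commute)

lemmas dd_scaleR = dd_bilinear[OF bounded_bilinear_scaleR]
lemmas dd_mult = dd_bilinear[OF bounded_bilinear_mult]

lemma dd_linear_image:
  assumes "bounded_linear L" "f differentiable at x"
  shows "dd (\<lambda>y. L (f y)) x v = L (dd f x v)"
  by (rule dd_eqI) (use bounded_linear.has_derivative[OF assms(1) dd_works[OF assms(2)]] in auto)

lemma dd_line:
  assumes "f differentiable at (x + r *\<^sub>R v)"
  shows "((\<lambda>r. f (x + r *\<^sub>R v)) has_vector_derivative dd f (x + r *\<^sub>R v) v) (at r)"
proof -
  have "((\<lambda>r. x + r *\<^sub>R v) has_derivative (\<lambda>h. h *\<^sub>R v)) (at r)"
    by (auto intro!: derivative_eq_intros)
  from has_derivative_compose[OF this dd_works[OF assms]]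
  show ?thesis unfolding has_vector_derivative_def by (simp add: dd_linear(2)[OF assms])
qed

section \<open>Symmetry of second derivatives\<close>

text \<open>Two applications of the mean value theorem: in direction \<open>v\<close> to the
  increment of \<open>f\<close> along \<open>s *\<^sub>R w\<close>, then in direction
  \<open>w\<close> to the derivative along \<open>v\<close>.\<close>

lemma second_difference:
  fixes f :: "'a::real_normed_vector \<Rightarrow> real"
  assumes S: "smooth_on S f" and s: "s > 0"
    and sub: "\<And>a b. 0 \<le> a \<Longrightarrow> a \<le> s \<Longrightarrow> 0 \<le> b \<Longrightarrow> b \<le> s \<Longrightarrow> x + a *\<^sub>R v + b *\<^sub>R w \<in> S"
  shows "\<exists>a b. 0 \<le> a \<and> a \<le> s \<and> 0 \<le> b \<and> b \<le> s \<and>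
    f (x + s *\<^sub>R v + s *\<^sub>R w) - f (x + s *\<^sub>R v) - f (x + s *\<^sub>R w) + f x =
    s * s * dd (\<lambda>y. dd f y v) (x + a *\<^sub>R v + b *\<^sub>R w) w"
proof -
  let ?g = "\<lambda>r. f (x + s *\<^sub>R w + r *\<^sub>R v) - f (x + r *\<^sub>R v)"
  have dg: "DERIV ?g r :> dd f (x + s *\<^sub>R w + r *\<^sub>R v) v - dd f (x + r *\<^sub>R v) v" if "0 \<le> r" "r \<le> s" for r
  proof -
    have "x + r *\<^sub>R v + s *\<^sub>R w \<in> S" "x + r *\<^sub>R v + 0 *\<^sub>R w \<in> S" using sub that s by force+
    then have "x + s *\<^sub>R w + r *\<^sub>R v \<in> S" "x + r *\<^sub>R v \<in> S" by (simp_all add: algebra_simps)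
    then show ?thesis unfolding has_real_derivative_iff_has_vector_derivative
      by (intro has_vector_derivative_diff dd_line smooth_on_differentiable[OF S])
  qed
  obtain a where a: "0 < a" "a < s"
      "?g s - ?g 0 = (s - 0) * (dd f (x + s *\<^sub>R w + a *\<^sub>R v) v - dd f (x + a *\<^sub>R v) v)"
    using MVT2[OF s dg] by auto
  have dk: "DERIV (\<lambda>r. dd f (x + a *\<^sub>R v + r *\<^sub>R w) v) r :> dd (\<lambda>y. dd f y v) (x + a *\<^sub>R v + r *\<^sub>R w) w"
    if "0 \<le> r" "r \<le> s" for r
    unfolding has_real_derivative_iff_has_vector_derivative
    by (rule dd_line[of "\<lambda>y. dd f y v"], rule smooth_on_differentiable[OF smooth_on_dd[OF S]])
      (use sub a that in auto)
  obtain b where b: "0 < b" "b < s"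
      "dd f (x + a *\<^sub>R v + s *\<^sub>R w) v - dd f (x + a *\<^sub>R v + 0 *\<^sub>R w) v
        = (s - 0) * dd (\<lambda>y. dd f y v) (x + a *\<^sub>R v + b *\<^sub>R w) w"
    using MVT2[OF s dk] by auto
  have "x + s *\<^sub>R w + a *\<^sub>R v = x + a *\<^sub>R v + s *\<^sub>R w" "x + s *\<^sub>R w + s *\<^sub>R v = x + s *\<^sub>R v + s *\<^sub>R w"
    by (simp_all add: algebra_simps)
  then show ?thesis using a b by (intro exI[of _ a] exI[of _ b]) (simp add: algebra_simps)
qed

text \<open>The second difference over a parallelogram does not distinguish the two sides. Read in
  either order it is \<open>s * s\<close> times a mixed derivative at some point of the
  parallelogram, and continuity compares these values with those at \<open>x\<close>.\<close>

lemma dd_symmetric_real: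
  fixes f :: "'a::real_normed_vector \<Rightarrow> real"
  assumes S: "open S" "smooth_on S f" and x: "x \<in> S"
  shows "dd (\<lambda>y. dd f y w) x v = dd (\<lambda>y. dd f y v) x w"
proof -
  let ?P = "\<lambda>y. dd (\<lambda>y. dd f y w) y v" and ?Q = "\<lambda>y. dd (\<lambda>y. dd f y v) y w"
  have cP: "continuous (at x) ?P" and cQ: "continuous (at x) ?Q"
    using smooth_on_continuous[OF smooth_on_dd[OF smooth_on_dd[OF S(2)]]] S(1) x
      continuous_on_eq_continuous_at by blast+
  have "\<bar>?P x - ?Q x\<bar> \<le> e" if e: "e > 0" for e
  proof -
    obtain r1 where r1: "r1 > 0" "\<And>y. dist y x < r1 \<Longrightarrow> \<bar>?P y - ?P x\<bar> < e / 2"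
      using cP e unfolding continuous_at_eps_delta dist_real_def by (metis half_gt_zero)
    obtain r2 where r2: "r2 > 0" "\<And>y. dist y x < r2 \<Longrightarrow> \<bar>?Q y - ?Q x\<bar> < e / 2"
      using cQ e unfolding continuous_at_eps_delta dist_real_def by (metis half_gt_zero)
    obtain r3 where r3: "r3 > 0" "ball x r3 \<subseteq> S" using S(1) x open_contains_ball by blast
    define r where "r = min r1 (min r2 r3)"
    have r: "r > 0" using r1 r2 r3 r_def by auto
    \<comment> \<open>The whole parallelogram with sides \<open>s *\<^sub>R v\<close> and
      \<open>s *\<^sub>R w\<close> then lies in the ball of radius \<open>r\<close>; the summand 1
      keeps the denominator positive.\<close>
    define s where "s = r / 2 / (norm v + norm w + 1)"
    have N: "norm v + norm w + 1 > 0" by (smt (verit) norm_ge_zero)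
    have s: "s > 0" using r N s_def by simp
    have near: "dist (x + a *\<^sub>R v + b *\<^sub>R w) x < r" if "0 \<le> a" "a \<le> s" "0 \<le> b" "b \<le> s" for a b
    proof -
      have "dist (x + a *\<^sub>R v + b *\<^sub>R w) x = norm (a *\<^sub>R v + b *\<^sub>R w)"
        by (simp add: dist_norm algebra_simps)
      also have "\<dots> \<le> a * norm v + b * norm w"
        using norm_triangle_ineq[of "a *\<^sub>R v" "b *\<^sub>R w"] that by simp
      also have "\<dots> \<le> s * norm v + s * norm w"
        using that by (intro add_mono mult_right_mono) auto
      also have "\<dots> \<le> s * (norm v + norm w + 1)" using s by (simp add: algebra_simps)
      also have "\<dots> = r / 2" using N unfolding s_def by (metis nonzero_divide_eq_eq order_less_irrefl)
      also have "\<dots> < r" using r by simp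
      finally show ?thesis .
    qed
    have inS: "x + a *\<^sub>R v + b *\<^sub>R w \<in> S" "x + b *\<^sub>R w + a *\<^sub>R v \<in> S"
      if "0 \<le> a" "a \<le> s" "0 \<le> b" "b \<le> s" for a b
    proof -
      show "x + a *\<^sub>R v + b *\<^sub>R w \<in> S" using near[OF that] r3 r_def by (auto simp: dist_commute subset_iff)
      then show "x + b *\<^sub>R w + a *\<^sub>R v \<in> S" by (simp add: algebra_simps)
    qed
    obtain a b where ab: "0 \<le> a" "a \<le> s" "0 \<le> b" "b \<le> s"
      "f (x + s *\<^sub>R v + s *\<^sub>R w) - f (x + s *\<^sub>R v) - f (x + s *\<^sub>R w) + f x = s * s * ?Q (x + a *\<^sub>R v + b *\<^sub>R w)"
      using second_difference[OF S(2) s inS(1)] by blast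
    obtain a' b' where ab': "0 \<le> a'" "a' \<le> s" "0 \<le> b'" "b' \<le> s"
      "f (x + s *\<^sub>R w + s *\<^sub>R v) - f (x + s *\<^sub>R w) - f (x + s *\<^sub>R v) + f x = s * s * ?P (x + a' *\<^sub>R w + b' *\<^sub>R v)"
      using second_difference[OF S(2) s inS(2)] by blast
    have com: "x + s *\<^sub>R w + s *\<^sub>R v = x + s *\<^sub>R v + s *\<^sub>R w" by (simp add: algebra_simps)
    then have "s * s * ?Q (x + a *\<^sub>R v + b *\<^sub>R w) = s * s * ?P (x + a' *\<^sub>R w + b' *\<^sub>R v)"
      using ab(5) ab'(5)[unfolded com] by linarith
    then have eq: "?Q (x + a *\<^sub>R v + b *\<^sub>R w) = ?P (x + a' *\<^sub>R w + b' *\<^sub>R v)" using s by simp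
    have "x + a' *\<^sub>R w + b' *\<^sub>R v = x + b' *\<^sub>R v + a' *\<^sub>R w" by (simp add: algebra_simps)
    then have "dist (x + a' *\<^sub>R w + b' *\<^sub>R v) x < r" using near[OF ab'(3,4,1,2)] by metis
    then have "\<bar>?P (x + a' *\<^sub>R w + b' *\<^sub>R v) - ?P x\<bar> < e / 2" using r1 r_def by simp
    moreover have "\<bar>?Q (x + a *\<^sub>R v + b *\<^sub>R w) - ?Q x\<bar> < e / 2" using near[OF ab(1-4)] r2 r_def by simp
    ultimately show ?thesis using eq by linarith
  qed
  then have "\<bar>?P x - ?Q x\<bar> \<le> 0" by (rule field_le_epsilon) auto
  then show ?thesis by simp
qed

lemma dd_symmetric:
  fixes f :: "'a::real_normed_vector \<Rightarrow> 'b::euclidean_space"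
  assumes S: "open S" "smooth_on S f" and x: "x \<in> S"
  shows "dd (\<lambda>y. dd f y w) x v = dd (\<lambda>y. dd f y v) x w"
proof (rule euclidean_eqI)
  fix b :: 'b assume "b \<in> Basis"
  have L: "bounded_linear (\<lambda>v. v \<bullet> b)" by (rule bounded_linear_inner_left)
  have *: "dd (\<lambda>y. dd f y w) x v \<bullet> b = dd (\<lambda>y. dd (\<lambda>y. f y \<bullet> b) y w) x v" for v w
  proof -
    have "dd (\<lambda>y. dd f y w) x v \<bullet> b = dd (\<lambda>y. dd f y w \<bullet> b) x v"
      using dd_linear_image[OF L smooth_on_differentiable[OF smooth_on_dd[OF S(2)] x]] by simp
    also have "\<dots> = dd (\<lambda>y. dd (\<lambda>y. f y \<bullet> b) y w) x v"
      by (rule dd_cong[OF S(1) x]) (simp add: dd_linear_image[OF L smooth_on_differentiable[OF S(2)]])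
    finally show ?thesis .
  qed
  show "dd (\<lambda>y. dd f y w) x v \<bullet> b = dd (\<lambda>y. dd f y v) x w \<bullet> b"
    unfolding * by (rule dd_symmetric_real[OF S(1) smooth_on_linear_image[OF L S] x])
qed

section \<open>The Poincare lemma and a smooth inverse function theorem\<close>

text \<open>The primitive is the integral of the form along the segment from the centre
  \<open>x0\<close>, differentiated under the integral sign.\<close>

lemma closed_form_exact:
  fixes \<theta> :: "'a::euclidean_space \<Rightarrow> 'a \<Rightarrow> real"
  assumes lin: "\<And>y. y \<in> ball x0 r \<Longrightarrow> linear (\<theta> y)"
    and sm: "\<And>v. smooth_on (ball x0 r) (\<lambda>y. \<theta> y v)"
    and closed: "\<And>y v w. y \<in> ball x0 r \<Longrightarrow> dd (\<lambda>y. \<theta> y w) y v = dd (\<lambda>y. \<theta> y v) y w"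
  shows "\<exists>F. \<forall>y\<in>ball x0 r. (F has_derivative \<theta> y) (at y)"
proof -
  let ?U = "ball x0 r"
  let ?c = "\<lambda>(y::'a) (t::real). x0 + t *\<^sub>R (y - x0)"
  define g where "g y t = (\<Sum>b\<in>Basis. ((y - x0) \<bullet> b) * \<theta> (?c y t) b)" for y t
  define g' where "g' y t v = (\<Sum>b\<in>Basis. ((y - x0) \<bullet> b) * (t * dd (\<lambda>y. \<theta> y b) (?c y t) v)
       + (v \<bullet> b) * \<theta> (?c y t) b)" for y t and v :: 'a
  have inU: "?c y t \<in> ?U" if "y \<in> ?U" "t \<in> cbox 0 1" for y t
  proof -
    have "dist x0 (?c y t) = \<bar>t\<bar> * dist x0 y" by (simp add: dist_norm norm_minus_commute)
    also have "\<dots> \<le> 1 * dist x0 y" using that by (intro mult_right_mono) auto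
    finally show ?thesis using that(1) by simp
  qed
  have dth: "((\<lambda>y. \<theta> y b) has_derivative (\<lambda>v. dd (\<lambda>y. \<theta> y b) y v)) (at y)" if "y \<in> ?U" for b y
    by (rule smooth_on_has_derivative[OF sm that])
  have dg: "((\<lambda>y. g y t) has_derivative g' y t) (at y)" if yt: "y \<in> ?U" "t \<in> cbox 0 1" for y t
    unfolding g_def g'_def
  proof (rule has_derivative_sum)
    fix b :: 'a
    have 1: "((\<lambda>y. (y - x0) \<bullet> b) has_derivative (\<lambda>v. v \<bullet> b)) (at y)"
      by (auto intro!: derivative_eq_intros)
    have c: "((\<lambda>y. ?c y t) has_derivative (\<lambda>v. t *\<^sub>R v)) (at y)"
      by (auto intro!: derivative_eq_intros)
    have "((\<lambda>y. \<theta> (?c y t) b) has_derivative (\<lambda>v. t * dd (\<lambda>y. \<theta> y b) (?c y t) v)) (at y)"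
      using has_derivative_compose[OF c dth[OF inU[OF yt]]]
      by (simp add: dd_linear(2)[OF smooth_on_differentiable[OF sm inU[OF yt]]])
    from has_derivative_mult[OF 1 this]
    show "((\<lambda>y. ((y - x0) \<bullet> b) * \<theta> (?c y t) b) has_derivative
      (\<lambda>v. (y - x0) \<bullet> b * (t * dd (\<lambda>y. \<theta> y b) (?c y t) v) + (v \<bullet> b) * \<theta> (?c y t) b)) (at y)" .
  qed
  have ap: "blinfun_apply (Blinfun (g' y t)) = g' y t" if "y \<in> ?U" "t \<in> cbox 0 1" for y t
    by (rule bounded_linear_Blinfun_apply[OF has_derivative_bounded_linear[OF dg[OF that]]])
  have cc: "continuous_on (?U \<times> cbox 0 1) (\<lambda>p. h (?c (fst p) (snd p)))"
    if "continuous_on ?U h" for h :: "'a \<Rightarrow> real"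
    by (rule continuous_on_compose2[OF that]) (use inU in \<open>auto intro!: continuous_intros\<close>)
  have cg': "continuous_on (?U \<times> cbox 0 1) (\<lambda>p. g' (fst p) (snd p) v)" for v
    unfolding g'_def
    by (intro continuous_intros cc[OF smooth_on_continuous] smooth_on_dd sm)
  have cg: "continuous_on (cbox 0 1) (g y)" if "y \<in> ?U" for y
    unfolding g_def
    by (intro continuous_intros continuous_on_compose2[OF smooth_on_continuous[OF sm]])
      (use inU that in auto)
  have ftc: "((\<lambda>t. g' y t v) has_integral \<theta> y v) (cbox 0 1)" if y: "y \<in> ?U" for y v
  proof -
    \<comment> \<open>Closedness exchanges \<open>v\<close> with the direction of the segment. The
      differentiated integrand thereby becomes a total derivative in \<open>t\<close>, which
      integrates to the value of the form at \<open>y\<close>.\<close>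
    have "((\<lambda>t. t * \<theta> (?c y t) v) has_vector_derivative g' y t v) (at t within {0..1})"
      if t: "t \<in> {0..1}" for t
    proof -
      let ?p = "?c y t"
      have p: "?p \<in> ?U" using inU[OF y] t by simp
      have "((\<lambda>t. \<theta> (?c y t) v) has_vector_derivative dd (\<lambda>y. \<theta> y v) ?p (y - x0)) (at t within {0..1})"
        by (rule has_vector_derivative_at_within[OF dd_line]) (rule smooth_on_differentiable[OF sm p])
      then have "((\<lambda>t. t * \<theta> (?c y t) v) has_vector_derivative
          t * dd (\<lambda>y. \<theta> y v) ?p (y - x0) + 1 * \<theta> ?p v) (at t within {0..1})"
        by (intro has_vector_derivative_mult has_vector_derivative_id)
      moreover have "(\<Sum>b\<in>Basis. (v \<bullet> b) * \<theta> ?p b) = \<theta> ?p v"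
        using linear_sum[OF lin[OF p], of "\<lambda>b. (v \<bullet> b) *\<^sub>R b" Basis]
        by (simp add: euclidean_representation linear_cmul[OF lin[OF p]])
      moreover have "(\<Sum>b\<in>Basis. ((y - x0) \<bullet> b) * (t * dd (\<lambda>y. \<theta> y b) ?p v))
          = t * dd (\<lambda>y. \<theta> y v) ?p (y - x0)"
        using dd_basis[OF smooth_on_differentiable[OF sm p], of v "y - x0"] closed[OF p]
        by (simp add: sum_distrib_left mult.left_commute)
      ultimately show ?thesis by (simp add: g'_def sum.distrib)
    qed
    from fundamental_theorem_of_calculus[OF _ this] show ?thesis by simp
  qed
  have "((\<lambda>y. integral (cbox 0 1) (g y)) has_derivative \<theta> y) (at y)" if y: "y \<in> ?U" for y
  proof -
    \<comment> \<open>The Leibniz rule wants the derivative to be continuous as an operator; in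
      finite dimension this can be checked vector by vector.\<close>
    have cB: "continuous_on (?U \<times> cbox 0 1) (\<lambda>(y, t). Blinfun (g' y t))"
    proof (rule continuous_on_blinfun_componentwise)
      fix i :: 'a
      show "continuous_on (?U \<times> cbox 0 1) (\<lambda>p. blinfun_apply (case p of (y, t) \<Rightarrow> Blinfun (g' y t)) i)"
        by (rule continuous_on_eq[OF cg'[of i]]) (auto simp: ap)
    qed
    have "((\<lambda>y. integral (cbox 0 1) (g y)) has_derivative
        integral (cbox 0 1) (\<lambda>t. Blinfun (g' y t))) (at y within ?U)"
    proof (rule leibniz_rule[OF _ _ cB y])
      show "((\<lambda>y. g y t) has_derivative blinfun_apply (Blinfun (g' y t))) (at y within ?U)"
        if "y \<in> ?U" "t \<in> cbox 0 1" for y t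
        using dg[OF that] ap[OF that] has_derivative_at_withinI by fastforce
      show "g y integrable_on cbox 0 1" if "y \<in> ?U" for y
        by (rule integrable_continuous[OF cg[OF that]])
    qed simp
    moreover have "blinfun_apply (integral (cbox 0 1) (\<lambda>t. Blinfun (g' y t))) = \<theta> y"
    proof
      fix v
      have "continuous_on (cbox 0 1) (\<lambda>t. Blinfun (g' y t))"
        using continuous_on_compose2[OF cB, of "cbox 0 1" "\<lambda>t. (y, t)"] y by (force intro!: continuous_intros)
      then have "blinfun_apply (integral (cbox 0 1) (\<lambda>t. Blinfun (g' y t))) v
          = integral (cbox 0 1) (\<lambda>t. blinfun_apply (Blinfun (g' y t)) v)"
        by (intro blinfun_apply_integral integrable_continuous)
      also have "\<dots> = integral (cbox 0 1) (\<lambda>t. g' y t v)"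
        by (rule integral_cong) (simp add: ap[OF y])
      also have "\<dots> = \<theta> y v" using ftc[OF y] by blast
      finally show "blinfun_apply (integral (cbox 0 1) (\<lambda>t. Blinfun (g' y t))) v = \<theta> y v" .
    qed
    ultimately show ?thesis using at_within_open[OF y] by simp
  qed
  then show ?thesis by blast
qed

text \<open>The right inverse \<open>R\<close> of the differential is an input because it is
  explicit in the application, being the frame dual to the closed coframe. It replaces a proof that
  inversion of operators is smooth.\<close>

lemma smooth_local_inverse:
  fixes F :: "'a::euclidean_space \<Rightarrow> 'a"
  assumes U: "open U" "smooth_on U F" "x0 \<in> U"
    and R: "\<And>v. smooth_on U (\<lambda>x. R x v)" "\<And>x v. x \<in> U \<Longrightarrow> dd F x (R x v) = v"
  obtains U' V G where "open U'" "x0 \<in> U'" "U' \<subseteq> U" "open V" "homeomorphism U' V F G"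
    "smooth_on V G" "\<And>y v. y \<in> V \<Longrightarrow> dd G y v = R (G y) v"
proof -
  define F' where "F' x = Blinfun (\<lambda>v. dd F x v)" for x
  have F': "blinfun_apply (F' x) = (\<lambda>v. dd F x v)" if "x \<in> U" for x
    unfolding F'_def by (rule bounded_linear_Blinfun_apply[OF smooth_on_linear[OF U(2) that]])
  have cF: "continuous_on U F'"
  proof (rule continuous_on_blinfun_componentwise)
    fix i :: 'a
    have "continuous_on U (\<lambda>x. dd F x i)" by (rule smooth_on_continuous[OF smooth_on_dd[OF U(2)]])
    then show "continuous_on U (\<lambda>x. blinfun_apply (F' x) i)"
      by (rule continuous_on_eq) (simp add: F')
  qed
  have Fd: "(F has_derivative blinfun_apply (F' x)) (at x)" if "x \<in> U" for x
    using smooth_on_has_derivative[OF U(2) that] F'[OF that] by simp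
  have bij: "bij (\<lambda>v. dd F x v)" and invR: "inv (\<lambda>v. dd F x v) = R x" if "x \<in> U" for x
  proof -
    have l: "linear (\<lambda>v. dd F x v)" using smooth_on_linear[OF U(2) that] bounded_linear.linear by blast
    have s: "surj (\<lambda>v. dd F x v)" using R(2)[OF that] by (metis surjI)
    show "bij (\<lambda>v. dd F x v)" using linear_surjective_imp_injective[OF l] s by (auto simp: bij_def)
    then show "inv (\<lambda>v. dd F x v) = R x" using R(2)[OF that]
      by (intro ext) (metis (no_types, lifting) bij_inv_eq_iff)
  qed
  have bR: "bounded_linear (R x0)"
    using bij[OF U(3)] invR[OF U(3)] smooth_on_linear[OF U(2,3)]
    by (metis bounded_linear.linear inj_linear_imp_inv_linear linear_conv_bounded_linear bij_def)
  have inv0: "Blinfun (R x0) o\<^sub>L F' x0 = id_blinfun"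
  proof (rule blinfun_eqI)
    fix i
    have "R x0 (dd F x0 i) = i" using bij[OF U(3)] invR[OF U(3)] by (metis bij_inv_eq_iff)
    then show "blinfun_apply (Blinfun (R x0) o\<^sub>L F' x0) i = blinfun_apply id_blinfun i"
      by (simp add: F'[OF U(3)] bounded_linear_Blinfun_apply[OF bR])
  qed
  obtain U' V G G' where *: "open U'" "U' \<subseteq> U" "x0 \<in> U'" "open V" "F x0 \<in> V" "homeomorphism U' V F G"
    "\<And>y. y \<in> V \<Longrightarrow> (G has_derivative (G' y)) (at y)"
    "\<And>y. y \<in> V \<Longrightarrow> G' y = inv (blinfun_apply (F'(G y)))"
    using inverse_function_theorem[OF U(1) Fd cF U(3) inv0] by metis
  have GU: "G y \<in> U" if "y \<in> V" for y using *(2,6) that unfolding homeomorphism_def by blast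
  have dG: "dd G y v = R (G y) v" if "y \<in> V" for y v
    using dd_eqI[OF *(7)[OF that]] *(8)[OF that] F'[OF GU[OF that]] invR[OF GU[OF that]] by simp
  \<comment> \<open>Bootstrapping: the derivative of \<open>G\<close> is \<open>R\<close> evaluated
    along \<open>G\<close>, so order \<open>n\<close> of \<open>G\<close> yields order
    \<open>n + 1\<close>.\<close>
  have "times_differentiable_on n G V" for n
  proof (induction n)
    case 0 show ?case using *(6) by (simp add: homeomorphism_def)
  next
    case (Suc n)
    have "times_differentiable_on n (\<lambda>x. dd G x v) V" for v
    proof (rule times_differentiable_on_cong[OF *(4)])
      show "R (G y) v = dd G y v" if "y \<in> V" for y using dG[OF that] by simp
      show "times_differentiable_on n (\<lambda>y. R (G y) v) V"
        by (rule times_differentiable_on_compose[OF *(4) _ _ Suc, of U "\<lambda>x. R x v"])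
          (use GU R(1) in \<open>auto simp: smooth_on_def\<close>)
    qed
    then show ?case using *(7) by (auto simp: differentiable_def)
  qed
  then have "smooth_on V G" by (simp add: smooth_on_def)
  then show ?thesis using that *(1-6) dG by blast
qed

section \<open>The ambient form\<close>

lemma ip_bounded_bilinear: "bounded_bilinear (ip c)"
  unfolding bilinear_conv_bounded_bilinear[symmetric] bilinear_def ip_def ipM_def
  by (auto intro!: linearI simp: algebra_simps inner_add_left inner_add_right)

lemma ip_sym: "ip c v w = ip c w v"
  by (simp add: ip_def ipM_def inner_commute mult.commute)

lemmas ip_simps [simp] = bounded_bilinear.add_left[OF ip_bounded_bilinear]
  bounded_bilinear.add_right[OF ip_bounded_bilinear] bounded_bilinear.diff_left[OF ip_bounded_bilinear]
  bounded_bilinear.diff_right[OF ip_bounded_bilinear] bounded_bilinear.minus_left[OF ip_bounded_bilinear]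
  bounded_bilinear.minus_right[OF ip_bounded_bilinear] bounded_bilinear.zero_left[OF ip_bounded_bilinear]
  bounded_bilinear.zero_right[OF ip_bounded_bilinear] bounded_bilinear.scaleR_left[OF ip_bounded_bilinear]
  bounded_bilinear.scaleR_right[OF ip_bounded_bilinear]

lemma ip_\<xi> [simp]: "ip c w \<xi> = snd w" "ip c \<xi> w = snd w"
  by (simp_all add: ip_def ipM_def \<xi>_def)

lemma snd_\<xi> [simp]: "snd \<xi> = 1"
  by (simp add: \<xi>_def)

lemmas smooth_on_ip = smooth_on_bilinear[OF ip_bounded_bilinear]
lemmas dd_ip = dd_bilinear[OF ip_bounded_bilinear]

text \<open>Applied to a point of \<open>MxR c\<close> this is the position vector in the quadric,
  hence normal to \<open>MxR c\<close>; applied to a vector it is the component along the space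
  form. Both readings occur.\<close>

definition pos :: "ambient \<Rightarrow> ambient" where
  "pos p = (fst p, 0)"

lemma bounded_linear_pos: "bounded_linear pos"
  unfolding pos_def by (intro bounded_linear_Pair bounded_linear_fst bounded_linear_zero)

lemma snd_pos [simp]: "snd (pos p) = 0"
  by (simp add: pos_def)

lemma pos_eq: "pos v = v - snd v *\<^sub>R \<xi>"
  by (simp add: pos_def \<xi>_def prod_eq_iff)

lemma ip_pos: "ip c (pos v) w = ip c v w - snd v * snd w" "ip c w (pos v) = ip c w v - snd w * snd v"
  by (simp_all add: pos_eq)

lemma proj_eq: "proj c q w = w - (c * ip c (pos q) w) *\<^sub>R pos q"
  by (simp add: proj_def ip_def pos_def)

lemma proj_linear: "linear (proj c q)"
  by (rule linearI) (simp_all add: proj_eq algebra_simps)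

lemma MxR_pos: "q \<in> MxR c \<Longrightarrow> ip c (pos q) (pos q) = 1 / c"
  by (auto simp: MxR_def space_form_def ip_def pos_def)

text \<open>For \<open>c > 0\<close> the form is Euclidean. For \<open>c < 0\<close> write the point
  as \<open>((x, s), m)\<close>; then \<open>x \<bullet> x\<close> is smaller than
  \<open>s * s\<close>, so by Cauchy-Schwarz a vector orthogonal to the position vector cannot be
  timelike.\<close>

lemma ip_pos_definite:
  assumes c: "c \<noteq> 0" and q: "q \<in> MxR c" and v: "ip c (pos q) v = 0" "v \<noteq> 0"
  shows "ip c v v > 0"
proof -
  obtain y t r where v_eq: "v = ((y, t), r)" by (metis prod.exhaust)
  obtain x s m where q_eq: "q = ((x, s), m)" by (metis prod.exhaust)
  show ?thesis
  proof (cases "c > 0")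
    case True
    have "ip c v v = v \<bullet> v" using True by (simp add: v_eq ip_def ipM_def inner_prod_def)
    then show ?thesis using v by simp
  next
    case False
    then have c: "c < 0" using c by simp
    have s: "s > 0" and xs: "x \<bullet> x = s * s + 1 / c"
      using q c by (auto simp: q_eq MxR_def space_form_def ipM_def)
    have xy: "x \<bullet> y = s * t" using v(1) c by (simp add: v_eq q_eq ip_def ipM_def pos_def)
    have e: "ip c v v = y \<bullet> y - t * t + r * r" using c by (simp add: v_eq ip_def ipM_def)
    have cs: "(x \<bullet> y)\<^sup>2 \<le> (x \<bullet> x) * (y \<bullet> y)" by (rule Cauchy_Schwarz_ineq)
    show ?thesis
    proof (cases "y = 0")
      case True
      then have "t = 0" using xy s by simp
      moreover from this have "r \<noteq> 0" using v(2) True by (auto simp: v_eq prod_eq_iff)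
      ultimately show ?thesis using True e by (metis (no_types) add_0 diff_0_right inner_zero_left mult_zero_left not_real_square_gt_zero)
    next
      case False
      then have y: "y \<bullet> y > 0" by simp
      then have "1 / c * (y \<bullet> y) < 0" using c by (intro mult_neg_pos) auto
      then have "s * s * (t * t) < s * s * (y \<bullet> y)"
        using cs unfolding xy xs power2_eq_square by (simp add: algebra_simps)
      then have "t * t < y \<bullet> y" using s by simp
      then show ?thesis unfolding e by (smt (verit) zero_le_square)
    qed
  qed
qed

text \<open>The form may be indefinite, so Euclidean orthonormal expansion does not apply. Pairing
  with the vectors still shows independence, five independent vectors span the space, and
  non-degeneracy kills the remainder. The coefficient \<open>c\<close> is the reciprocal of
  \<open>ip c a5 a5\<close>.\<close>

lemma ambient_frame_expansion:
  assumes c: "c \<noteq> 0"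
    and norm: "ip c a1 a1 = 1" "ip c a2 a2 = 1" "ip c a3 a3 = 1" "ip c a4 a4 = 1" "ip c a5 a5 = 1 / c"
    and orth: "ip c a1 a2 = 0" "ip c a1 a3 = 0" "ip c a1 a4 = 0" "ip c a1 a5 = 0"
      "ip c a2 a3 = 0" "ip c a2 a4 = 0" "ip c a2 a5 = 0" "ip c a3 a4 = 0" "ip c a3 a5 = 0" "ip c a4 a5 = 0"
  shows "w = ip c w a1 *\<^sub>R a1 + ip c w a2 *\<^sub>R a2 + ip c w a3 *\<^sub>R a3 + ip c w a4 *\<^sub>R a4 + (c * ip c w a5) *\<^sub>R a5"
proof -
  note orth' = orth orth[unfolded ip_sym[of c a1]] orth[unfolded ip_sym[of c a2]]
    orth[unfolded ip_sym[of c a3]] orth[unfolded ip_sym[of c a4]]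
  define b :: "ambient list" where "b = [a1, a2, a3, a4, a5]"
  have dist: "distinct b"
    unfolding b_def using norm orth c by (auto simp: field_simps)
  have ind: "independent (set b)"
  proof (rule independent_if_scalars_zero)
    fix k x assume k: "(\<Sum>x\<in>set b. k x *\<^sub>R x) = 0" and x: "x \<in> set b"
    have "(\<Sum>x\<in>set b. k x *\<^sub>R x) = k a1 *\<^sub>R a1 + (k a2 *\<^sub>R a2 + (k a3 *\<^sub>R a3 + (k a4 *\<^sub>R a4 + k a5 *\<^sub>R a5)))"
      using dist by (simp add: b_def)
    then have 0: "k a1 *\<^sub>R a1 + (k a2 *\<^sub>R a2 + (k a3 *\<^sub>R a3 + (k a4 *\<^sub>R a4 + k a5 *\<^sub>R a5))) = 0" using k by simp
    show "k x = 0"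
      using arg_cong[OF 0, of "\<lambda>z. ip c z x"] x norm orth' c by (auto simp: b_def)
  qed simp
  have "card (set b) = DIM(ambient)" using dist by (simp add: distinct_card b_def)
  then have span: "span (set b) = UNIV"
    by (metis card_eq_dim dim_UNIV finite_set ind span_UNIV subset_UNIV card_ge_dim_independent order_refl top.extremum_uniqueI)
  define z where "z = w - (ip c w a1 *\<^sub>R a1 + ip c w a2 *\<^sub>R a2 + ip c w a3 *\<^sub>R a3 + ip c w a4 *\<^sub>R a4 + (c * ip c w a5) *\<^sub>R a5)"
  have zb: "ip c z x = 0" if "x \<in> set b" for x
    using that norm orth' c by (auto simp: b_def z_def)
  have "ip c z y = 0" for y
  proof -
    have "y \<in> span (set b)" using span by simp
    then show ?thesis
      by (induction rule: span_induct_alt) (auto simp: zb)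
  qed
  \<comment> \<open>Multiplying the fourth coordinate by \<open>sgn c\<close> turns the form into
    the Euclidean inner product of \<open>z\<close> with itself.\<close>
  then have "ip c z (fst z, 0) = 0" "ip c z ((fst (fst z), sgn c * snd (fst z)), snd z) = 0" by auto
  then have "z \<bullet> z = 0" using c by (auto simp: ip_def ipM_def inner_prod_def sgn_if split: if_splits)
  then have "z = 0" by simp
  then show ?thesis unfolding z_def by simp
qed

section \<open>Parametrised patches\<close>

locale patch =
  fixes c :: real and D :: "plane set" and f :: "plane \<Rightarrow> ambient"
  assumes c_nz: "c \<noteq> 0" and open_D: "open D" and imm: "immersion_into c D f"
begin

lemma f_smooth: "smooth_on D f"
  using imm by (simp add: immersion_into_def)

lemma f_MxR: "x \<in> D \<Longrightarrow> f x \<in> MxR c"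
  using imm by (auto simp: immersion_into_def)

abbreviation df' where "df' x v \<equiv> dd f x v"
abbreviation ddf where "ddf x v w \<equiv> dd (\<lambda>y. dd f y w) x v"
abbreviation \<eta> where "\<eta> x \<equiv> pos (f x)"

lemma f_diff: "x \<in> D \<Longrightarrow> f differentiable (at x)"
  using smooth_on_differentiable[OF f_smooth] .

lemma df_diff: "x \<in> D \<Longrightarrow> (\<lambda>y. dd f y w) differentiable (at x)"
  using smooth_on_differentiable[OF smooth_on_dd[OF f_smooth]] .

lemmas df_lin = dd_linear[OF f_diff]

lemma df_inj: "x \<in> D \<Longrightarrow> dd f x v = dd f x w \<Longrightarrow> v = w"
  using imm unfolding immersion_into_def inj_def df_def by blast

lemma \<eta>_smooth: "smooth_on D \<eta>"
  by (rule smooth_on_linear_image[OF bounded_linear_pos open_D f_smooth])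

lemma d\<eta>: "x \<in> D \<Longrightarrow> dd \<eta> x v = pos (dd f x v)"
  by (rule dd_linear_image[OF bounded_linear_pos f_diff])

lemma \<eta>_norm: "x \<in> D \<Longrightarrow> ip c (\<eta> x) (\<eta> x) = 1 / c"
  by (simp add: MxR_pos f_MxR)

lemma dd_eq_0_if_const:
  assumes "x \<in> D" "\<And>y. y \<in> D \<Longrightarrow> g y = k"
  shows "dd g x v = 0"
  using dd_cong[OF open_D assms(1), of g "\<lambda>_. k"] assms(2) by simp

lemma ip_df_\<eta>:
  assumes x: "x \<in> D" shows "ip c (df' x v) (\<eta> x) = 0" "ip c (\<eta> x) (df' x v) = 0"
proof -
  have d: "\<eta> differentiable (at x)" by (rule smooth_on_differentiable[OF \<eta>_smooth x])
  have "dd (\<lambda>y. ip c (\<eta> y) (\<eta> y)) x v = 0"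
    by (rule dd_eq_0_if_const[OF x]) (rule \<eta>_norm)
  then have "ip c (pos (df' x v)) (\<eta> x) = 0"
    unfolding dd_ip[OF d d] d\<eta>[OF x] using ip_sym[of c "\<eta> x"] by simp
  then show "ip c (df' x v) (\<eta> x) = 0" by (simp add: ip_pos)
  then show "ip c (\<eta> x) (df' x v) = 0" using ip_sym by metis
qed

lemma proj_f: "proj c (f x) w = w - (c * ip c (\<eta> x) w) *\<^sub>R \<eta> x"
  by (rule proj_eq)

lemma ip_proj_tangent: "ip c (\<eta> x) w = 0 \<Longrightarrow> ip c (proj c (f x) z) w = ip c z w"
  by (simp add: proj_eq)

lemma metric_eq: "metric c f x v w = ip c (df' x v) (df' x w)"
  by (simp add: metric_def df_def)

lemma metric_pos: "x \<in> D \<Longrightarrow> v \<noteq> 0 \<Longrightarrow> metric c f x v v > 0"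
  unfolding metric_eq using df_inj[of x v 0] df_lin(4)
  by (intro ip_pos_definite[OF c_nz f_MxR ip_df_\<eta>(2)]) auto

lemma metric_bilinear:
  "x \<in> D \<Longrightarrow> metric c f x (v + v') w = metric c f x v w + metric c f x v' w"
  "x \<in> D \<Longrightarrow> metric c f x (v - v') w = metric c f x v w - metric c f x v' w"
  "x \<in> D \<Longrightarrow> metric c f x (r *\<^sub>R v) w = r * metric c f x v w"
  "metric c f x v w = metric c f x w v"
  by (simp_all add: metric_eq df_lin ip_sym)

lemma plane_eq: "v = fst v *\<^sub>R e\<^sub>1 + snd v *\<^sub>R e\<^sub>2" for v :: plane
  by (simp add: prod_eq_iff)

lemma df_coord:
  assumes "x \<in> D" shows "df' x v = fst v *\<^sub>R df' x e\<^sub>1 + snd v *\<^sub>R df' x e\<^sub>2"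
  using plane_eq[of v] df_lin[OF assms] by metis

text \<open>The test vector is \<open>e\<^sub>1\<close> made orthogonal to \<open>e\<^sub>2\<close>
  and scaled by the squared length of \<open>e\<^sub>2\<close>; its squared length is that factor
  times the determinant.\<close>

lemma gram_pos:
  assumes x: "x \<in> D" shows "gram c f x > 0"
proof -
  let ?m = "metric c f x"
  let ?v = "?m e\<^sub>2 e\<^sub>2 *\<^sub>R e\<^sub>1 - ?m e\<^sub>1 e\<^sub>2 *\<^sub>R e\<^sub>2"
  have g: "?m e\<^sub>2 e\<^sub>2 > 0" using metric_pos[OF x, of e\<^sub>2] by (simp add: prod_eq_iff)
  then have "?v \<noteq> 0" by (simp add: prod_eq_iff)
  then have "?m ?v ?v > 0" by (rule metric_pos[OF x])
  moreover have "?m ?v ?v = ?m e\<^sub>2 e\<^sub>2 * gram c f x"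
    unfolding metric_eq gram_def df_lin[OF x] ip_simps
    by (simp add: power2_eq_square algebra_simps ip_sym[of c "df' x e\<^sub>2" "df' x e\<^sub>1"])
  ultimately show ?thesis using g by (simp add: zero_less_mult_iff)
qed

lemma metric_unique:
  assumes x: "x \<in> D" and "\<And>w. metric c f x a w = metric c f x b w" shows "a = b"
proof (rule ccontr)
  assume "a \<noteq> b"
  then have "metric c f x (a - b) (a - b) > 0" using metric_pos[OF x, of "a - b"] by simp
  then show False using assms(2) by (simp add: metric_bilinear(2)[OF x])
qed

lemma metric_sharp:
  assumes x: "x \<in> D" and \<alpha>: "linear \<alpha>" shows "metric c f x (sharp c f x \<alpha>) v = \<alpha> v"
proof -
  let ?m = "metric c f x" and ?g = "gram c f x"
  have g: "?g \<noteq> 0" using gram_pos[OF x] by simp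
  have m: "?m (a, b) (p, q) = a * p * ?m e\<^sub>1 e\<^sub>1 + (a * q + b * p) * ?m e\<^sub>1 e\<^sub>2 + b * q * ?m e\<^sub>2 e\<^sub>2" for a b p q
    unfolding metric_eq df_coord[OF x, of "(a, b)"] df_coord[OF x, of "(p, q)"]
    by (simp add: algebra_simps ip_sym[of c "df' x e\<^sub>2" "df' x e\<^sub>1"])
  have a: "\<alpha> v = fst v * \<alpha> e\<^sub>1 + snd v * \<alpha> e\<^sub>2"
    using plane_eq[of v] linear_add[OF \<alpha>] linear_cmul[OF \<alpha>] by (metis real_scaleR_def)
  have "?m (?m e\<^sub>2 e\<^sub>2 * \<alpha> e\<^sub>1 - ?m e\<^sub>1 e\<^sub>2 * \<alpha> e\<^sub>2, ?m e\<^sub>1 e\<^sub>1 * \<alpha> e\<^sub>2 - ?m e\<^sub>1 e\<^sub>2 * \<alpha> e\<^sub>1) (fst v, snd v)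
      = ?g * (fst v * \<alpha> e\<^sub>1 + snd v * \<alpha> e\<^sub>2)"
    by (rule trans[OF m]) (unfold gram_def power2_eq_square, algebra)
  then show ?thesis
    unfolding a sharp_def metric_bilinear(3)[OF x] using g by simp
qed

lemma metric_tang: "x \<in> D \<Longrightarrow> metric c f x (tang c f x w) v = ip c w (df' x v)"
  unfolding tang_def df_def by (rule metric_sharp, assumption, rule linearI) (simp_all add: df_lin)

end

section \<open>Derivatives along vector fields and the ambient curvature\<close>

lemma smooth_on_dd_field:
  fixes g :: "'a::euclidean_space \<Rightarrow> 'b::real_normed_vector"
  assumes "open S" "smooth_on S g" "smooth_on S u"
  shows "smooth_on S (\<lambda>y. dd g y (u y))"
proof (rule smooth_on_cong[OF assms(1)])
  show "(\<Sum>b\<in>Basis. (u x \<bullet> b) *\<^sub>R dd g x b) = dd g x (u x)" if "x \<in> S" for x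
    using dd_basis[OF smooth_on_differentiable[OF assms(2) that], of "u x"] by simp
  have "times_differentiable_on n (\<lambda>x. \<Sum>b\<in>Basis. (u x \<bullet> b) *\<^sub>R dd g x b) S" for n
    using assms smooth_on_dd[OF assms(2)]
    by (intro times_differentiable_on_sum times_differentiable_on_bilinear[OF _ bounded_bilinear_scaleR]
        times_differentiable_on_bilinear[OF _ bounded_bilinear_inner] times_differentiable_on_const)
      (auto simp: smooth_on_def)
  then show "smooth_on S (\<lambda>x. \<Sum>b\<in>Basis. (u x \<bullet> b) *\<^sub>R dd g x b)" by (simp add: smooth_on_def)
qed

lemma dd_sum:
  assumes "\<And>b. b \<in> A \<Longrightarrow> f b differentiable at x"
  shows "dd (\<lambda>y. \<Sum>b\<in>A. f b y) x v = (\<Sum>b\<in>A. dd (f b) x v)"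
  by (rule dd_eqI[where f' = "\<lambda>v. \<Sum>b\<in>A. dd (f b) x v"])
    (intro has_derivative_sum dd_works assms)

text \<open>The product rule for the pairing of a differential with a moving direction, again
  reduced to fixed directions by a basis expansion.\<close>

lemma dd_dd_field:
  fixes g :: "'a::euclidean_space \<Rightarrow> 'b::real_normed_vector"
  assumes S: "open S" "smooth_on S g" "x \<in> S" and u: "u differentiable at x"
  shows "dd (\<lambda>y. dd g y (u y)) x v = dd (\<lambda>y. dd g y (u x)) x v + dd g x (dd u x v)"
proof -
  have gd: "(\<lambda>y. dd g y b) differentiable at x" for b
    by (rule smooth_on_differentiable[OF smooth_on_dd[OF S(2)] S(3)])
  have ud: "(\<lambda>y. u y \<bullet> b) differentiable at x" for b
    using bounded_linear.has_derivative[OF bounded_linear_inner_left dd_works[OF u]]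
    unfolding differentiable_def by blast
  have sd: "(\<lambda>y. (u y \<bullet> b) *\<^sub>R dd g y b) differentiable at x" "(\<lambda>y. (u x \<bullet> b) *\<^sub>R dd g y b) differentiable at x" for b
    using gd ud by (auto intro: differentiable_scaleR)
  have dU: "dd (\<lambda>y. u y \<bullet> b) x v = dd u x v \<bullet> b" for b
    by (rule dd_linear_image[OF bounded_linear_inner_left u])
  have "dd (\<lambda>y. dd g y (u y)) x v = dd (\<lambda>y. \<Sum>b\<in>Basis. (u y \<bullet> b) *\<^sub>R dd g y b) x v"
    by (rule dd_cong[OF S(1,3)]) (rule dd_basis[OF smooth_on_differentiable[OF S(2)]])
  also have "\<dots> = (\<Sum>b\<in>Basis. (dd u x v \<bullet> b) *\<^sub>R dd g x b) + (\<Sum>b\<in>Basis. (u x \<bullet> b) *\<^sub>R dd (\<lambda>y. dd g y b) x v)"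
    by (simp add: dd_sum[OF sd(1)] dd_scaleR[OF ud gd] dU sum.distrib)
  also have "(\<Sum>b\<in>Basis. (dd u x v \<bullet> b) *\<^sub>R dd g x b) = dd g x (dd u x v)"
    by (rule dd_basis[symmetric]) (rule smooth_on_differentiable[OF S(2,3)])
  also have "(\<Sum>b\<in>Basis. (u x \<bullet> b) *\<^sub>R dd (\<lambda>y. dd g y b) x v) = dd (\<lambda>y. dd g y (u x)) x v"
  proof -
    have "dd (\<lambda>y. dd g y (u x)) x v = dd (\<lambda>y. \<Sum>b\<in>Basis. (u x \<bullet> b) *\<^sub>R dd g y b) x v"
      by (rule dd_cong[OF S(1,3)]) (rule dd_basis[OF smooth_on_differentiable[OF S(2)]])
    also have "\<dots> = (\<Sum>b\<in>Basis. (u x \<bullet> b) *\<^sub>R dd (\<lambda>y. dd g y b) x v)"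
      by (simp add: dd_sum[OF sd(2)] dd_scaleR[OF _ gd])
    finally show ?thesis by simp
  qed
  finally show ?thesis by (simp add: add.commute)
qed

text \<open>The line factor is flat, so this is the constant curvature tensor applied to the
  components along the space form. It comes from differentiating the tangential projection
  twice.\<close>

lemma curv_eq:
  assumes q: "q \<in> MxR c" and c: "c \<noteq> 0"
    and t: "ip c (pos q) x = 0" "ip c (pos q) y = 0" "ip c (pos q) z = 0"
  shows "curv c q x y z = (c * ip c (pos y) z) *\<^sub>R pos x - (c * ip c (pos x) z) *\<^sub>R pos y"
proof -
  have dproj: "dd (\<lambda>p. proj c p z) p v = - (c * ip c (pos v) z) *\<^sub>R pos p - (c * ip c (pos p) z) *\<^sub>R pos v"
    for z p v
  proof -
    have "((\<lambda>p. proj c p z) has_derivative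
       (\<lambda>v. - (c * ip c (pos v) z) *\<^sub>R pos p - (c * ip c (pos p) z) *\<^sub>R pos v)) (at p)"
      unfolding proj_eq
      by (auto intro!: derivative_eq_intros bounded_linear.has_derivative[OF bounded_linear_pos]
          bounded_bilinear.FDERIV[OF ip_bounded_bilinear] simp: algebra_simps)
    then show ?thesis by (rule dd_eqI)
  qed
  \<comment> \<open>The projection removes everything along \<open>pos q\<close> and the two terms
    along \<open>pos x\<close> cancel. The surviving term gives the curvature by antisymmetrising in
    \<open>x\<close> and \<open>y\<close>.\<close>
  have ddproj: "proj c q (dd (cov c (\<lambda>p. proj c p y) (\<lambda>p. proj c p z)) q x) = - (c * ip c (pos x) z) *\<^sub>R pos y"
    if t: "ip c (pos q) x = 0" "ip c (pos q) y = 0" "ip c (pos q) z = 0" for x y z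
  proof -
    define G where "G p = - (c * ip c (pos (proj c p y)) z) *\<^sub>R pos p - (c * ip c (pos p) z) *\<^sub>R pos (proj c p y)" for p
    have cov: "cov c (\<lambda>p. proj c p y) (\<lambda>p. proj c p z) = (\<lambda>p. G p - (c * ip c (pos p) (G p)) *\<^sub>R pos p)"
    proof
      fix p
      have "cov c (\<lambda>p. proj c p y) (\<lambda>p. proj c p z) p = proj c p (G p)"
        by (simp add: cov_def dproj G_def)
      then show "cov c (\<lambda>p. proj c p y) (\<lambda>p. proj c p z) p = G p - (c * ip c (pos p) (G p)) *\<^sub>R pos p"
        by (simp only: proj_eq)
    qed
    have pd: "((\<lambda>p. proj c p y) has_derivative (\<lambda>v. - (c * ip c (pos v) y) *\<^sub>R pos p - (c * ip c (pos p) y) *\<^sub>R pos v)) (at p)" for p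
      unfolding proj_eq
      by (auto intro!: derivative_eq_intros bounded_linear.has_derivative[OF bounded_linear_pos]
          bounded_bilinear.FDERIV[OF ip_bounded_bilinear] simp: algebra_simps)
    have posd: "(pos has_derivative pos) (at p)" for p
      by (rule bounded_linear_imp_has_derivative[OF bounded_linear_pos])
    define G' where "G' v = - (c * ip c (pos (- (c * ip c (pos v) y) *\<^sub>R pos q - (c * ip c (pos q) y) *\<^sub>R pos v)) z) *\<^sub>R pos q
        - (c * ip c (pos (proj c q y)) z) *\<^sub>R pos v - (c * ip c (pos v) z) *\<^sub>R pos (proj c q y)
        - (c * ip c (pos q) z) *\<^sub>R pos (- (c * ip c (pos v) y) *\<^sub>R pos q - (c * ip c (pos q) y) *\<^sub>R pos v)" for v
    have Gd: "(G has_derivative G') (at q)"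
      unfolding G_def G'_def
      by (auto intro!: derivative_eq_intros bounded_linear.has_derivative[OF bounded_linear_pos]
          bounded_bilinear.FDERIV[OF ip_bounded_bilinear] pd posd simp: algebra_simps)
    have "((\<lambda>p. G p - (c * ip c (pos p) (G p)) *\<^sub>R pos p) has_derivative
       (\<lambda>v. G' v - ((c * ip c (pos q) (G q)) *\<^sub>R pos v + (c * (ip c (pos q) (G' v) + ip c (pos v) (G q))) *\<^sub>R pos q))) (at q)"
      by (auto intro!: derivative_eq_intros bounded_bilinear.FDERIV[OF ip_bounded_bilinear] posd Gd simp: algebra_simps)
    note d = dd_eqI[OF this]
    have py: "proj c q y = y" using t by (simp add: proj_eq)
    have Gq: "G q = - (c * ip c (pos y) z) *\<^sub>R pos q" using t py by (simp add: G_def)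
    have nq: "ip c (pos q) (pos q) = 1 / c" by (rule MxR_pos[OF q])
    have Gx: "proj c q (G' x) = - (c * ip c (pos y) z) *\<^sub>R pos x - (c * ip c (pos x) z) *\<^sub>R pos y"
      using t nq c by (simp add: G'_def py proj_eq ip_pos algebra_simps)
    have "proj c q (dd (cov c (\<lambda>p. proj c p y) (\<lambda>p. proj c p z)) q x)
        = proj c q (G' x) - (c * ip c (pos q) (G q)) *\<^sub>R proj c q (pos x)
          - (c * (ip c (pos q) (G' x) + ip c (pos x) (G q))) *\<^sub>R proj c q (pos q)"
      unfolding cov d by (simp add: linear_diff[OF proj_linear] linear_add[OF proj_linear] linear_cmul[OF proj_linear])
    also have "proj c q (pos q) = 0" using nq c by (simp add: proj_eq)
    also have "proj c q (pos x) = pos x" using t by (simp add: proj_eq ip_pos)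
    finally show ?thesis using nq c by (simp add: Gx Gq algebra_simps)
  qed
  have cov: "cov c X W q = proj c q (dd W q (X q))" for X W by (simp add: cov_def)
  have p: "proj c q x = x" "proj c q y = y" using t by (simp_all add: proj_eq)
  have sy: "ip c (pos y) x = ip c (pos x) y" by (simp add: ip_pos ip_sym[of c y x] mult.commute)
  \<comment> \<open>The fields are projections of constant vectors, so their bracket at
    \<open>q\<close> is a multiple of \<open>pos q\<close> with coefficient antisymmetric in a
    symmetric expression.\<close>
  have br: "lie_bracket (\<lambda>p. proj c p x) (\<lambda>p. proj c p y) q = 0"
    unfolding lie_bracket_def p dproj using t sy by simp
  show ?thesis
    unfolding curv_def Let_def cov[of _ "cov _ _ _"] p
    using ddproj[OF t] ddproj[OF t(2,1,3)] by (simp add: cov_def br dproj linear_0[OF proj_linear] pos_def[of 0]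
        flip: zero_prod_def)
qed

section \<open>Moving frames on a patch\<close>

text \<open>The tangent half lives in the parameter plane, where \<open>LC\<close>,
  \<open>sff\<close> and \<open>tr\<close> take their arguments, and the normal half in the ambient
  space. With the quadric normal \<eta> these give five fields spanning the ambient space at each
  point.\<close>

locale frame = patch +
  fixes u1 u2 :: "plane \<Rightarrow> plane" and e3 e4 :: "plane \<Rightarrow> ambient"
  assumes frame_smooth: "smooth_on D u1" "smooth_on D u2" "smooth_on D e3" "smooth_on D e4"
    and u_orth: "\<And>x. x \<in> D \<Longrightarrow> metric c f x (u1 x) (u1 x) = 1" "\<And>x. x \<in> D \<Longrightarrow> metric c f x (u2 x) (u2 x) = 1"
      "\<And>x. x \<in> D \<Longrightarrow> metric c f x (u1 x) (u2 x) = 0"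
    and e_norm: "\<And>x. x \<in> D \<Longrightarrow> ip c (e3 x) (e3 x) = 1" "\<And>x. x \<in> D \<Longrightarrow> ip c (e4 x) (e4 x) = 1"
      "\<And>x. x \<in> D \<Longrightarrow> ip c (e3 x) (e4 x) = 0"
    and e_tan: "\<And>x v. x \<in> D \<Longrightarrow> ip c (dd f x v) (e3 x) = 0" "\<And>x v. x \<in> D \<Longrightarrow> ip c (dd f x v) (e4 x) = 0"
    and e_\<eta>: "\<And>x. x \<in> D \<Longrightarrow> ip c (e3 x) (pos (f x)) = 0" "\<And>x. x \<in> D \<Longrightarrow> ip c (e4 x) (pos (f x)) = 0"
begin

definition "e1 x = dd f x (u1 x)"
definition "e2 x = dd f x (u2 x)"

abbreviation "\<theta>1 x v \<equiv> ip c (dd f x v) (e1 x)"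
abbreviation "\<theta>2 x v \<equiv> ip c (dd f x v) (e2 x)"

lemma e_smooth: "smooth_on D e1" "smooth_on D e2" "smooth_on D e3" "smooth_on D e4"
  unfolding e1_def[abs_def] e2_def[abs_def]
  by (intro smooth_on_dd_field[OF open_D f_smooth] frame_smooth)+

lemma e_diff:
  assumes "x \<in> D"
  shows "e1 differentiable (at x)" "e2 differentiable (at x)" "e3 differentiable (at x)" "e4 differentiable (at x)"
    "\<eta> differentiable (at x)"
  using smooth_on_differentiable[OF _ assms] e_smooth \<eta>_smooth by blast+

lemma onb:
  assumes x: "x \<in> D"
  shows "ip c (e1 x) (e1 x) = 1" "ip c (e2 x) (e2 x) = 1" "ip c (e3 x) (e3 x) = 1" "ip c (e4 x) (e4 x) = 1"
    "ip c (e1 x) (e2 x) = 0" "ip c (e1 x) (e3 x) = 0" "ip c (e1 x) (e4 x) = 0" "ip c (e1 x) (\<eta> x) = 0"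
    "ip c (e2 x) (e3 x) = 0" "ip c (e2 x) (e4 x) = 0" "ip c (e2 x) (\<eta> x) = 0"
    "ip c (e3 x) (e4 x) = 0" "ip c (e3 x) (\<eta> x) = 0" "ip c (e4 x) (\<eta> x) = 0" "ip c (\<eta> x) (\<eta> x) = 1 / c"
  using u_orth[OF x] e_norm[OF x] e_tan[OF x] e_\<eta>[OF x] ip_df_\<eta>[OF x] \<eta>_norm[OF x]
  by (simp_all add: e1_def e2_def metric_eq)

lemma onb':
  assumes x: "x \<in> D"
  shows "ip c (e2 x) (e1 x) = 0" "ip c (e3 x) (e1 x) = 0" "ip c (e4 x) (e1 x) = 0" "ip c (\<eta> x) (e1 x) = 0"
    "ip c (e3 x) (e2 x) = 0" "ip c (e4 x) (e2 x) = 0" "ip c (\<eta> x) (e2 x) = 0"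
    "ip c (e4 x) (e3 x) = 0" "ip c (\<eta> x) (e3 x) = 0" "ip c (\<eta> x) (e4 x) = 0"
    "ip c (e3 x) (dd f x v) = 0" "ip c (e4 x) (dd f x v) = 0"
  using onb[OF x] e_tan[OF x] ip_sym by metis+

lemma expand:
  assumes x: "x \<in> D"
  shows "w = ip c w (e1 x) *\<^sub>R e1 x + ip c w (e2 x) *\<^sub>R e2 x + ip c w (e3 x) *\<^sub>R e3 x + ip c w (e4 x) *\<^sub>R e4 x
    + (c * ip c w (\<eta> x)) *\<^sub>R \<eta> x"
  by (rule ambient_frame_expansion[OF c_nz]) (simp_all add: onb[OF x])

lemma parseval:
  assumes x: "x \<in> D"
  shows "ip c w z = ip c w (e1 x) * ip c z (e1 x) + ip c w (e2 x) * ip c z (e2 x) + ip c w (e3 x) * ip c z (e3 x)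
    + ip c w (e4 x) * ip c z (e4 x) + c * ip c w (\<eta> x) * ip c z (\<eta> x)"
  by (subst expand[OF x, of w], unfold ip_simps)
    (simp add: ip_sym[of c "e1 x" z] ip_sym[of c "e2 x" z] ip_sym[of c "e3 x" z] ip_sym[of c "e4 x" z] ip_sym[of c "\<eta> x" z])

lemma df_expand: "x \<in> D \<Longrightarrow> dd f x v = \<theta>1 x v *\<^sub>R e1 x + \<theta>2 x v *\<^sub>R e2 x"
  by (subst expand[of x]) (simp_all add: e_tan ip_df_\<eta>)

lemma v_expand: "x \<in> D \<Longrightarrow> v = \<theta>1 x v *\<^sub>R u1 x + \<theta>2 x v *\<^sub>R u2 x"
  by (rule df_inj, assumption) (simp add: df_lin e1_def[symmetric] e2_def[symmetric] flip: df_expand)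

lemma \<theta>_u:
  assumes "x \<in> D" shows "\<theta>1 x (u1 x) = 1" "\<theta>1 x (u2 x) = 0" "\<theta>2 x (u1 x) = 0" "\<theta>2 x (u2 x) = 1"
  using onb[OF assms] onb'[OF assms] by (simp_all add: e1_def e2_def)

lemma form_expand:
  assumes "x \<in> D" "linear \<alpha>" shows "\<alpha> v = \<theta>1 x v * \<alpha> (u1 x) + \<theta>2 x v * (\<alpha> (u2 x) :: real)"
  by (subst v_expand[OF assms(1), of v]) (simp add: linear_add[OF assms(2)] linear_cmul[OF assms(2)])

lemma ip_const_deriv:
  assumes x: "x \<in> D" and "A differentiable (at x)" "B differentiable (at x)" "\<And>y. y \<in> D \<Longrightarrow> ip c (A y) (B y) = k"
  shows "ip c (dd A x v) (B x) = - ip c (dd B x v) (A x)"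
  using dd_eq_0_if_const[OF x, of "\<lambda>y. ip c (A y) (B y)" k v, OF assms(4)] unfolding dd_ip[OF assms(2,3)]
  by (simp add: ip_sym[of c "A x"])

text \<open>Differentiating constant products gives the skew-symmetry of the connection forms. The
  components along \<eta> are explicit because the derivative of \<eta> is the space-form part of
  \<open>dd f\<close>; they encode the second fundamental form of the quadric.\<close>

lemma d_onb:
  assumes x: "x \<in> D"
  shows "ip c (dd e1 x v) (e1 x) = 0" "ip c (dd e2 x v) (e2 x) = 0" "ip c (dd e3 x v) (e3 x) = 0"
    "ip c (dd e4 x v) (e4 x) = 0"
    "ip c (dd e2 x v) (e1 x) = - ip c (dd e1 x v) (e2 x)"
    "ip c (dd e3 x v) (e1 x) = - ip c (dd e1 x v) (e3 x)"
    "ip c (dd e3 x v) (e2 x) = - ip c (dd e2 x v) (e3 x)"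
    "ip c (dd e4 x v) (e1 x) = - ip c (dd e1 x v) (e4 x)"
    "ip c (dd e4 x v) (e2 x) = - ip c (dd e2 x v) (e4 x)"
    "ip c (dd e4 x v) (e3 x) = - ip c (dd e3 x v) (e4 x)"
    "ip c (dd e1 x v) (\<eta> x) = - (\<theta>1 x v - snd (dd f x v) * snd (e1 x))"
    "ip c (dd e2 x v) (\<eta> x) = - (\<theta>2 x v - snd (dd f x v) * snd (e2 x))"
    "ip c (dd e3 x v) (\<eta> x) = snd (dd f x v) * snd (e3 x)"
    "ip c (dd e4 x v) (\<eta> x) = snd (dd f x v) * snd (e4 x)"
proof -
  note d = e_diff[OF x]
  show "ip c (dd e1 x v) (e1 x) = 0" "ip c (dd e2 x v) (e2 x) = 0" "ip c (dd e3 x v) (e3 x) = 0"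
    "ip c (dd e4 x v) (e4 x) = 0"
    using ip_const_deriv[OF x d(1) d(1) onb(1)] ip_const_deriv[OF x d(2) d(2) onb(2)]
      ip_const_deriv[OF x d(3) d(3) onb(3)] ip_const_deriv[OF x d(4) d(4) onb(4)]
    by (smt (verit, best))+
  show "ip c (dd e2 x v) (e1 x) = - ip c (dd e1 x v) (e2 x)"
    "ip c (dd e3 x v) (e1 x) = - ip c (dd e1 x v) (e3 x)"
    "ip c (dd e3 x v) (e2 x) = - ip c (dd e2 x v) (e3 x)"
    "ip c (dd e4 x v) (e1 x) = - ip c (dd e1 x v) (e4 x)"
    "ip c (dd e4 x v) (e2 x) = - ip c (dd e2 x v) (e4 x)"
    "ip c (dd e4 x v) (e3 x) = - ip c (dd e3 x v) (e4 x)"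
    using ip_const_deriv[OF x d(2) d(1) onb'(1)] ip_const_deriv[OF x d(3) d(1) onb'(2)]
      ip_const_deriv[OF x d(3) d(2) onb'(5)] ip_const_deriv[OF x d(4) d(1) onb'(3)]
      ip_const_deriv[OF x d(4) d(2) onb'(6)] ip_const_deriv[OF x d(4) d(3) onb'(8)] by blast+
  show "ip c (dd e1 x v) (\<eta> x) = - (\<theta>1 x v - snd (dd f x v) * snd (e1 x))"
    "ip c (dd e2 x v) (\<eta> x) = - (\<theta>2 x v - snd (dd f x v) * snd (e2 x))"
    "ip c (dd e3 x v) (\<eta> x) = snd (dd f x v) * snd (e3 x)"
    "ip c (dd e4 x v) (\<eta> x) = snd (dd f x v) * snd (e4 x)"
    using ip_const_deriv[OF x d(1) d(5) onb(8)] ip_const_deriv[OF x d(2) d(5) onb(11)]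
      ip_const_deriv[OF x d(3) d(5) onb(13)] ip_const_deriv[OF x d(4) d(5) onb(14)]
    by (simp_all add: d\<eta>[OF x] ip_pos e_tan[OF x])
qed

lemma ddf_sym: "x \<in> D \<Longrightarrow> ddf x v w = ddf x w v"
  using dd_symmetric[OF open_D f_smooth] by blast

lemma ddf_lin:
  assumes "x \<in> D"
  shows "ddf x (v + v') w = ddf x v w + ddf x v' w" "ddf x (r *\<^sub>R v) w = r *\<^sub>R ddf x v w"
    "ddf x w (v + v') = ddf x w v + ddf x w v'" "ddf x w (r *\<^sub>R v) = r *\<^sub>R ddf x w v"
proof -
  note l = dd_linear[OF df_diff[OF assms]]
  show "ddf x (v + v') w = ddf x v w + ddf x v' w" "ddf x (r *\<^sub>R v) w = r *\<^sub>R ddf x v w" by (rule l)+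
  show "ddf x w (v + v') = ddf x w v + ddf x w v'"
    by (subst (1 2 3) ddf_sym[OF assms, where v = w]) (rule l)
  show "ddf x w (r *\<^sub>R v) = r *\<^sub>R ddf x w v"
    by (subst (1 2) ddf_sym[OF assms, where v = w]) (rule l)
qed

text \<open>Weingarten's equations, from differentiating the orthogonality of the normals to
  \<open>dd f\<close>.\<close>

lemma S_eq:
  assumes x: "x \<in> D"
  shows "ip c (ddf x v w) (e3 x) = - ip c (dd e3 x v) (dd f x w)"
    "ip c (ddf x v w) (e4 x) = - ip c (dd e4 x v) (dd f x w)"
proof -
  have *: "ip c (ddf x v w) (B x) = - ip c (dd B x v) (dd f x w)"
    if "B differentiable (at x)" "\<And>y. y \<in> D \<Longrightarrow> ip c (dd f y w) (B y) = 0" for B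
    by (rule ip_const_deriv[OF x, where A = "\<lambda>y. dd f y w" and k = 0]) (use that df_diff[OF x] in simp_all)
  show "ip c (ddf x v w) (e3 x) = - ip c (dd e3 x v) (dd f x w)"
    by (rule *) (simp_all add: e_diff(3)[OF x] e_tan(1))
  show "ip c (ddf x v w) (e4 x) = - ip c (dd e4 x v) (dd f x w)"
    by (rule *) (simp_all add: e_diff(4)[OF x] e_tan(2))
qed

lemma de_eq:
  assumes x: "x \<in> D"
  shows "dd e1 x v = ddf x v (u1 x) + dd f x (dd u1 x v)"
    "dd e2 x v = ddf x v (u2 x) + dd f x (dd u2 x v)"
  unfolding e1_def[abs_def] e2_def[abs_def]
  by (rule dd_dd_field[OF open_D f_smooth x]; rule smooth_on_differentiable[OF _ x]; rule frame_smooth)+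

lemma metric_frame: "x \<in> D \<Longrightarrow> metric c f x v w = \<theta>1 x v * \<theta>1 x w + \<theta>2 x v * \<theta>2 x w"
  unfolding metric_eq by (subst parseval[of x]) (simp_all add: e_tan ip_df_\<eta>)

lemma \<theta>_LC:
  assumes x: "x \<in> D"
  shows "\<theta>1 x (LC c f Z x v) = ip c (dd (\<lambda>y. dd f y (Z y)) x v) (e1 x)"
    "\<theta>2 x (LC c f Z x v) = ip c (dd (\<lambda>y. dd f y (Z y)) x v) (e2 x)"
  using metric_tang[OF x, of "nab c f (\<lambda>y. df f y (Z y)) x v" "u1 x"]
    metric_tang[OF x, of "nab c f (\<lambda>y. df f y (Z y)) x v" "u2 x"]
  by (simp_all add: LC_def metric_eq nab_def df_def ip_proj_tangent onb'(4,7)[OF x] flip: e1_def e2_def)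

lemma LC_const:
  assumes x: "x \<in> D"
  shows "LC c f (\<lambda>_. w) x v = ip c (ddf x v w) (e1 x) *\<^sub>R u1 x + ip c (ddf x v w) (e2 x) *\<^sub>R u2 x"
  by (subst v_expand[OF x, of "LC c f (\<lambda>_. w) x v"]) (simp add: \<theta>_LC[OF x])

lemma sff_eq:
  assumes x: "x \<in> D"
  shows "sff c f x v w = ip c (ddf x v w) (e3 x) *\<^sub>R e3 x + ip c (ddf x v w) (e4 x) *\<^sub>R e4 x"
proof -
  have "sff c f x v w = ddf x v w - (c * ip c (\<eta> x) (ddf x v w)) *\<^sub>R \<eta> x
    - (ip c (ddf x v w) (e1 x) *\<^sub>R e1 x + ip c (ddf x v w) (e2 x) *\<^sub>R e2 x)"
    unfolding sff_def nab_def df_def proj_f LC_const[OF x]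
    by (simp add: df_lin[OF x] e1_def e2_def)
  moreover have "s = C + E" if "X = A + B + C + E + F" "s = X - F - (A + B)" for X A B C E F s :: ambient
    using that by simp
  ultimately show ?thesis using expand[OF x, of "ddf x v w"] ip_sym[of c "\<eta> x" "ddf x v w"] by metis
qed

text \<open>In terms of the coframe \<theta>1, \<theta>2 the Gram determinant is the square of the
  coframe determinant, and the coordinate formula for the trace collapses by the polynomial identity
  \<open>alg\<close>.\<close>

lemma tr_frame:
  assumes x: "x \<in> D" and \<beta>: "\<And>w. linear (\<lambda>v. \<beta> v w)" "\<And>v. linear (\<lambda>w. \<beta> v w)"
  shows "tr c f x \<beta> = \<beta> (u1 x) (u1 x) + \<beta> (u2 x) (u2 x)"
proof -
  let ?a = "\<theta>1 x e\<^sub>1" and ?b = "\<theta>2 x e\<^sub>1" and ?p = "\<theta>1 x e\<^sub>2" and ?q = "\<theta>2 x e\<^sub>2"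
  have b: "\<beta> v w = (\<theta>1 x v * \<theta>1 x w) *\<^sub>R \<beta> (u1 x) (u1 x) + (\<theta>1 x v * \<theta>2 x w) *\<^sub>R \<beta> (u1 x) (u2 x)
      + (\<theta>2 x v * \<theta>1 x w) *\<^sub>R \<beta> (u2 x) (u1 x) + (\<theta>2 x v * \<theta>2 x w) *\<^sub>R \<beta> (u2 x) (u2 x)" for v w
    by (subst v_expand[OF x, of v], subst v_expand[OF x, of w])
      (simp add: linear_add[OF \<beta>(1)] linear_add[OF \<beta>(2)] linear_cmul[OF \<beta>(1)] linear_cmul[OF \<beta>(2)] algebra_simps)
  have g: "gram c f x = (?a * ?q - ?b * ?p)\<^sup>2"
    unfolding gram_def metric_frame[OF x] power2_eq_square by (simp add: algebra_simps)
  have gn: "gram c f x \<noteq> 0" using gram_pos[OF x] by simp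
  have alg: "(p * p + q * q) *\<^sub>R ((a * a) *\<^sub>R B1 + (a * b) *\<^sub>R B2 + (b * a) *\<^sub>R B3 + (b * b) *\<^sub>R B4)
     - (a * p + b * q) *\<^sub>R (((a * p) *\<^sub>R B1 + (a * q) *\<^sub>R B2 + (b * p) *\<^sub>R B3 + (b * q) *\<^sub>R B4)
       + ((p * a) *\<^sub>R B1 + (p * b) *\<^sub>R B2 + (q * a) *\<^sub>R B3 + (q * b) *\<^sub>R B4))
     + (a * a + b * b) *\<^sub>R ((p * p) *\<^sub>R B1 + (p * q) *\<^sub>R B2 + (q * p) *\<^sub>R B3 + (q * q) *\<^sub>R B4)
     = ((a * q - b * p)\<^sup>2) *\<^sub>R (B1 + B4)" for a b p q and B1 B2 B3 B4 :: ambient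
    by (rule euclidean_eqI, simp add: inner_add_left inner_diff_left power2_eq_square, algebra)
  have "gram c f x *\<^sub>R tr c f x \<beta> = gram c f x *\<^sub>R (\<beta> (u1 x) (u1 x) + \<beta> (u2 x) (u2 x))"
    unfolding tr_def b[of e\<^sub>1 e\<^sub>1] b[of e\<^sub>1 e\<^sub>2] b[of e\<^sub>2 e\<^sub>1] b[of e\<^sub>2 e\<^sub>2] metric_frame[OF x] alg g
    using gn unfolding g by simp
  then show ?thesis using gn by simp
qed

lemma mean_curv_eq:
  assumes x: "x \<in> D"
  shows "mean_curv c f x = (1 / 2) *\<^sub>R
    ((ip c (ddf x (u1 x) (u1 x)) (e3 x) + ip c (ddf x (u2 x) (u2 x)) (e3 x)) *\<^sub>R e3 x
    + (ip c (ddf x (u1 x) (u1 x)) (e4 x) + ip c (ddf x (u2 x) (u2 x)) (e4 x)) *\<^sub>R e4 x)"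
proof -
  have "linear (\<lambda>v. sff c f x v w)" "linear (sff c f x v)" for v w
    by (rule linearI; simp add: sff_eq[OF x] ddf_lin[OF x] algebra_simps)+
  then show ?thesis unfolding mean_curv_def by (subst tr_frame[OF x]) (simp_all add: sff_eq[OF x] algebra_simps)
qed

end

section \<open>The frame adapted to \<xi> and the biconservative equation\<close>

text \<open>Here \<open>e1 = T/|T|\<close>, \<open>e3 = H/|H|\<close>, \<open>e4 = N/|N|\<close>, \<open>\<tau> = |T|\<close> and \<open>n = |N|\<close>.\<close>

locale cmc = frame +
  fixes \<tau> n :: "plane \<Rightarrow> real" and h :: real
  assumes h_pos: "h > 0"
    and \<tau>_pos: "\<And>x. x \<in> D \<Longrightarrow> \<tau> x > 0" and n_pos: "\<And>x. x \<in> D \<Longrightarrow> n x > 0"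
    and \<xi>_eq: "\<And>x. x \<in> D \<Longrightarrow> \<xi> = \<tau> x *\<^sub>R e1 x + n x *\<^sub>R e4 x"
    and mc: "\<And>x. x \<in> D \<Longrightarrow> mean_curv c f x = h *\<^sub>R e3 x"
    and bicons: "\<And>x. x \<in> D \<Longrightarrow> df f x (tang c f x (bitension c f x)) = 0"
begin

lemma snd_eq: assumes "x \<in> D" shows "snd w = \<tau> x * ip c w (e1 x) + n x * ip c w (e4 x)"
proof -
  have "snd w = ip c w (\<tau> x *\<^sub>R e1 x + n x *\<^sub>R e4 x)" using \<xi>_eq[OF assms] ip_\<xi>(1) by metis
  then show ?thesis by simp
qed

lemma snd_e:
  assumes "x \<in> D"
  shows "snd (e1 x) = \<tau> x" "snd (e2 x) = 0" "snd (e3 x) = 0" "snd (e4 x) = n x" "snd (dd f x v) = \<tau> x * \<theta>1 x v"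
  using snd_eq[OF assms, of "e1 x"] snd_eq[OF assms, of "e2 x"] snd_eq[OF assms, of "e3 x"]
    snd_eq[OF assms, of "e4 x"] snd_eq[OF assms, of "dd f x v"] onb[OF assms] onb'[OF assms] e_tan[OF assms] by simp_all

lemma \<tau>n: assumes "x \<in> D" shows "\<tau> x * \<tau> x + n x * n x = 1"
  using snd_eq[OF assms, of \<xi>] snd_e[OF assms] ip_\<xi>(2) by simp

lemma snd_dd: "x \<in> D \<Longrightarrow> A differentiable (at x) \<Longrightarrow> snd (dd A x v) = dd (\<lambda>y. snd (A y)) x v"
  using dd_linear_image[OF bounded_linear_snd] by metis

text \<open>The field \<xi> is constant and has components \<tau>, 0, 0, \<open>n\<close> in the
  frame. Differentiating the first two components expresses the derivative of \<open>T\<close>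
  through \<open>A\<^sub>N\<close>; the third, which is zero since \<open>H\<close> is orthogonal to
  \<xi>, gives the normal connection form.\<close>

lemma de_eqs:
  assumes x: "x \<in> D"
  shows "dd \<tau> x v = n x * ip c (dd e1 x v) (e4 x)"
    "\<tau> x * ip c (dd e1 x v) (e2 x) = n x * ip c (dd e2 x v) (e4 x)"
    "\<tau> x * ip c (dd e1 x v) (e3 x) = n x * ip c (dd e3 x v) (e4 x)"
proof -
  have "dd \<tau> x v = dd (\<lambda>y. snd (e1 y)) x v" by (rule dd_cong[OF open_D x]) (simp add: snd_e)
  then show "dd \<tau> x v = n x * ip c (dd e1 x v) (e4 x)"
    using snd_dd[OF x e_diff(1)[OF x], of v] snd_eq[OF x, of "dd e1 x v"] d_onb(1)[OF x] by simp
  have "dd (\<lambda>y. snd (e2 y)) x v = 0" "dd (\<lambda>y. snd (e3 y)) x v = 0"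
    by (rule dd_eq_0_if_const[OF x], simp add: snd_e)+
  then have "snd (dd e2 x v) = 0" "snd (dd e3 x v) = 0"
    using snd_dd[OF x e_diff(2)[OF x]] snd_dd[OF x e_diff(3)[OF x]] by simp_all
  then show "\<tau> x * ip c (dd e1 x v) (e2 x) = n x * ip c (dd e2 x v) (e4 x)"
    "\<tau> x * ip c (dd e1 x v) (e3 x) = n x * ip c (dd e3 x v) (e4 x)"
    using snd_eq[OF x, of "dd e2 x v"] snd_eq[OF x, of "dd e3 x v"] d_onb(5,6)[OF x] by simp_all
qed

lemma de_\<eta>:
  assumes x: "x \<in> D"
  shows "ip c (dd e1 x v) (\<eta> x) = - (n x * n x * \<theta>1 x v)" "ip c (dd e2 x v) (\<eta> x) = - \<theta>2 x v"
    "ip c (dd e3 x v) (\<eta> x) = 0" "ip c (dd e4 x v) (\<eta> x) = \<tau> x * n x * \<theta>1 x v"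
proof -
  have "n x * n x = 1 - \<tau> x * \<tau> x" using \<tau>n[OF x] by linarith
  then show "ip c (dd e1 x v) (\<eta> x) = - (n x * n x * \<theta>1 x v)"
    using d_onb(11)[OF x, of v] snd_e[OF x] by (simp only:) (simp add: algebra_simps)
qed (simp_all add: d_onb(12-14)[OF x] snd_e[OF x])

lemma \<alpha>_eq:
  assumes x: "x \<in> D"
  shows "ip c (dd e1 x v) (e3 x) = ip c (ddf x v (u1 x)) (e3 x)" "ip c (dd e2 x v) (e3 x) = ip c (ddf x v (u2 x)) (e3 x)"
    "ip c (dd e1 x v) (e4 x) = ip c (ddf x v (u1 x)) (e4 x)" "ip c (dd e2 x v) (e4 x) = ip c (ddf x v (u2 x)) (e4 x)"
  by (simp_all add: de_eq[OF x] e_tan[OF x])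

lemma \<alpha>_sym:
  assumes x: "x \<in> D"
  shows "ip c (dd e1 x (u2 x)) (e3 x) = ip c (dd e2 x (u1 x)) (e3 x)"
    "ip c (dd e1 x (u2 x)) (e4 x) = ip c (dd e2 x (u1 x)) (e4 x)"
  unfolding \<alpha>_eq[OF x] using ddf_sym[OF x] by metis+

lemma trace_eq:
  assumes x: "x \<in> D"
  shows "ip c (dd e1 x (u1 x)) (e3 x) + ip c (dd e2 x (u2 x)) (e3 x) = 2 * h"
    "ip c (dd e1 x (u1 x)) (e4 x) + ip c (dd e2 x (u2 x)) (e4 x) = 0"
  using arg_cong[OF mc[OF x, unfolded mean_curv_eq[OF x]], of "\<lambda>w. ip c w (e3 x)"]
    arg_cong[OF mc[OF x, unfolded mean_curv_eq[OF x]], of "\<lambda>w. ip c w (e4 x)"]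
  by (simp_all add: onb[OF x] onb'[OF x] \<alpha>_eq[OF x])

lemma de3_df_sym: "x \<in> D \<Longrightarrow> ip c (dd e3 x v) (dd f x w) = ip c (dd e3 x w) (dd f x v)"
  using S_eq(1)[of x v w] S_eq(1)[of x w v] ddf_sym[of x v w] by simp

lemma de3_diff: "x \<in> D \<Longrightarrow> (\<lambda>y. dd e3 y w) differentiable (at x)"
  using smooth_on_differentiable[OF smooth_on_dd[OF e_smooth(3)]] .

text \<open>The tension field is \<open>2 * h\<close> times \<open>e3\<close>. Since
  \<open>e3\<close> is orthogonal to \<xi>, the curvature term of the bitension field is a multiple
  of \<open>e3\<close> and hence normal, and the derivatives of \<open>e3\<close> have no component
  along \<eta>. Only the rough Laplacian of \<open>e3\<close> remains.\<close>

lemma tangential_bitension: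
  assumes x: "x \<in> D"
  shows "ip c (dd (\<lambda>y. dd e3 y (u1 x)) x (u1 x)) (dd f x z) - ip c (dd e3 x (LC c f (\<lambda>_. u1 x) x (u1 x))) (dd f x z)
    + (ip c (dd (\<lambda>y. dd e3 y (u2 x)) x (u2 x)) (dd f x z) - ip c (dd e3 x (LC c f (\<lambda>_. u2 x) x (u2 x))) (dd f x z)) = 0"
proof -
  let ?W = "tension c f"
  have T: "?W y = (2 * h) *\<^sub>R e3 y" if "y \<in> D" for y
    using arg_cong[OF mc[OF that], of "\<lambda>w. 2 *\<^sub>R w"] by (simp add: tension_def mean_curv_def)
  have dT: "dd ?W y w = (2 * h) *\<^sub>R dd e3 y w" if "y \<in> D" for y w
  proof -
    have "dd ?W y w = dd (\<lambda>y. (2 * h) *\<^sub>R e3 y) y w" by (rule dd_cong[OF open_D that]) (rule T)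
    then show ?thesis using dd_linear_image[OF bounded_linear_scaleR_right e_diff(3)[OF that]] by simp
  qed
  have nabT: "nab c f ?W y w = (2 * h) *\<^sub>R dd e3 y w" if "y \<in> D" for y w
    using de_\<eta>(3)[OF that] ip_sym[of c "\<eta> y" "dd e3 y w"] by (simp add: nab_def dT[OF that] proj_f)
  have nab2: "nab c f (\<lambda>y. nab c f ?W y w) x v = (2 * h) *\<^sub>R proj c (f x) (dd (\<lambda>y. dd e3 y w) x v)" for v w
  proof -
    have "dd (\<lambda>y. nab c f ?W y w) x v = dd (\<lambda>y. (2 * h) *\<^sub>R dd e3 y w) x v"
      by (rule dd_cong[OF open_D x]) (rule nabT)
    also have "\<dots> = (2 * h) *\<^sub>R dd (\<lambda>y. dd e3 y w) x v"
      by (rule dd_linear_image[OF bounded_linear_scaleR_right de3_diff[OF x]])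
    finally have "dd (\<lambda>y. nab c f ?W y w) x v = (2 * h) *\<^sub>R dd (\<lambda>y. dd e3 y w) x v" .
    then show ?thesis by (simp add: nab_def linear_cmul[OF proj_linear])
  qed
  define \<beta> where "\<beta> v w = nab c f (\<lambda>y. nab c f ?W y w) x v - nab c f ?W x (LC c f (\<lambda>_. w) x v)" for v w
  have \<beta>: "\<beta> v w = (2 * h) *\<^sub>R (proj c (f x) (dd (\<lambda>y. dd e3 y w) x v) - dd e3 x (LC c f (\<lambda>_. w) x v))" for v w
    by (simp add: \<beta>_def nab2 nabT[OF x] algebra_simps)
  have e3sym: "dd (\<lambda>y. dd e3 y w) x v = dd (\<lambda>y. dd e3 y v) x w" for v w
    by (rule dd_symmetric[OF open_D e_smooth(3) x])
  have LCsym: "LC c f (\<lambda>_. w) x v = LC c f (\<lambda>_. v) x w" for v w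
    unfolding LC_const[OF x] ddf_sym[OF x, of v w] by simp
  have lin1: "linear (\<lambda>v. \<beta> v w)" for w
    unfolding \<beta> LC_const[OF x]
    by (rule linearI) (simp_all add: dd_linear[OF de3_diff[OF x]] dd_linear[OF e_diff(3)[OF x]] ddf_lin[OF x]
      linear_add[OF proj_linear] linear_cmul[OF proj_linear] algebra_simps)
  have "\<beta> v w = \<beta> w v" for v w unfolding \<beta> e3sym[of w v] LCsym[of w v] by simp
  then have lin2: "linear (\<lambda>w. \<beta> v w)" for v using lin1[of v] by simp
  have rl: "rough_laplacian c f ?W x = \<beta> (u1 x) (u1 x) + \<beta> (u2 x) (u2 x)"
    unfolding rough_laplacian_def \<beta>_def[symmetric] by (rule tr_frame[OF x lin1 lin2])
  define \<gamma> where "\<gamma> v w = curv c (f x) (df f x v) (?W x) (df f x w)" for v w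
  have pe3: "pos (e3 x) = e3 x" by (simp add: pos_eq snd_e[OF x])
  have pW: "pos (?W x) = (2 * h) *\<^sub>R e3 x"
    unfolding T[OF x] using linear_cmul[OF bounded_linear.linear[OF bounded_linear_pos]] pe3 by simp
  have \<gamma>: "\<gamma> v w = - (2 * h * c * ip c (pos (dd f x v)) (dd f x w)) *\<^sub>R e3 x" for v w
    unfolding \<gamma>_def
    by (subst curv_eq[OF f_MxR[OF x] c_nz]) (simp_all add: df_def T[OF x] pW ip_df_\<eta>[OF x] onb'[OF x] pW[unfolded T[OF x]])
  have lin\<gamma>: "linear (\<lambda>v. \<gamma> v w)" "linear (\<lambda>v. \<gamma> w v)" for w
    unfolding \<gamma> ip_pos by (rule linearI; simp add: df_lin[OF x] algebra_simps)+
  have t\<gamma>: "ip c (tr c f x \<gamma>) (dd f x z) = 0"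
    unfolding tr_frame[OF x lin\<gamma>] \<gamma> by (simp add: onb'[OF x])
  have "tang c f x (bitension c f x) = 0"
    using bicons[OF x] df_inj[OF x, of _ 0] df_lin(4)[OF x] unfolding df_def by metis
  then have "ip c (bitension c f x) (dd f x z) = 0"
    using metric_tang[OF x, of "bitension c f x" z] by (simp add: metric_eq df_lin[OF x])
  then have "ip c (\<beta> (u1 x) (u1 x)) (dd f x z) + ip c (\<beta> (u2 x) (u2 x)) (dd f x z) = 0"
    using t\<gamma> unfolding bitension_def rl \<gamma>_def[abs_def] by simp
  then have "2 * h * (ip c (dd (\<lambda>y. dd e3 y (u1 x)) x (u1 x)) (dd f x z) - ip c (dd e3 x (LC c f (\<lambda>_. u1 x) x (u1 x))) (dd f x z)
    + (ip c (dd (\<lambda>y. dd e3 y (u2 x)) x (u2 x)) (dd f x z) - ip c (dd e3 x (LC c f (\<lambda>_. u2 x) x (u2 x))) (dd f x z))) = 0"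
    unfolding \<beta> by (simp add: ip_proj_tangent[OF ip_df_\<eta>(2)[OF x]] algebra_simps)
  then show ?thesis using h_pos by simp
qed

text \<open>The left side is, up to sign conventions, the \<open>z\<close>-component of the trace of
  \<open>A\<close> in the direction of the normal derivative of \<open>e3\<close>. The gradient term
  is absent because the trace of the shape operator of \<open>e3\<close> is the constant
  \<open>2 * h\<close>.\<close>

lemma biconservative_eq:
  assumes x: "x \<in> D"
  shows "ip c (dd e3 x (u1 x)) (e4 x) * ip c (dd e1 x z) (e4 x) + ip c (dd e3 x (u2 x)) (e4 x) * ip c (dd e2 x z) (e4 x) = 0"
proof -
  let ?D2 = "\<lambda>v w. dd (\<lambda>y. dd e3 y w) x v"
  \<comment> \<open>The derivative of the symmetry of the shape operator. Together with
    \<open>e3sym\<close> it converts the trace of the second derivative of \<open>e3\<close> into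
    the derivative of a constant trace.\<close>
  have F: "ip c (?D2 v w) (dd f x z) + ip c (dd e3 x w) (ddf x v z) = ip c (?D2 v z) (dd f x w) + ip c (dd e3 x z) (ddf x v w)"
    for v w z
  proof -
    have "dd (\<lambda>y. ip c (dd e3 y w) (dd f y z)) x v = dd (\<lambda>y. ip c (dd e3 y z) (dd f y w)) x v"
      by (rule dd_cong[OF open_D x]) (rule de3_df_sym)
    then show ?thesis unfolding dd_ip[OF de3_diff[OF x] df_diff[OF x]] .
  qed
  have ud: "u1 differentiable at x" "u2 differentiable at x"
    using smooth_on_differentiable[OF _ x] frame_smooth by blast+
  have ed: "(\<lambda>y. dd e3 y (u1 y)) differentiable at x" "(\<lambda>y. dd e3 y (u2 y)) differentiable at x"
    using smooth_on_differentiable[OF smooth_on_dd_field[OF open_D e_smooth(3)] x] frame_smooth by blast+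
  have const: "ip c (dd e3 y (u1 y)) (e1 y) + ip c (dd e3 y (u2 y)) (e2 y) = - (2 * h)" if "y \<in> D" for y
    using trace_eq(1)[OF that] d_onb(6,7)[OF that] by simp
  have "dd (\<lambda>y. ip c (dd e3 y (u1 y)) (e1 y) + ip c (dd e3 y (u2 y)) (e2 y)) x z = 0"
    by (rule dd_eq_0_if_const[OF x, where k = "- (2 * h)"]) (rule const)
  moreover have "(\<lambda>y. ip c (dd e3 y (u1 y)) (e1 y)) differentiable at x" "(\<lambda>y. ip c (dd e3 y (u2 y)) (e2 y)) differentiable at x"
    using smooth_on_differentiable[OF smooth_on_ip[OF open_D smooth_on_dd_field[OF open_D e_smooth(3)]] x]
      frame_smooth e_smooth by blast+
  ultimately have tr: "ip c (?D2 z (u1 x)) (e1 x) + ip c (dd e3 x (dd u1 x z)) (e1 x) + ip c (dd e3 x (u1 x)) (dd e1 x z)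
     + (ip c (?D2 z (u2 x)) (e2 x) + ip c (dd e3 x (dd u2 x z)) (e2 x) + ip c (dd e3 x (u2 x)) (dd e2 x z)) = 0"
    by (simp add: dd_add dd_ip[OF ed(1) e_diff(1)[OF x]] dd_ip[OF ed(2) e_diff(2)[OF x]]
        dd_dd_field[OF open_D e_smooth(3) x ud(1)] dd_dd_field[OF open_D e_smooth(3) x ud(2)])
  have e3sym: "?D2 v w = ?D2 w v" for v w by (rule dd_symmetric[OF open_D e_smooth(3) x])
  \<comment> \<open>The shape operator is moved to the other argument. Since
    \<open>dd e3 x z\<close> has no component along \<open>e3\<close> or \<eta>, the tangential
    product is the full product minus its \<open>e4\<close> part.\<close>
  have K: "ip c (dd e3 x (LC c f (\<lambda>_. v) x v)) (dd f x z)
      = ip c (dd e3 x z) (ddf x v v) - ip c (dd e3 x z) (e4 x) * ip c (ddf x v v) (e4 x)" for v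
    unfolding de3_df_sym[OF x, of "LC c f (\<lambda>_. v) x v"]
    unfolding LC_const[OF x]
    by (subst parseval[OF x, of _ "ddf x v v"])
      (simp add: df_lin[OF x] d_onb[OF x] snd_e[OF x] algebra_simps flip: e1_def e2_def)
  have U: "ip c (dd e3 x (dd u1 x z)) (e1 x) = ip c (dd e3 x (u1 x)) (dd e1 x z) - ip c (dd e3 x (u1 x)) (ddf x z (u1 x))"
    "ip c (dd e3 x (dd u2 x z)) (e2 x) = ip c (dd e3 x (u2 x)) (dd e2 x z) - ip c (dd e3 x (u2 x)) (ddf x z (u2 x))"
    using de3_df_sym[OF x, of "dd u1 x z" "u1 x"] de3_df_sym[OF x, of "dd u2 x z" "u2 x"]
    by (simp_all add: de_eq[OF x] flip: e1_def e2_def)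
  have B: "ip c (ddf x (u1 x) (u1 x)) (e4 x) + ip c (ddf x (u2 x) (u2 x)) (e4 x) = 0"
    using trace_eq(2)[OF x] \<alpha>_eq[OF x] by simp
  \<comment> \<open>All second derivatives of \<open>e3\<close> cancel, and what \<open>K\<close>
    leaves over is a multiple of the trace of the shape operator of \<open>e4\<close>, which
    vanishes by \<open>B\<close>.\<close>
  have sum: "ip c (dd e3 x (u1 x)) (dd e1 x z) + ip c (dd e3 x (u2 x)) (dd e2 x z) = 0"
  proof -
    have "ip c (dd e3 x z) (e4 x) * (ip c (ddf x (u1 x) (u1 x)) (e4 x) + ip c (ddf x (u2 x) (u2 x)) (e4 x)) = 0"
      using B by simp
    then show ?thesis
      using tangential_bitension[OF x, of z] tr U F[of "u1 x" "u1 x" z] F[of "u2 x" "u2 x" z]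
      unfolding K e3sym[of z] ddf_sym[OF x, of z] e1_def[symmetric] e2_def[symmetric]
      by (simp add: algebra_simps)
  qed
  \<comment> \<open>The tangential products cancel: the matrix of the shape operator of
    \<open>e3\<close> is symmetric, whereas the connection form between \<open>e1\<close> and
    \<open>e2\<close> is skew.\<close>
  then show ?thesis
    using \<alpha>_sym[OF x]
    by (subst (asm) (1 2) parseval[OF x]) (simp add: d_onb[OF x] snd_e[OF x] algebra_simps)
qed

end

section \<open>Vanishing of \<open>A\<^sub>N\<close> and flatness\<close>

context cmc begin

lemma d\<theta>:
  assumes x: "x \<in> D"
  shows "dd (\<lambda>y. \<theta>1 y w) x v = ip c (ddf x v w) (e1 x) + ip c (dd e1 x v) (dd f x w)"
    "dd (\<lambda>y. \<theta>2 y w) x v = ip c (ddf x v w) (e2 x) + ip c (dd e2 x v) (dd f x w)"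
  using dd_ip[OF df_diff[OF x] e_diff(1)[OF x], of c w v] dd_ip[OF df_diff[OF x] e_diff(2)[OF x], of c w v]
  by (simp_all add: ip_sym[of c "dd f x w"])

lemma linear_ip_dd: "A differentiable (at x) \<Longrightarrow> linear (\<lambda>v. ip c (dd A x v) z)"
  by (rule linearI) (simp_all add: dd_linear)

text \<open>Where \<open>A\<^sub>N\<close> does not vanish, the biconservative equation forces \<open>A\<^sub>H T = 0\<close>; then \<open>H\<close> is parallel in
  the normal bundle and the Codazzi equation for \<open>A\<^sub>H\<close>, which has the distinct constant eigenvalues
  \<open>0\<close> and \<open>2|H|\<^sup>2\<close>, makes \<open>T/|T|\<close> parallel, so \<open>A\<^sub>N = 0\<close> after all.\<close>

lemma A\<^sub>N_zero:
  assumes x: "x \<in> D"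
  shows "ip c (dd e1 x v) (e4 x) = 0" "ip c (dd e2 x v) (e4 x) = 0"
proof -
  define b1 where "b1 y = ip c (dd e1 y (u1 y)) (e4 y)" for y
  define b2 where "b2 y = ip c (dd e1 y (u2 y)) (e4 y)" for y
  have "b1 x * b1 x + b2 x * b2 x = 0"
  proof (rule ccontr)
    assume nz: "b1 x * b1 x + b2 x * b2 x \<noteq> 0"
    \<comment> \<open>The contradiction needs derivatives of \<open>e3\<close>, so the assumption at
      \<open>x\<close> is spread to a neighbourhood.\<close>
    define U where "U = {y \<in> D. b1 y * b1 y + b2 y * b2 y \<in> - {0}}"
    have "smooth_on D b1" "smooth_on D b2"
      unfolding b1_def[abs_def] b2_def[abs_def]
      by (intro smooth_on_ip smooth_on_dd_field open_D e_smooth frame_smooth)+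
    then have "continuous_on D (\<lambda>y. b1 y * b1 y + b2 y * b2 y)"
      by (intro continuous_intros smooth_on_continuous)
    then have "open (D \<inter> (\<lambda>y. b1 y * b1 y + b2 y * b2 y) -` (-{0}))"
      by (rule continuous_open_preimage[OF _ open_D]) auto
    then have oU: "open U" unfolding U_def Int_def vimage_def by simp
    have xU: "x \<in> U" using x nz by (simp add: U_def)
    have UD: "y \<in> D" if "y \<in> U" for y using that by (simp add: U_def)
    \<comment> \<open>The matrix of the shape operator of \<open>e4\<close> has rows
      \<open>(b1, b2)\<close> and \<open>(b2, -b1)\<close>; its square is
      \<open>b1 * b1 + b2 * b2\<close> times the identity, so it can be cancelled.\<close>
    have A0: "ip c (dd e1 y (u1 y)) (e3 y) = 0" "ip c (dd e1 y (u2 y)) (e3 y) = 0" if y: "y \<in> U" for y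
    proof -
      let ?A1 = "ip c (dd e1 y (u1 y)) (e3 y)" and ?A2 = "ip c (dd e1 y (u2 y)) (e3 y)"
      let ?m1 = "ip c (dd e3 y (u1 y)) (e4 y)" and ?m2 = "ip c (dd e3 y (u2 y)) (e4 y)"
      have D: "y \<in> D" and nz: "b1 y * b1 y + b2 y * b2 y \<noteq> 0" using y by (simp_all add: U_def)
      have m: "\<tau> y * ?A1 = n y * ?m1" "\<tau> y * ?A2 = n y * ?m2" using de_eqs(3)[OF D] by blast+
      have b: "ip c (dd e2 y (u1 y)) (e4 y) = b2 y" "ip c (dd e2 y (u2 y)) (e4 y) = - b1 y"
        using \<alpha>_sym(2)[OF D] trace_eq(2)[OF D] by (simp_all add: b1_def b2_def)
      have "?m1 * b1 y + ?m2 * b2 y = 0" "?m1 * b2 y - ?m2 * b1 y = 0"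
        using biconservative_eq[OF D, of "u1 y"] biconservative_eq[OF D, of "u2 y"] b
        by (simp_all add: b1_def b2_def)
      then have "\<tau> y * (?A1 * b1 y + ?A2 * b2 y) = 0" "\<tau> y * (?A1 * b2 y - ?A2 * b1 y) = 0"
        using m by (algebra)+
      then have "?A1 * b1 y + ?A2 * b2 y = 0" "?A1 * b2 y - ?A2 * b1 y = 0" using \<tau>_pos[OF D] by simp_all
      then have "?A1 * (b1 y * b1 y + b2 y * b2 y) = 0" "?A2 * (b1 y * b1 y + b2 y * b2 y) = 0"
        by algebra+
      then show "?A1 = 0" "?A2 = 0" using nz mult_eq_0_iff by blast+
    qed
    have de3: "dd e3 y v = (- 2 * h) *\<^sub>R (\<theta>2 y v *\<^sub>R e2 y)" if y: "y \<in> U" for y v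
    proof -
      note D = UD[OF y]
      have a1: "ip c (dd e1 y v) (e3 y) = 0"
        by (subst form_expand[OF D linear_ip_dd[OF e_diff(1)[OF D]]]) (simp add: A0[OF y])
      have a2: "ip c (dd e2 y v) (e3 y) = 2 * h * \<theta>2 y v"
        using A0[OF y] \<alpha>_sym(1)[OF D] trace_eq(1)[OF D]
        by (subst form_expand[OF D linear_ip_dd[OF e_diff(2)[OF D]]]) simp
      have "ip c (dd e3 y v) (e4 y) = 0" using de_eqs(3)[OF D, of v] a1 n_pos[OF D] by simp
      then show ?thesis
        by (subst expand[OF D]) (simp add: d_onb(3,6,7)[OF D] de_\<eta>[OF D] a1 a2)
    qed
    have dx: "(\<lambda>y. \<theta>2 y w) differentiable (at x)" for w
      by (rule smooth_on_differentiable[OF smooth_on_ip[OF open_D smooth_on_dd[OF f_smooth] e_smooth(2)] x])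
    have dde3: "dd (\<lambda>y. dd e3 y w) x v = (- 2 * h) *\<^sub>R (dd (\<lambda>y. \<theta>2 y w) x v *\<^sub>R e2 x + \<theta>2 x w *\<^sub>R dd e2 x v)" for v w
    proof -
      have "dd (\<lambda>y. dd e3 y w) x v = dd (\<lambda>y. (- 2 * h) *\<^sub>R (\<theta>2 y w *\<^sub>R e2 y)) x v"
        by (rule dd_cong[OF oU xU]) (rule de3)
      also have "\<dots> = (- 2 * h) *\<^sub>R dd (\<lambda>y. \<theta>2 y w *\<^sub>R e2 y) x v"
        by (rule dd_linear_image[OF bounded_linear_scaleR_right]) (intro differentiable_scaleR dx e_diff(2)[OF x])
      finally show ?thesis unfolding dd_scaleR[OF dx e_diff(2)[OF x]] .
    qed
    \<comment> \<open>The Codazzi equation, as symmetry of the second derivative of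
      \<open>e3\<close> computed from \<open>de3\<close>.\<close>
    have sym: "dd (\<lambda>y. \<theta>2 y (u2 x)) x (u1 x) *\<^sub>R e2 x + \<theta>2 x (u2 x) *\<^sub>R dd e2 x (u1 x)
      = dd (\<lambda>y. \<theta>2 y (u1 x)) x (u2 x) *\<^sub>R e2 x + \<theta>2 x (u1 x) *\<^sub>R dd e2 x (u2 x)"
      using dd_symmetric[OF open_D e_smooth(3) x, of "u2 x" "u1 x"] h_pos unfolding dde3 by simp
    have 1: "ip c (dd e2 x (u1 x)) (e1 x) = 0"
      using arg_cong[OF sym, of "\<lambda>w. ip c w (e1 x)"] by (simp add: \<theta>_u[OF x] onb'[OF x])
    have "dd (\<lambda>y. \<theta>2 y (u2 x)) x (u1 x) = dd (\<lambda>y. \<theta>2 y (u1 x)) x (u2 x)"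
      using arg_cong[OF sym, of "\<lambda>w. ip c w (e2 x)"] by (simp add: \<theta>_u[OF x] onb[OF x] d_onb(2)[OF x])
    \<comment> \<open>Here the exterior derivative of \<theta>2 vanishes on the frame; the second
      derivative of \<open>f\<close> drops out by symmetry and leaves the connection form.\<close>
    then have 2: "ip c (dd e2 x (u2 x)) (e1 x) = 0"
      unfolding d\<theta>[OF x] ddf_sym[OF x, of "u1 x" "u2 x"] by (simp add: d_onb(2)[OF x] flip: e1_def e2_def)
    have "ip c (dd e2 x (u1 x)) (e4 x) = 0" "ip c (dd e2 x (u2 x)) (e4 x) = 0"
      using 1 2 de_eqs(2)[OF x, of "u1 x"] de_eqs(2)[OF x, of "u2 x"] n_pos[OF x] d_onb(5)[OF x] by simp_all
    then have "b1 x = 0" "b2 x = 0"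
      using \<alpha>_sym(2)[OF x] trace_eq(2)[OF x] by (simp_all add: b1_def b2_def)
    then show False using nz by simp
  qed
  then have b: "b1 x = 0" "b2 x = 0" by (simp_all add: sum_squares_eq_zero_iff)
  show "ip c (dd e1 x v) (e4 x) = 0"
    using b by (subst form_expand[OF x linear_ip_dd[OF e_diff(1)[OF x]]]) (simp add: b1_def b2_def)
  show "ip c (dd e2 x v) (e4 x) = 0"
    using b \<alpha>_sym(2)[OF x] trace_eq(2)[OF x]
    by (subst form_expand[OF x linear_ip_dd[OF e_diff(2)[OF x]]]) (simp add: b1_def b2_def)
qed

text \<open>With \<open>A\<^sub>N = 0\<close> the derivative of \<xi> leaves neither a tangential
  connection form nor a change of length of \<open>T\<close>.\<close>

lemma de_parallel:
  assumes x: "x \<in> D"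
  shows "ip c (dd e1 x v) (e2 x) = 0" "ip c (dd e2 x v) (e1 x) = 0" "dd \<tau> x v = 0"
  using de_eqs(1,2)[OF x, of v] A\<^sub>N_zero[OF x, of v] \<tau>_pos[OF x] d_onb(5)[OF x] by simp_all

lemma d\<theta>':
  assumes x: "x \<in> D"
  shows "dd (\<lambda>y. \<theta>1 y w) x v = ip c (ddf x v w) (e1 x)" "dd (\<lambda>y. \<theta>2 y w) x v = ip c (ddf x v w) (e2 x)"
proof -
  have "ip c (dd e1 x v) (dd f x w) = 0" "ip c (dd e2 x v) (dd f x w) = 0"
    by (subst df_expand[OF x, of w]; simp add: d_onb(1,2)[OF x] de_parallel[OF x])+
  then show "dd (\<lambda>y. \<theta>1 y w) x v = ip c (ddf x v w) (e1 x)" "dd (\<lambda>y. \<theta>2 y w) x v = ip c (ddf x v w) (e2 x)"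
    unfolding d\<theta>[OF x] by simp_all
qed

text \<open>The coframe of a parallel frame: its derivatives are components of the symmetric second
  derivative of \<open>f\<close>. These closed forms later integrate to flat coordinates.\<close>

lemma \<theta>_closed:
  assumes x: "x \<in> D"
  shows "dd (\<lambda>y. \<theta>1 y w) x v = dd (\<lambda>y. \<theta>1 y v) x w" "dd (\<lambda>y. \<theta>2 y w) x v = dd (\<lambda>y. \<theta>2 y v) x w"
  unfolding d\<theta>'[OF x] ddf_sym[OF x, of v w] by simp_all

lemma \<theta>_smooth: "smooth_on D (\<lambda>y. \<theta>1 y w)" "smooth_on D (\<lambda>y. \<theta>2 y w)"
  by (intro smooth_on_ip open_D smooth_on_dd f_smooth e_smooth)+

lemma LC_smooth: "smooth_on D (\<lambda>y. LC c f (\<lambda>_. z) y w)"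
proof (rule smooth_on_cong[OF open_D])
  show "ip c (ddf y w z) (e1 y) *\<^sub>R u1 y + ip c (ddf y w z) (e2 y) *\<^sub>R u2 y = LC c f (\<lambda>_. z) y w" if "y \<in> D" for y
    using LC_const[OF that] by simp
  show "smooth_on D (\<lambda>y. ip c (ddf y w z) (e1 y) *\<^sub>R u1 y + ip c (ddf y w z) (e2 y) *\<^sub>R u2 y)"
    by (intro smooth_on_add smooth_on_scaleR smooth_on_ip open_D smooth_on_dd f_smooth e_smooth frame_smooth)
qed

text \<open>In a parallel frame covariant differentiation is ordinary differentiation of components,
  so the curvature reduces to a commutator of second derivatives.\<close>

lemma flat:
  assumes x: "x \<in> D"
  shows "surf_curv c f x v w z = 0"
proof -
  have *: "\<theta>1 x (LC c f (\<lambda>y. LC c f (\<lambda>_. z) y w) x v) = dd (\<lambda>y. dd (\<lambda>y. \<theta>1 y z) y w) x v"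
    "\<theta>2 x (LC c f (\<lambda>y. LC c f (\<lambda>_. z) y w) x v) = dd (\<lambda>y. dd (\<lambda>y. \<theta>2 y z) y w) x v" for v w
  proof -
    let ?Z = "\<lambda>y. LC c f (\<lambda>_. z) y w"
    have d: "(\<lambda>y. dd f y (?Z y)) differentiable (at x)"
      by (rule smooth_on_differentiable[OF smooth_on_dd_field[OF open_D f_smooth LC_smooth] x])
    have 0: "ip c (dd f x (?Z x)) (dd e1 x v) = 0" "ip c (dd f x (?Z x)) (dd e2 x v) = 0"
      by (subst df_expand[OF x, of "?Z x"];
          simp add: d_onb(1,2)[OF x] de_parallel[OF x] ip_sym[of c "e1 x" "dd _ x v"] ip_sym[of c "e2 x" "dd _ x v"])+
    have "dd (\<lambda>y. dd (\<lambda>y. \<theta>1 y z) y w) x v = dd (\<lambda>y. \<theta>1 y (?Z y)) x v"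
      by (rule dd_cong[OF open_D x]) (simp add: d\<theta>' \<theta>_LC)
    then show "\<theta>1 x (LC c f ?Z x v) = dd (\<lambda>y. dd (\<lambda>y. \<theta>1 y z) y w) x v"
      unfolding \<theta>_LC[OF x] dd_ip[OF d e_diff(1)[OF x]] using 0 by simp
    have "dd (\<lambda>y. dd (\<lambda>y. \<theta>2 y z) y w) x v = dd (\<lambda>y. \<theta>2 y (?Z y)) x v"
      by (rule dd_cong[OF open_D x]) (simp add: d\<theta>' \<theta>_LC)
    then show "\<theta>2 x (LC c f ?Z x v) = dd (\<lambda>y. dd (\<lambda>y. \<theta>2 y z) y w) x v"
      unfolding \<theta>_LC[OF x] dd_ip[OF d e_diff(2)[OF x]] using 0 by simp
  qed
  have "\<theta>1 x (surf_curv c f x v w z) = 0" "\<theta>2 x (surf_curv c f x v w z) = 0"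
    unfolding surf_curv_def df_lin[OF x] ip_simps *
    using dd_symmetric[OF open_D \<theta>_smooth(1) x, of z w v] dd_symmetric[OF open_D \<theta>_smooth(2) x, of z w v] by simp_all
  then show ?thesis by (subst v_expand[OF x]) simp
qed

section \<open>The matrix of \<open>A\<^sub>H\<close>: Gauss, Codazzi and constancy\<close>

text \<open>Entries of the shape operator of the unit vector \<open>e3\<close> in the frame
  \<open>u1\<close>, \<open>u2\<close>. The missing diagonal entry is \<open>2 * h - A11 x\<close>,
  so the eigenvalues average to \<open>h\<close>.\<close>

definition "A11 x = ip c (dd e1 x (u1 x)) (e3 x)"
definition "A12 x = ip c (dd e1 x (u2 x)) (e3 x)"

lemma \<alpha>_A:
  assumes x: "x \<in> D"
  shows "ip c (dd e1 x v) (e3 x) = \<theta>1 x v * A11 x + \<theta>2 x v * A12 x"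
    "ip c (dd e2 x v) (e3 x) = \<theta>1 x v * A12 x + \<theta>2 x v * (2 * h - A11 x)"
proof -
  show "ip c (dd e1 x v) (e3 x) = \<theta>1 x v * A11 x + \<theta>2 x v * A12 x"
    by (subst form_expand[OF x linear_ip_dd[OF e_diff(1)[OF x]]]) (simp add: A11_def A12_def)
  have "ip c (dd e2 x (u2 x)) (e3 x) = 2 * h - A11 x" "ip c (dd e2 x (u1 x)) (e3 x) = A12 x"
    using \<alpha>_sym(1)[OF x] trace_eq(1)[OF x] by (simp_all add: A11_def A12_def)
  then show "ip c (dd e2 x v) (e3 x) = \<theta>1 x v * A12 x + \<theta>2 x v * (2 * h - A11 x)"
    by (subst form_expand[OF x linear_ip_dd[OF e_diff(2)[OF x]]]) simp
qed

lemma de1_diff: "x \<in> D \<Longrightarrow> (\<lambda>y. dd e1 y w) differentiable (at x)" "x \<in> D \<Longrightarrow> (\<lambda>y. dd e2 y w) differentiable (at x)"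
  by (rule smooth_on_differentiable[OF smooth_on_dd[OF e_smooth(1)]], assumption)
    (rule smooth_on_differentiable[OF smooth_on_dd[OF e_smooth(2)]])

text \<open>Differentiating the vanishing connection form and using the symmetry of the second
  derivative of \<open>e1\<close> gives an identity between products of first derivatives. Their
  \<open>e3\<close> parts form the determinant and their \<eta> parts the curvature term.\<close>

lemma gauss:
  assumes x: "x \<in> D"
  shows "A12 x * A12 x = A11 x * (2 * h - A11 x) + c * (1 - \<tau> x * \<tau> x)"
proof -
  have "ip c (dd (\<lambda>y. dd e1 y w) x v) (e2 x) = - ip c (dd e1 x w) (dd e2 x v)" for v w
    using ip_const_deriv[OF x de1_diff(1)[OF x] e_diff(2)[OF x], of w 0 v] de_parallel(1) ip_sym by metis
  then have "ip c (dd e1 x (u2 x)) (dd e2 x (u1 x)) = ip c (dd e1 x (u1 x)) (dd e2 x (u2 x))"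
    using dd_symmetric[OF open_D e_smooth(1) x, of "u2 x" "u1 x"] by (metis neg_equal_iff_equal)
  then show ?thesis
    using \<tau>n[OF x] c_nz
    by (subst (asm) (1 2) parseval[OF x])
      (simp add: d_onb(1,2)[OF x] de_parallel[OF x] A\<^sub>N_zero[OF x] de_\<eta>[OF x] \<theta>_u[OF x] \<alpha>_A[OF x] algebra_simps, algebra)
qed

lemma A_diff: "x \<in> D \<Longrightarrow> A11 differentiable (at x)" "x \<in> D \<Longrightarrow> A12 differentiable (at x)"
proof -
  have "smooth_on D A11" "smooth_on D A12"
    unfolding A11_def[abs_def] A12_def[abs_def]
    by (intro smooth_on_ip smooth_on_dd_field open_D e_smooth frame_smooth)+
  then show "x \<in> D \<Longrightarrow> A11 differentiable (at x)" "x \<in> D \<Longrightarrow> A12 differentiable (at x)"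
    using smooth_on_differentiable by blast+
qed

text \<open>Derivatives of \<open>e3\<close> are tangential or along \<open>e4\<close>, whereas
  those of \<open>e1\<close> and \<open>e2\<close> have no such components. So no product of first
  derivatives interferes with the symmetry of second derivatives.\<close>

lemma \<alpha>_closed:
  assumes x: "x \<in> D"
  shows "dd (\<lambda>y. ip c (dd e1 y w) (e3 y)) x v = dd (\<lambda>y. ip c (dd e1 y v) (e3 y)) x w"
    "dd (\<lambda>y. ip c (dd e2 y w) (e3 y)) x v = dd (\<lambda>y. ip c (dd e2 y v) (e3 y)) x w"
proof -
  have "ip c (dd e1 x w) (dd e3 x v) = 0" "ip c (dd e2 x w) (dd e3 x v) = 0" for v w
    by (subst parseval[OF x]; simp add: d_onb(1-4)[OF x] de_parallel[OF x] A\<^sub>N_zero[OF x] de_\<eta>[OF x])+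
  then show "dd (\<lambda>y. ip c (dd e1 y w) (e3 y)) x v = dd (\<lambda>y. ip c (dd e1 y v) (e3 y)) x w"
    "dd (\<lambda>y. ip c (dd e2 y w) (e3 y)) x v = dd (\<lambda>y. ip c (dd e2 y v) (e3 y)) x w"
    unfolding dd_ip[OF de1_diff(1)[OF x] e_diff(3)[OF x]] dd_ip[OF de1_diff(2)[OF x] e_diff(3)[OF x]]
    using dd_symmetric[OF open_D e_smooth(1) x, of v w] dd_symmetric[OF open_D e_smooth(2) x, of v w] by simp_all
qed

text \<open>With closed \<theta>1 and \<theta>2, closedness of the rows of the shape operator
  becomes the Cauchy-Riemann system for \<open>A11\<close> and \<open>- A12\<close>.\<close>

lemma codazzi:
  assumes x: "x \<in> D"
  shows "dd A12 x (u1 x) = dd A11 x (u2 x)" "dd A12 x (u2 x) = - dd A11 x (u1 x)"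
proof -
  have \<theta>d: "(\<lambda>y. \<theta>1 y w) differentiable (at x)" "(\<lambda>y. \<theta>2 y w) differentiable (at x)" for w
    using smooth_on_differentiable[OF _ x] \<theta>_smooth by blast+
  note dm = dd_mult[OF \<theta>d(1)] dd_mult[OF \<theta>d(2)]
  have d2: "(\<lambda>y. 2 * h - A11 y) differentiable (at x)" by (intro derivative_intros A_diff[OF x])
  have dd2: "dd (\<lambda>y. 2 * h - A11 y) x v = - dd A11 x v" for v
    using dd_diff[of "\<lambda>_. 2 * h", OF _ A_diff(1)[OF x]] by simp
  have "dd (\<lambda>y. ip c (dd e1 y w) (e3 y)) x v = dd (\<lambda>y. \<theta>1 y w * A11 y + \<theta>2 y w * A12 y) x v" for v w
    by (rule dd_cong[OF open_D x]) (rule \<alpha>_A)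
  also have "dd (\<lambda>y. \<theta>1 y w * A11 y + \<theta>2 y w * A12 y) x v = dd (\<lambda>y. \<theta>1 y w) x v * A11 x + \<theta>1 x w * dd A11 x v
      + (dd (\<lambda>y. \<theta>2 y w) x v * A12 x + \<theta>2 x w * dd A12 x v)" for v w
    by (subst dd_add) (auto intro!: differentiable_mult \<theta>d A_diff[OF x] simp: dm A_diff[OF x])
  finally have 1: "dd (\<lambda>y. ip c (dd e1 y w) (e3 y)) x v = dd (\<lambda>y. \<theta>1 y w) x v * A11 x + \<theta>1 x w * dd A11 x v
      + (dd (\<lambda>y. \<theta>2 y w) x v * A12 x + \<theta>2 x w * dd A12 x v)" for v w .
  have "dd (\<lambda>y. ip c (dd e2 y w) (e3 y)) x v = dd (\<lambda>y. \<theta>1 y w * A12 y + \<theta>2 y w * (2 * h - A11 y)) x v" for v w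
    by (rule dd_cong[OF open_D x]) (rule \<alpha>_A)
  also have "dd (\<lambda>y. \<theta>1 y w * A12 y + \<theta>2 y w * (2 * h - A11 y)) x v = dd (\<lambda>y. \<theta>1 y w) x v * A12 x + \<theta>1 x w * dd A12 x v
      + (dd (\<lambda>y. \<theta>2 y w) x v * (2 * h - A11 x) + \<theta>2 x w * (- dd A11 x v))" for v w
    by (subst dd_add) (auto intro!: differentiable_mult \<theta>d A_diff[OF x] d2 simp: dm A_diff[OF x] d2 dd2)
  finally have 2: "dd (\<lambda>y. ip c (dd e2 y w) (e3 y)) x v = dd (\<lambda>y. \<theta>1 y w) x v * A12 x + \<theta>1 x w * dd A12 x v
      + (dd (\<lambda>y. \<theta>2 y w) x v * (2 * h - A11 x) + \<theta>2 x w * (- dd A11 x v))" for v w .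
  show "dd A12 x (u1 x) = dd A11 x (u2 x)"
    using \<alpha>_closed(1)[OF x, of "u2 x" "u1 x"] \<theta>_closed[OF x, of "u2 x" "u1 x"] unfolding 1 by (simp add: \<theta>_u[OF x])
  show "dd A12 x (u2 x) = - dd A11 x (u1 x)"
    using \<alpha>_closed(2)[OF x, of "u2 x" "u1 x"] \<theta>_closed[OF x, of "u2 x" "u1 x"] unfolding 2 by (simp add: \<theta>_u[OF x])
qed

lemma const_if_dd_zero:
  assumes "connected D" "x \<in> D" "y \<in> D" and d: "\<And>x. x \<in> D \<Longrightarrow> g differentiable (at x)" "\<And>x v. x \<in> D \<Longrightarrow> dd g x v = 0"
  shows "g x = g y"
proof (rule has_derivative_zero_unique_connected[OF open_D assms(1) _ assms(2,3)])
  show "(g has_derivative (\<lambda>h. 0)) (at x)" if "x \<in> D" for x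
    using dd_works[OF d(1)[OF that]] d(2)[OF that] by simp
qed

lemma \<tau>_diff: "x \<in> D \<Longrightarrow> \<tau> differentiable (at x)"
  by (rule differentiable_cong_open[OF _ open_D, of "\<lambda>y. snd (e1 y)"])
    (auto simp: snd_e differentiable_def intro!: bounded_linear.has_derivative[OF bounded_linear_snd] dd_works e_diff)

lemma \<tau>_const: "connected D \<Longrightarrow> x \<in> D \<Longrightarrow> y \<in> D \<Longrightarrow> \<tau> x = \<tau> y"
  by (rule const_if_dd_zero) (auto simp: \<tau>_diff de_parallel)

text \<open>A holomorphic function of constant modulus is constant: \<open>gauss\<close> says that
  the squared modulus of \<open>A11 - h\<close> and \<open>A12\<close> is \<open>k\<close>. No
  diagonalisation is involved, so the umbilic case \<open>k = 0\<close> is included.\<close>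

lemma A_const:
  assumes con: "connected D" and xy: "x \<in> D" "y \<in> D"
  shows "A11 x = A11 y" "A12 x = A12 y"
proof -
  define k where "k = h * h + c * (1 - \<tau> x * \<tau> x)"
  have g: "(A11 z - h) * (A11 z - h) + A12 z * A12 z = k" if "z \<in> D" for z
    using gauss[OF that] \<tau>_const[OF con xy(1) that] unfolding k_def by algebra
  have "A11 x = A11 y \<and> A12 x = A12 y"
  proof (cases "k = 0")
    case True
    then have "A11 z = h" "A12 z = 0" if "z \<in> D" for z
      using g[OF that] sum_squares_eq_zero_iff[of "A11 z - h" "A12 z"] by simp_all
    then show ?thesis using xy by simp
  next
    case False
    have "dd A11 z v = 0 \<and> dd A12 z v = 0" if z: "z \<in> D" for z v
    proof -
      have d: "(\<lambda>y. A11 y - h) differentiable (at z)" by (intro derivative_intros A_diff[OF z])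
      have dd1: "dd (\<lambda>y. A11 y - h) z v = dd A11 z v" for v
        using dd_diff[of A11 z "\<lambda>_. h", OF A_diff(1)[OF z]] by simp
      have "dd (\<lambda>y. (A11 y - h) * (A11 y - h) + A12 y * A12 y) z v = 0" for v
        by (rule dd_eq_0_if_const[OF z]) (rule g)
      then have e: "(A11 z - h) * dd A11 z v + A12 z * dd A12 z v = 0" for v
        using dd_add[OF differentiable_mult[OF d d] differentiable_mult[OF A_diff(2)[OF z] A_diff(2)[OF z]], of v]
          dd_mult[OF d d, of v] dd_mult[OF A_diff(2)[OF z] A_diff(2)[OF z], of v] dd1[of v] by simp
      note e1 = e[of "u1 z"] and e2 = e[of "u2 z"] and cz = codazzi[OF z]
      \<comment> \<open>The derivative of the modulus in two directions, combined with
        Cauchy-Riemann, is a linear system for two derivatives with determinant \<open>k\<close> up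
        to sign.\<close>
      have "k * dd A11 z (u1 z) = 0" "k * dd A12 z (u1 z) = 0"
        using e1 e2 cz unfolding g[OF z, symmetric] by algebra+
      then have 0: "dd A11 z (u1 z) = 0" "dd A12 z (u1 z) = 0" using False by simp_all
      have l: "linear (\<lambda>v. dd A11 z v)" "linear (\<lambda>v. dd A12 z v)"
        by (rule linear_frechet_derivative; rule A_diff[OF z])+
      show ?thesis
        by (subst form_expand[OF z l(1)], subst form_expand[OF z l(2)]) (use 0 cz in simp)
    qed
    then show ?thesis using const_if_dd_zero[OF con xy] A_diff by blast
  qed
  then show "A11 x = A11 y" "A12 x = A12 y" by auto
qed

end

lemma dd_along:
  assumes "Z differentiable (at (y t))" "(y has_vector_derivative w) (at t)"
  shows "((\<lambda>t. Z (y t)) has_vector_derivative dd Z (y t) w) (at t)"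
  using has_derivative_compose[OF assms(2)[unfolded has_vector_derivative_def] dd_works[OF assms(1)]]
  unfolding has_vector_derivative_def by (simp add: dd_linear(2)[OF assms(1)])

section \<open>Construction of the adapted frame\<close>

context patch begin

lemma metric_\<xi>: "x \<in> D \<Longrightarrow> metric c f x (tang c f x \<xi>) v = snd (dd f x v)"
  by (simp add: metric_tang)

lemma metric_smooth: "smooth_on D (\<lambda>x. metric c f x v w)"
  unfolding metric_eq by (intro smooth_on_ip open_D smooth_on_dd f_smooth)

lemma gram_smooth: "smooth_on D (gram c f)"
  unfolding gram_def[abs_def] power2_eq_square
  by (intro smooth_on_diff smooth_on_mult open_D metric_smooth)

lemma tang_smooth:
  assumes "smooth_on D W" shows "smooth_on D (\<lambda>x. tang c f x (W x))"
  unfolding tang_def sharp_def df_def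
  by (intro smooth_on_scaleR smooth_on_divide smooth_on_Pair smooth_on_diff smooth_on_mult smooth_on_const
      open_D metric_smooth gram_smooth smooth_on_ip assms smooth_on_dd f_smooth)
    (use gram_pos in fastforce)

lemma nab_df: "nab c f (\<lambda>y. df f y w) x v = ddf x v w - (c * ip c (\<eta> x) (ddf x v w)) *\<^sub>R \<eta> x"
  by (simp add: nab_def df_def proj_eq)

lemma sff_smooth: "smooth_on D (\<lambda>x. sff c f x v w)"
proof -
  have "smooth_on D (\<lambda>x. nab c f (\<lambda>y. df f y w) x v)"
    unfolding nab_df
    by (intro smooth_on_diff smooth_on_scaleR smooth_on_mult smooth_on_const smooth_on_ip open_D smooth_on_dd f_smooth \<eta>_smooth)
  then show ?thesis unfolding sff_def LC_def df_def
    by (intro smooth_on_diff smooth_on_dd_field tang_smooth open_D f_smooth)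
qed

lemma mean_curv_smooth: "smooth_on D (mean_curv c f)"
  unfolding mean_curv_def[abs_def] tr_def
  by (intro smooth_on_scaleR smooth_on_add smooth_on_diff smooth_on_divide smooth_on_const open_D metric_smooth sff_smooth gram_smooth)
    (use gram_pos in fastforce)

lemma sff_normal:
  assumes x: "x \<in> D" shows "ip c (sff c f x v w) (dd f x z) = 0" "ip c (sff c f x v w) (\<eta> x) = 0"
proof -
  show "ip c (sff c f x v w) (dd f x z) = 0"
    using metric_tang[OF x, of "nab c f (\<lambda>y. df f y w) x v" z]
    by (simp add: sff_def LC_def df_def metric_eq)
  show "ip c (sff c f x v w) (\<eta> x) = 0"
    using \<eta>_norm[OF x] c_nz by (simp add: sff_def df_def ip_df_\<eta>[OF x] nab_df[unfolded df_def] ip_sym[of c "\<eta> x" "ddf x v w"])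
qed

lemma mean_curv_normal:
  assumes x: "x \<in> D" shows "ip c (mean_curv c f x) (dd f x z) = 0" "ip c (mean_curv c f x) (\<eta> x) = 0"
  by (simp_all add: mean_curv_def tr_def sff_normal[OF x])

lemma cmc_frame:
  assumes H: "\<And>x. x \<in> D \<Longrightarrow> len c (mean_curv c f x) = h" "\<And>x. x \<in> D \<Longrightarrow> mean_curv c f x \<noteq> 0"
      "\<And>x. x \<in> D \<Longrightarrow> ip c (mean_curv c f x) \<xi> = 0"
    and T: "\<And>x. x \<in> D \<Longrightarrow> 0 < len c (tan_xi c f x) \<and> len c (tan_xi c f x) < 1"
    and bi: "\<And>x. x \<in> D \<Longrightarrow> df f x (tang c f x (bitension c f x)) = 0"
    and ne: "D \<noteq> {}"
  obtains u1 u2 e3 e4 \<tau> n where "cmc c D f u1 u2 e3 e4 \<tau> n h"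
proof -
  define t where "t x = tang c f x \<xi>" for x
  define \<tau> where "\<tau> x = sqrt (metric c f x (t x) (t x))" for x
  define n where "n x = sqrt (1 - metric c f x (t x) (t x))" for x
  \<comment> \<open>The kernel of the height differential, which is pairing with \<open>T\<close>: a
    smooth vector orthogonal to \<open>T\<close> obtained without choosing anything. It cannot
    vanish, since \<open>T\<close> itself has positive height derivative.\<close>
  define v2 where "v2 x = (- snd (dd f x e\<^sub>2), snd (dd f x e\<^sub>1))" for x
  define u1 where "u1 x = (1 / \<tau> x) *\<^sub>R t x" for x
  define u2 where "u2 x = (1 / sqrt (metric c f x (v2 x) (v2 x))) *\<^sub>R v2 x" for x
  define e3 where "e3 x = (1 / h) *\<^sub>R mean_curv c f x" for x
  define e4 where "e4 x = (1 / n x) *\<^sub>R (\<xi> - dd f x (t x))" for x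
  have \<tau>_len: "\<tau> x = len c (tan_xi c f x)" for x
    by (simp add: \<tau>_def t_def len_def tan_xi_def df_def metric_eq)
  have \<tau>: "0 < \<tau> x" "\<tau> x < 1" if "x \<in> D" for x using T[OF that] \<tau>_len by simp_all
  have mt: "metric c f x (t x) v = snd (dd f x v)" if "x \<in> D" for x v
    using metric_\<xi>[OF that] by (simp add: t_def)
  have tt: "metric c f x (t x) (t x) > 0" "metric c f x (t x) (t x) < 1" if "x \<in> D" for x
    using \<tau>[OF that] unfolding \<tau>_def by (simp_all add: real_sqrt_lt_1_iff)
  have n: "n x > 0" if "x \<in> D" for x using tt[OF that] by (simp add: n_def)
  have v2t: "metric c f x (t x) (v2 x) = 0" if "x \<in> D" for x
    unfolding mt[OF that] by (subst df_coord[OF that]) (simp add: v2_def)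
  have v2: "v2 x \<noteq> 0" if x: "x \<in> D" for x
  proof
    assume "v2 x = 0"
    then have "snd (dd f x e\<^sub>1) = 0" "snd (dd f x e\<^sub>2) = 0" by (simp_all add: v2_def prod_eq_iff)
    then have "snd (dd f x (t x)) = 0" by (subst df_coord[OF x]) simp
    then show False using mt[OF x, of "t x"] tt[OF x] by simp
  qed
  have v22: "metric c f x (v2 x) (v2 x) > 0" if "x \<in> D" for x using metric_pos[OF that v2[OF that]] .
  have h2: "ip c (mean_curv c f x) (mean_curv c f x) = h * h" "h > 0" if x: "x \<in> D" for x
  proof -
    have p: "ip c (mean_curv c f x) (mean_curv c f x) > 0"
      using mean_curv_normal(2)[OF x] by (intro ip_pos_definite[OF c_nz f_MxR[OF x]] H(2)[OF x]) (simp add: ip_sym)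
    then show "h > 0" using H(1)[OF x] unfolding len_def by (metis real_sqrt_gt_zero)
    show "ip c (mean_curv c f x) (mean_curv c f x) = h * h"
      using p H(1)[OF x] unfolding len_def by (metis less_imp_le real_sqrt_mult_self abs_of_pos abs_of_nonneg real_sqrt_mult)
  qed
  have h: "h > 0" using h2(2) ne by auto
  have st: "smooth_on D t" unfolding t_def[abs_def] by (intro tang_smooth smooth_on_const)
  have sdt: "smooth_on D (\<lambda>x. dd f x (t x))" by (intro smooth_on_dd_field open_D f_smooth st)
  have stt: "smooth_on D (\<lambda>x. metric c f x (t x) (t x))" unfolding metric_eq by (intro smooth_on_ip open_D sdt)
  have s\<tau>: "smooth_on D \<tau>" unfolding \<tau>_def[abs_def] by (intro smooth_on_sqrt open_D stt tt)
  have sn: "smooth_on D n" unfolding n_def[abs_def]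
    by (intro smooth_on_sqrt open_D smooth_on_diff smooth_on_const stt) (use tt in simp)
  have sv2: "smooth_on D v2" unfolding v2_def[abs_def]
    by (intro smooth_on_Pair smooth_on_minus open_D smooth_on_linear_image[OF bounded_linear_snd] smooth_on_dd f_smooth)
  have fr: "frame c D f u1 u2 e3 e4"
  proof (intro frame.intro patch_axioms frame_axioms.intro)
    show "smooth_on D u1" unfolding u1_def[abs_def]
      by (intro smooth_on_scaleR smooth_on_divide smooth_on_const open_D s\<tau> st) (use \<tau> in fastforce)
    show "smooth_on D u2" unfolding u2_def[abs_def] metric_eq
      by (intro smooth_on_scaleR smooth_on_divide smooth_on_const open_D sv2 smooth_on_sqrt smooth_on_ip smooth_on_dd_field f_smooth)
        (use v22 in \<open>fastforce simp: metric_eq\<close>)+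
    show "smooth_on D e3" unfolding e3_def[abs_def]
      by (intro smooth_on_scaleR smooth_on_const open_D mean_curv_smooth)
    show "smooth_on D e4" unfolding e4_def[abs_def]
      by (intro smooth_on_scaleR smooth_on_divide smooth_on_diff smooth_on_const open_D sdt sn) (use n in fastforce)
  next
    fix x assume x: "x \<in> D"
    have sc: "metric c f x (a *\<^sub>R v) (b *\<^sub>R w) = a * b * metric c f x v w" for a b v w
      by (simp add: metric_eq df_lin[OF x])
    show "metric c f x (u1 x) (u1 x) = 1" unfolding u1_def sc using tt[OF x] by (simp add: \<tau>_def)
    show "metric c f x (u2 x) (u2 x) = 1" unfolding u2_def sc using v22[OF x] by simp
    show "metric c f x (u1 x) (u2 x) = 0" unfolding u1_def u2_def sc v2t[OF x] by simp
    show "ip c (e3 x) (e3 x) = 1" using h2[OF x] by (simp add: e3_def)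
    have "ip c (\<xi> - dd f x (t x)) (\<xi> - dd f x (t x)) = n x * n x"
      using mt[OF x, of "t x"] tt[OF x] by (simp add: n_def metric_eq)
    then show "ip c (e4 x) (e4 x) = 1" using n[OF x]
      by (simp only: e4_def bounded_bilinear.scaleR_left[OF ip_bounded_bilinear] bounded_bilinear.scaleR_right[OF ip_bounded_bilinear]) simp
    show "ip c (e3 x) (e4 x) = 0" using H(3)[OF x] mean_curv_normal[OF x] by (simp add: e3_def e4_def)
    show "ip c (dd f x v) (e3 x) = 0" for v using mean_curv_normal[OF x] by (simp add: e3_def ip_sym[of c "dd f x v"])
    show "ip c (dd f x v) (e4 x) = 0" for v using mt[OF x, of v] by (simp add: e4_def metric_eq ip_sym[of c "dd f x v"])
    show "ip c (e3 x) (pos (f x)) = 0" using mean_curv_normal[OF x] by (simp add: e3_def)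
    show "ip c (e4 x) (pos (f x)) = 0" by (simp add: e4_def ip_df_\<eta>[OF x])
  qed
  interpret frame c D f u1 u2 e3 e4 by (rule fr)
  have "cmc c D f u1 u2 e3 e4 \<tau> n h"
  proof (intro cmc.intro fr cmc_axioms.intro)
    fix x assume x: "x \<in> D"
    show "\<xi> = \<tau> x *\<^sub>R e1 x + n x *\<^sub>R e4 x"
      using \<tau>[OF x] n[OF x] by (simp add: e1_def u1_def e4_def df_lin[OF x])
    show "mean_curv c f x = h *\<^sub>R e3 x" using h by (simp add: e3_def)
    show "df f x (tang c f x (bitension c f x)) = 0" by (rule bi[OF x])
  qed (use h \<tau> n in auto)
  then show ?thesis using that by blast
qed

section \<open>Frenet frames and principal coordinates\<close>

text \<open>Signs are absorbed in the Frenet frame \<open>E, sgn k N, sgn (k \<mu>) B\<close> to make the curvatures positive.\<close>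

lemma helix_along:
  fixes y :: "real \<Rightarrow> plane"
  assumes I: "open I" and y: "smooth_on I y" "y ` I \<subseteq> D" "\<And>t. t \<in> I \<Longrightarrow> (y has_vector_derivative w (y t)) (at t)"
    and sm: "smooth_on D E" "smooth_on D N" "smooth_on D B"
    and E: "\<And>x. x \<in> D \<Longrightarrow> dd f x (w x) = E x"
    and tan: "\<And>x. x \<in> D \<Longrightarrow> ip c (\<eta> x) (N x) = 0" "\<And>x. x \<in> D \<Longrightarrow> ip c (\<eta> x) (B x) = 0"
    and on: "\<And>x. x \<in> D \<Longrightarrow> ip c (E x) (E x) = 1" "\<And>x. x \<in> D \<Longrightarrow> ip c (N x) (N x) = 1" "\<And>x. x \<in> D \<Longrightarrow> ip c (B x) (B x) = 1"
      "\<And>x. x \<in> D \<Longrightarrow> ip c (E x) (N x) = 0" "\<And>x. x \<in> D \<Longrightarrow> ip c (E x) (B x) = 0" "\<And>x. x \<in> D \<Longrightarrow> ip c (N x) (B x) = 0"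
    and k: "k \<noteq> 0"
    and dE: "\<And>x. x \<in> D \<Longrightarrow> proj c (f x) (dd E x (w x)) = k *\<^sub>R N x"
    and dN: "\<And>x. x \<in> D \<Longrightarrow> proj c (f x) (dd N x (w x)) = (- k) *\<^sub>R E x + \<mu> *\<^sub>R B x"
    and dB: "\<And>x. x \<in> D \<Longrightarrow> proj c (f x) (dd B x (w x)) = (- \<mu>) *\<^sub>R N x"
  shows "helix_or_circle c \<bar>k\<bar> \<bar>\<mu>\<bar> I (f \<circ> y)"
proof -
  define s where "s = sgn k"
  define s' where "s' = sgn (s * \<mu>)"
  have s: "s * s = 1" "s * k = \<bar>k\<bar>" "s * \<bar>k\<bar> = k" using k by (auto simp: s_def sgn_if)
  have s': "s' * s' = 1" "s' * \<bar>\<mu>\<bar> = s * \<mu>" "s' * \<mu> = s * \<bar>\<mu>\<bar>" if "\<mu> \<noteq> 0" using that k by (auto simp: s'_def s_def sgn_if)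
  define F where "F i = (if i = 1 then (\<lambda>t. E (y t)) else if i = 2 then (\<lambda>t. s *\<^sub>R N (y t)) else (\<lambda>t. s' *\<^sub>R B (y t)))" for i :: nat
  have yD: "y t \<in> D" if "t \<in> I" for t using y(2) that by blast
  have vd: "vector_derivative (\<lambda>t. Z (y t)) (at t) = dd Z (y t) (w (y t))" if "smooth_on D Z" "t \<in> I" for Z :: "plane \<Rightarrow> ambient" and t
    by (rule vector_derivative_at[OF dd_along[OF smooth_on_differentiable[OF that(1) yD[OF that(2)]] y(3)[OF that(2)]]])
  have sc: "smooth_on D (\<lambda>x. r *\<^sub>R Z x)" "dd (\<lambda>x. r *\<^sub>R Z x) x v = r *\<^sub>R dd Z x v"
    if "smooth_on D Z" "x \<in> D" for Z :: "plane \<Rightarrow> ambient" and r x v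
    by (intro smooth_on_scaleR smooth_on_const open_D that)
      (rule dd_linear_image[OF bounded_linear_scaleR_right smooth_on_differentiable[OF that]])
  have sI: "smooth_on I (\<lambda>t. Z (y t))" if "smooth_on D Z" for Z :: "plane \<Rightarrow> ambient"
    by (rule smooth_on_compose[OF that y(1) I y(2)])
  have nF: "nab_curve c (f \<circ> y) (F 1) t = \<bar>k\<bar> *\<^sub>R F 2 t"
    "nab_curve c (f \<circ> y) (F 2) t = - \<bar>k\<bar> *\<^sub>R F 1 t + (s * \<mu>) *\<^sub>R B (y t)"
    "nab_curve c (f \<circ> y) (F 3) t = - (s' * \<mu>) *\<^sub>R N (y t)" if t: "t \<in> I" for t
    unfolding nab_curve_def F_def
    using vd[OF sm(1) t] vd[OF sc(1)[OF sm(2) yD[OF t]] t, of s] vd[OF sc(1)[OF sm(3) yD[OF t]] t, of s']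
      sc(2)[OF sm(2) yD[OF t]] sc(2)[OF sm(3) yD[OF t]] dE[OF yD[OF t]] dN[OF yD[OF t]] dB[OF yD[OF t]] s
    by (simp_all add: linear_cmul[OF proj_linear] scaleR_right_distrib scaleR_right_diff_distrib mult.commute)
  have nF2: "nab_curve c (f \<circ> y) (F 2) t = - \<bar>k\<bar> *\<^sub>R F 1 t + \<bar>\<mu>\<bar> *\<^sub>R F 3 t"
     "nab_curve c (f \<circ> y) (F 3) t = - \<bar>\<mu>\<bar> *\<^sub>R F 2 t" if "t \<in> I" "\<mu> \<noteq> 0" for t
    using nF[OF that(1)] s'[OF that(2)] by (simp_all add: F_def mult.commute)
  have F0: "F 1 t = vector_derivative (f \<circ> y) (at t)" if t: "t \<in> I" for t
    using vd[OF f_smooth t] E[OF yD[OF t]] by (simp add: F_def o_def)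
  have pr: "proj c (f (y t)) (F i t) = F i t" if t: "t \<in> I" for i t
    using tan[OF yD[OF t]] ip_df_\<eta>(2)[OF yD[OF t], of "w (y t)"] E[OF yD[OF t]] by (simp add: F_def proj_eq)
  have smF: "smooth_on I (F i)" for i
    unfolding F_def by (auto intro!: sI smooth_on_scaleR I open_D sm)
  have ipF: "ip c (F 1 t) (F 1 t) = 1" "ip c (F 2 t) (F 2 t) = 1" "\<mu> \<noteq> 0 \<Longrightarrow> ip c (F 3 t) (F 3 t) = 1"
     "ip c (F 1 t) (F 2 t) = 0" "ip c (F 1 t) (F 3 t) = 0" "ip c (F 2 t) (F 3 t) = 0"
     "ip c (F 2 t) (F 1 t) = 0" "ip c (F 3 t) (F 1 t) = 0" "ip c (F 3 t) (F 2 t) = 0" if t: "t \<in> I" for t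
    using on[OF yD[OF t]] ip_sym[of c "N (y t)" "E (y t)"] ip_sym[of c "B (y t)" "E (y t)"] ip_sym[of c "B (y t)" "N (y t)"] s s'
    by (simp_all add: F_def)
  have M: "(f \<circ> y) ` I \<subseteq> MxR c" using f_MxR[OF yD] by (simp add: image_subset_iff)
  have sf: "smooth_on I (f \<circ> y)" using sI[OF f_smooth] by (simp add: o_def)
  show ?thesis
  proof (cases "\<mu> = 0")
    case True
    \<comment> \<open>For \<open>\<mu> = 0\<close> the sign \<open>s'\<close> is zero and so is
      \<open>F 3\<close>. The derivative of \<open>F 2\<close> then has no component along
      \<open>B\<close>, and the first two fields form a frame of order 2.\<close>
    have sets: "{1..2::nat} = {1, 2}" "{1..<2::nat} = {1}" by auto
    have "frenet_curve c 2 (\<lambda>i t. \<bar>k\<bar>) F I (f \<circ> y)"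
      unfolding frenet_curve_def sets
      using M sf smF F0 pr ipF(1,2,4,7) nF(1,2) True k by (auto simp: numeral_2_eq_2)
    then show ?thesis using True by (auto simp: helix_or_circle_def circle_def helix_of_order_def)
  next
    case False
    have sets: "{1..3::nat} = {1, 2, 3}" "{1..<3::nat} = {1, 2}" by auto
    have "frenet_curve c 3 (\<lambda>i t. if i = 1 then \<bar>k\<bar> else \<bar>\<mu>\<bar>) F I (f \<circ> y)"
      unfolding frenet_curve_def sets
      using M sf smF F0 pr ipF nF(1) nF2 False k by (auto simp: numeral_3_eq_3 numeral_2_eq_2)
    then show ?thesis using False by (auto simp: helix_or_circle_def helix_def helix_of_order_def)
  qed
qed

end

context cmc begin

lemma proj_expand:
  assumes x: "x \<in> D"
  shows "proj c (f x) w = ip c w (e1 x) *\<^sub>R e1 x + ip c w (e2 x) *\<^sub>R e2 x + ip c w (e3 x) *\<^sub>R e3 x + ip c w (e4 x) *\<^sub>R e4 x"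
  using expand[OF x, of w] unfolding proj_eq ip_sym[of c "pos (f x)" w] by (metis add_diff_cancel_right')

text \<open>The vector \<open>(p, q)\<close> is a unit eigenvector for \<open>k\<close>. As the
  frame is parallel, the curve is a geodesic of the surface, so its ambient acceleration is
  \<open>k\<close> times \<open>e3\<close>. The second curvature is the rotation of
  \<open>e3\<close> towards \<open>e4\<close> along the curve.\<close>

lemma principal_helix:
  assumes t: "\<And>x. x \<in> D \<Longrightarrow> \<tau> x = t" and A: "\<And>x. x \<in> D \<Longrightarrow> A11 x = a11" "\<And>x. x \<in> D \<Longrightarrow> A12 x = a12"
    and eig: "a11 * p + a12 * q = k * p" "a12 * p + (2 * h - a11) * q = k * q" and pq: "p * p + q * q = 1" and k: "k \<noteq> 0"
    and y: "open I" "smooth_on I y" "y ` I \<subseteq> D"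
      "\<And>s. s \<in> I \<Longrightarrow> (y has_vector_derivative (p *\<^sub>R u1 (y s) + q *\<^sub>R u2 (y s))) (at s)"
      "I \<noteq> {}"
  shows "helix_or_circle c \<bar>k\<bar> (\<bar>t * p\<bar> / sqrt (1 - t * t) * \<bar>k\<bar>) I (f \<circ> y)"
proof -
  have D0: "\<exists>x. x \<in> D" using y(3,5) by (metis all_not_in_conv image_subset_iff)
  define m where "m = sqrt (1 - t * t)"
  have n: "n x = m" if "x \<in> D" for x
    using \<tau>n[OF that] t[OF that] n_pos[OF that] unfolding m_def by (metis abs_of_pos add_diff_cancel_left' real_sqrt_abs2)
  have m: "m > 0" using D0 n n_pos by metis
  define \<mu> where "\<mu> = t * p / m * k"
  have ab: "\<bar>\<mu>\<bar> = \<bar>t * p\<bar> / m * \<bar>k\<bar>" using m by (simp add: \<mu>_def abs_mult)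
  define w where "w x = p *\<^sub>R u1 x + q *\<^sub>R u2 x" for x
  define E where "E x = p *\<^sub>R e1 x + q *\<^sub>R e2 x" for x
  have w\<theta>: "\<theta>1 x (w x) = p" "\<theta>2 x (w x) = q" if "x \<in> D" for x
    using \<theta>_u[OF that] by (simp_all add: w_def df_lin[OF that])
  have \<alpha>: "ip c (dd e1 x (w x)) (e3 x) = k * p" "ip c (dd e2 x (w x)) (e3 x) = k * q" if "x \<in> D" for x
    using eig by (simp_all add: \<alpha>_A[OF that] w\<theta>[OF that] A[OF that] algebra_simps)
  \<comment> \<open>The relation between the normal connection and the second fundamental form in
    \<open>de_eqs\<close>, evaluated on an eigenvector; this is the origin of the factor
    \<open>t * p / m\<close>.\<close>
  have mu: "ip c (dd e3 x (w x)) (e4 x) = \<mu>" if "x \<in> D" for x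
    using de_eqs(3)[OF that, of "w x"] m by (simp add: \<alpha>[OF that] t[OF that] n[OF that] \<mu>_def field_simps)
  have dE: "dd E x v = p *\<^sub>R dd e1 x v + q *\<^sub>R dd e2 x v" if "x \<in> D" for x v
  proof -
    have d: "(\<lambda>y. p *\<^sub>R e1 y) differentiable (at x)" "(\<lambda>y. q *\<^sub>R e2 y) differentiable (at x)"
      using e_diff[OF that] by (auto intro: differentiable_scaleR)
    show ?thesis unfolding E_def[abs_def] dd_add[OF d]
      using dd_linear_image[OF bounded_linear_scaleR_right e_diff(1)[OF that]]
        dd_linear_image[OF bounded_linear_scaleR_right e_diff(2)[OF that]] by simp
  qed
  have "helix_or_circle c \<bar>k\<bar> \<bar>\<mu>\<bar> I (f \<circ> y)"
  proof (rule helix_along[where E = E and N = e3 and B = e4 and w = w])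
    show "(y has_vector_derivative w (y s)) (at s)" if "s \<in> I" for s using y(4)[OF that] by (simp add: w_def)
    show "smooth_on D E" unfolding E_def[abs_def]
      by (intro smooth_on_add smooth_on_scaleR smooth_on_const open_D e_smooth)
  next
    fix x assume x: "x \<in> D"
    show "dd f x (w x) = E x" by (simp add: w_def E_def df_lin[OF x] e1_def e2_def)
    show "ip c (E x) (E x) = 1" using pq by (simp add: E_def onb[OF x] onb'[OF x])
    show "ip c (E x) (e3 x) = 0" "ip c (E x) (e4 x) = 0" by (simp_all add: E_def onb[OF x])
    show "proj c (f x) (dd E x (w x)) = k *\<^sub>R e3 x"
    proof -
      have "p * (k * p) + q * (k * q) = k" using pq by algebra
      then show ?thesis unfolding proj_expand[OF x] dE[OF x]
        by (simp add: d_onb(1,2)[OF x] de_parallel[OF x] A\<^sub>N_zero[OF x] \<alpha>[OF x])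
    qed
    show "proj c (f x) (dd e3 x (w x)) = (- k) *\<^sub>R E x + \<mu> *\<^sub>R e4 x"
      unfolding proj_expand[OF x]
      by (simp add: d_onb(3,6,7)[OF x] \<alpha>[OF x] mu[OF x] E_def algebra_simps)
    show "proj c (f x) (dd e4 x (w x)) = (- \<mu>) *\<^sub>R e3 x"
      unfolding proj_expand[OF x]
      by (simp add: d_onb(4,8,9,10)[OF x] A\<^sub>N_zero[OF x] mu[OF x])
  qed (simp_all add: y k onb onb' e_smooth)
  then show ?thesis by (simp add: ab m_def)
qed

text \<open>The eigenvector components are constant, so the principal coframe is closed. Its
  primitives on a ball are the coordinates \<open>F\<close>, and the inverse of \<open>F\<close>
  turns the coordinate fields into the principal fields.\<close>

lemma principal_coordinates:
  assumes t: "\<And>x. x \<in> D \<Longrightarrow> \<tau> x = t" and A: "\<And>x. x \<in> D \<Longrightarrow> A11 x = a11" "\<And>x. x \<in> D \<Longrightarrow> A12 x = a12"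
    and eig1: "a11 * p + a12 * q = k1 * p" "a12 * p + (2 * h - a11) * q = k1 * q"
    and eig2: "a11 * p' + a12 * q' = k2 * p'" "a12 * p' + (2 * h - a11) * q' = k2 * q'"
    and pq: "p * p + q * q = 1" "p' * p' + q' * q' = 1" "p * p' + q * q' = 0" and k: "k1 \<noteq> 0" "k2 \<noteq> 0" and x0: "x0 \<in> D"
  obtains U V F G where "open U" "x0 \<in> U" "U \<subseteq> D" "open V" "homeomorphism U V F G" "smooth_on U F" "smooth_on V G"
    "isometric_immersion c V (f \<circ> G)"
    "\<And>z. z \<in> V \<Longrightarrow> ip c (df (f \<circ> G) z e\<^sub>1) \<xi> = t * p \<and> ip c (df (f \<circ> G) z e\<^sub>2) \<xi> = t * p'"
    "integral_curves_satisfy V (f \<circ> G) e\<^sub>1 (helix_or_circle c \<bar>k1\<bar> (\<bar>t * p\<bar> / sqrt (1 - t * t) * \<bar>k1\<bar>))"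
    "integral_curves_satisfy V (f \<circ> G) e\<^sub>2 (helix_or_circle c \<bar>k2\<bar> (\<bar>t * p'\<bar> / sqrt (1 - t * t) * \<bar>k2\<bar>))"
proof -
  obtain r where r: "r > 0" "ball x0 r \<subseteq> D" using open_D x0 open_contains_ball by blast
  let ?B = "ball x0 r"
  have BD: "y \<in> D" if "y \<in> ?B" for y using r that by blast
  define w1 where "w1 x = p *\<^sub>R u1 x + q *\<^sub>R u2 x" for x
  define w2 where "w2 x = p' *\<^sub>R u1 x + q' *\<^sub>R u2 x" for x
  have ex: "\<exists>F. \<forall>y\<in>?B. (F has_derivative (\<lambda>v. a * \<theta>1 y v + b * \<theta>2 y v)) (at y)" for a b
  proof (rule closed_form_exact)
    fix y v w assume y: "y \<in> ?B"
    show "linear (\<lambda>v. a * \<theta>1 y v + b * \<theta>2 y v)"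
      by (rule linearI) (simp_all add: df_lin[OF BD[OF y]] algebra_simps)
    have d: "(\<lambda>y. \<theta>1 y w) differentiable (at y)" "(\<lambda>y. \<theta>2 y w) differentiable (at y)" for w
      using smooth_on_differentiable[OF _ BD[OF y]] \<theta>_smooth by blast+
    have "dd (\<lambda>y. a * \<theta>1 y w + b * \<theta>2 y w) y v = a * dd (\<lambda>y. \<theta>1 y w) y v + b * dd (\<lambda>y. \<theta>2 y w) y v" for v w
      using dd_add[of "\<lambda>y. a * \<theta>1 y w" y "\<lambda>y. b * \<theta>2 y w" v] d
        dd_linear_image[OF bounded_linear_mult_right d(1)] dd_linear_image[OF bounded_linear_mult_right d(2)]
      by (simp add: differentiable_mult)
    then show "dd (\<lambda>y. a * \<theta>1 y w + b * \<theta>2 y w) y v = dd (\<lambda>y. a * \<theta>1 y v + b * \<theta>2 y v) y w"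
      using \<theta>_closed[OF BD[OF y], of v w] by simp
  next
    show "smooth_on ?B (\<lambda>y. a * \<theta>1 y v + b * \<theta>2 y v)" for v
      by (intro smooth_on_add smooth_on_mult smooth_on_const open_ball smooth_on_subset[OF \<theta>_smooth(1) r(2)]
          smooth_on_subset[OF \<theta>_smooth(2) r(2)])
  qed
  obtain F1 F2 where F1: "\<And>y. y \<in> ?B \<Longrightarrow> (F1 has_derivative (\<lambda>v. p * \<theta>1 y v + q * \<theta>2 y v)) (at y)"
    and F2: "\<And>y. y \<in> ?B \<Longrightarrow> (F2 has_derivative (\<lambda>v. p' * \<theta>1 y v + q' * \<theta>2 y v)) (at y)"
    using ex[of p q] ex[of p' q'] by blast
  define F where "F y = (F1 y, F2 y)" for y
  have dF: "(F has_derivative (\<lambda>v. (p * \<theta>1 y v + q * \<theta>2 y v, p' * \<theta>1 y v + q' * \<theta>2 y v))) (at y)" if "y \<in> ?B" for y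
    unfolding F_def[abs_def] by (rule has_derivative_Pair[OF F1[OF that] F2[OF that]])
  have sF: "smooth_on ?B F"
  proof (rule smooth_onI)
    show "F differentiable (at y)" if "y \<in> ?B" for y using dF[OF that] differentiable_def by blast
    show "smooth_on ?B (\<lambda>y. dd F y v)" for v
    proof (rule smooth_on_cong[OF open_ball])
      show "(p * \<theta>1 y v + q * \<theta>2 y v, p' * \<theta>1 y v + q' * \<theta>2 y v) = dd F y v" if "y \<in> ?B" for y
        using dd_eqI[OF dF[OF that]] by simp
      show "smooth_on ?B (\<lambda>y. (p * \<theta>1 y v + q * \<theta>2 y v, p' * \<theta>1 y v + q' * \<theta>2 y v))"
        by (intro smooth_on_Pair smooth_on_add smooth_on_mult smooth_on_const open_ball smooth_on_subset[OF \<theta>_smooth(1) r(2)]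
          smooth_on_subset[OF \<theta>_smooth(2) r(2)])
    qed
  qed
  define R where "R y v = fst v *\<^sub>R w1 y + snd v *\<^sub>R w2 y" for y and v :: plane
  have sw: "smooth_on D w1" "smooth_on D w2" unfolding w1_def[abs_def] w2_def[abs_def]
    by (intro smooth_on_add smooth_on_scaleR smooth_on_const open_D frame_smooth)+
  have sR: "smooth_on ?B (\<lambda>y. R y v)" for v unfolding R_def
    by (intro smooth_on_add smooth_on_scaleR smooth_on_const open_ball smooth_on_subset[OF sw(1) r(2)] smooth_on_subset[OF sw(2) r(2)])
  \<comment> \<open>Two orthonormal rows of a square matrix also make orthonormal columns; hence the
    principal frame is inverse to its coframe.\<close>
  have FR: "dd F y (R y v) = v" if y: "y \<in> ?B" for y v
  proof -
    have "\<theta>1 y (R y v) = fst v * p + snd v * p'" "\<theta>2 y (R y v) = fst v * q + snd v * q'"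
      using \<theta>_u[OF BD[OF y]] by (simp_all add: R_def w1_def w2_def df_lin[OF BD[OF y]])
    moreover have "p * (a * p + b * p') + q * (a * q + b * q') = a" "p' * (a * p + b * p') + q' * (a * q + b * q') = b" for a b
      using pq by algebra+
    ultimately show ?thesis unfolding dd_eqI[OF dF[OF y]] by (simp add: prod_eq_iff)
  qed
  obtain U V G where UV: "open U" "x0 \<in> U" "U \<subseteq> ?B" "open V" "homeomorphism U V F G"
    "smooth_on V G" "\<And>y v. y \<in> V \<Longrightarrow> dd G y v = R (G y) v"
    using smooth_local_inverse[OF open_ball sF _ sR FR, of x0] r(1) by (metis centre_in_ball)
  have GU: "G y \<in> U" "G y \<in> D" if "y \<in> V" for y using UV(3,5) that BD unfolding homeomorphism_def by blast+
  have GV: "G ` V \<subseteq> D" using GU by blast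
  have dX: "dd (f \<circ> G) z v = (fst v * p + snd v * p') *\<^sub>R e1 (G z) + (fst v * q + snd v * q') *\<^sub>R e2 (G z)" if z: "z \<in> V" for z v
    using dd_compose[OF smooth_on_differentiable[OF UV(6) z] f_diff[OF GU(2)[OF z]], of v] UV(7)[OF z, of v]
    by (simp add: o_def R_def w1_def w2_def df_lin[OF GU(2)[OF z]] e1_def e2_def algebra_simps)
  have met: "metric c (f \<circ> G) z v w = v \<bullet> w" if z: "z \<in> V" for z v w
  proof -
    have "(a * p + b * p') * (c * p + d * p') + (a * q + b * q') * (c * q + d * q') = a * c + b * d" for a b c d
      using pq by algebra
    then show ?thesis unfolding metric_def df_def dX[OF z]
      by (simp add: onb[OF GU(2)[OF z]] onb'[OF GU(2)[OF z]] inner_prod_def)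
  qed
  have sX: "smooth_on V (f \<circ> G)"
    using smooth_on_compose[OF f_smooth UV(6) UV(4) GV] by (simp add: o_def)
  have "isometric_immersion c V (f \<circ> G)"
    unfolding isometric_immersion_def immersion_into_def
  proof (intro conjI ballI allI met sX)
    show "(f \<circ> G) ` V \<subseteq> MxR c" using f_MxR[OF GU(2)] by (simp add: image_subset_iff)
    fix z assume z: "z \<in> V"
    have l: "linear (df (f \<circ> G) z)"
      unfolding df_def by (rule linear_frechet_derivative[OF smooth_on_differentiable[OF sX z]])
    show "inj (df (f \<circ> G) z)"
    proof (subst linear_injective_0[OF l], intro allI impI)
      fix v assume "df (f \<circ> G) z v = 0"
      then have "metric c (f \<circ> G) z v v = 0" by (simp add: metric_def)
      then show "v = 0" using met[OF z] by simp
    qed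
  qed
  moreover have "ip c (df (f \<circ> G) z e\<^sub>1) \<xi> = t * p \<and> ip c (df (f \<circ> G) z e\<^sub>2) \<xi> = t * p'" if z: "z \<in> V" for z
    unfolding df_def dX[OF z] using snd_e[OF GU(2)[OF z]] t[OF GU(2)[OF z]] by simp
  \<comment> \<open>Stated for a general coordinate vector so that both principal directions are
    instances. The map \<open>G\<close> carries its integral curves to integral curves of the
    principal field \<open>a *\<^sub>R u1 y + b *\<^sub>R u2 y\<close>.\<close>
  moreover have "integral_curves_satisfy V (f \<circ> G) e (helix_or_circle c \<bar>k\<bar> (\<bar>t * a\<bar> / sqrt (1 - t * t) * \<bar>k\<bar>))"
    if e: "\<And>y. R y e = a *\<^sub>R u1 y + b *\<^sub>R u2 y" and ab: "a * a + b * b = 1"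
      "a11 * a + a12 * b = k * a" "a12 * a + (2 * h - a11) * b = k * b" "k \<noteq> 0" for e k a b
    unfolding integral_curves_satisfy_def
  proof (intro allI impI, elim conjE)
    fix I and \<gamma> :: "real \<Rightarrow> plane"
    assume I: "open I" "\<gamma> ` I \<subseteq> V" and ne: "I \<noteq> {}" and \<gamma>: "\<forall>s\<in>I. (\<gamma> has_vector_derivative e) (at s)"
    have s\<gamma>: "smooth_on I \<gamma>"
    proof (rule smooth_onI)
      show "\<gamma> differentiable at s" if "s \<in> I" for s
        using \<gamma> that unfolding has_vector_derivative_def differentiable_def by blast
      show "smooth_on I (\<lambda>s. dd \<gamma> s v)" for v
        by (rule smooth_on_cong[OF I(1) _ smooth_on_const[of I "v *\<^sub>R e"]])
          (use \<gamma> dd_eqI in \<open>fastforce simp: has_vector_derivative_def\<close>)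
    qed
    have "helix_or_circle c \<bar>k\<bar> (\<bar>t * a\<bar> / sqrt (1 - t * t) * \<bar>k\<bar>) I (f \<circ> (\<lambda>s. G (\<gamma> s)))"
    proof (rule principal_helix[OF t A ab(2,3,1,4) I(1)])
      show "smooth_on I (\<lambda>s. G (\<gamma> s))" by (rule smooth_on_compose[OF UV(6) s\<gamma> I])
      show "(\<lambda>s. G (\<gamma> s)) ` I \<subseteq> D" using I(2) GU by blast
      show "((\<lambda>s. G (\<gamma> s)) has_vector_derivative a *\<^sub>R u1 (G (\<gamma> s)) + b *\<^sub>R u2 (G (\<gamma> s))) (at s)" if s: "s \<in> I" for s
      proof -
        have "\<gamma> s \<in> V" using I(2) s by blast
        then show ?thesis
          using dd_along[OF smooth_on_differentiable[OF UV(6)], of \<gamma> s e] \<gamma> s UV(7) e by simp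
      qed
    qed (use ne in simp_all)
    then show "helix_or_circle c \<bar>k\<bar> (\<bar>t * a\<bar> / sqrt (1 - t * t) * \<bar>k\<bar>) I (f \<circ> G \<circ> \<gamma>)"
      by (simp add: o_def)
  qed
  note ic = this
  have "integral_curves_satisfy V (f \<circ> G) e\<^sub>1 (helix_or_circle c \<bar>k1\<bar> (\<bar>t * p\<bar> / sqrt (1 - t * t) * \<bar>k1\<bar>))"
    by (rule ic[of _ p q]) (simp_all add: R_def w1_def pq eig1 k)
  moreover have "integral_curves_satisfy V (f \<circ> G) e\<^sub>2 (helix_or_circle c \<bar>k2\<bar> (\<bar>t * p'\<bar> / sqrt (1 - t * t) * \<bar>k2\<bar>))"
    by (rule ic[of _ p' q']) (simp_all add: R_def w2_def pq eig2 k)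
  ultimately show ?thesis
    using that[OF UV(1,2) _ UV(4,5) smooth_on_subset[OF sF UV(3)] UV(6)] UV(3) r(2) by simp
qed

end

section \<open>Invariance under changes of parametrisation\<close>

text \<open>The pair \<open>(|T|, \<langle>\<sigma>(T, T), H\<rangle>)\<close>, which does not depend on the parametrisation.\<close>

definition intrinsic :: "real \<Rightarrow> (plane \<Rightarrow> ambient) \<Rightarrow> plane \<Rightarrow> real \<times> real" where
  "intrinsic c f x = (len c (tan_xi c f x),
     ip c (sff c f x (tang c f x \<xi>) (tang c f x \<xi>)) (mean_curv c f x))"

lemma patch_subset: "patch c D f \<Longrightarrow> open U \<Longrightarrow> U \<subseteq> D \<Longrightarrow> patch c U f"
  unfolding patch_def immersion_into_def using smooth_on_subset by blast

context cmc begin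

lemma tang_\<xi>: assumes x: "x \<in> D" shows "tang c f x \<xi> = \<tau> x *\<^sub>R u1 x"
proof (rule metric_unique[OF x])
  show "metric c f x (tang c f x \<xi>) w = metric c f x (\<tau> x *\<^sub>R u1 x) w" for w
    unfolding metric_\<xi>[OF x] by (simp add: snd_e[OF x] metric_frame[OF x] df_lin[OF x] \<theta>_u[OF x])
qed

lemma len_tan_xi: assumes x: "x \<in> D" shows "len c (tan_xi c f x) = \<tau> x"
proof -
  have "tan_xi c f x = \<tau> x *\<^sub>R e1 x" by (simp add: tan_xi_def df_def tang_\<xi>[OF x] df_lin[OF x] e1_def)
  then show ?thesis using \<tau>_pos[OF x] by (simp add: len_def onb[OF x])
qed

lemma intrinsic_eq:
  assumes x: "x \<in> D" shows "intrinsic c f x = (\<tau> x, \<tau> x * \<tau> x * h * A11 x)"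
  by (simp add: intrinsic_def len_tan_xi[OF x] tang_\<xi>[OF x] sff_eq[OF x] ddf_lin[OF x] mc[OF x] onb[OF x] onb'[OF x]
      A11_def \<alpha>_eq[OF x])

text \<open>The adapted frame is carried back along \<open>g\<close>: the normals and \<tau>,
  \<open>n\<close> by composition, the tangent fields through \<open>tang\<close>. The result is
  again an adapted frame with the same matrix entries, and both invariants are read off from
  it.\<close>

lemma intrinsic_pullback:
  assumes f': "patch c D' f'" and U: "open U" "U \<subseteq> D'" and g: "smooth_on U g" "g ` U \<subseteq> D"
    and fg: "\<And>y. y \<in> U \<Longrightarrow> f' y = f (g y)"
    and bi: "\<And>y. y \<in> U \<Longrightarrow> df f' y (tang c f' y (bitension c f' y)) = 0" and x: "x \<in> U"
  shows "intrinsic c f' x = intrinsic c f (g x)"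
proof -
  interpret P: patch c U f' by (rule patch_subset[OF f' U])
  have gD: "g y \<in> D" if "y \<in> U" for y using g(2) that by blast
  have gd: "g differentiable (at y)" if "y \<in> U" for y by (rule smooth_on_differentiable[OF g(1) that])
  have chain: "dd f' y v = dd f (g y) (dd g y v)" if y: "y \<in> U" for y v
  proof -
    have "dd f' y v = dd (\<lambda>y. f (g y)) y v" by (rule dd_cong[OF U(1) y]) (rule fg)
    then show ?thesis using dd_compose[OF gd[OF y] f_diff[OF gD[OF y]], of v] by simp
  qed
  \<comment> \<open>The composite \<open>f'\<close> is an immersion, so \<open>dd g y\<close> is
    injective, and between planes it is then surjective.\<close>
  have surj: "\<exists>v. dd g y v = z" if y: "y \<in> U" for y z
  proof -
    have l: "linear (\<lambda>v. dd g y v)" using linear_frechet_derivative[OF gd[OF y]] by simp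
    have i: "inj (\<lambda>v. dd g y v)" by (rule injI, rule P.df_inj[OF y]) (simp add: chain[OF y])
    have "surj (\<lambda>v. dd g y v)" using linear_injective_imp_surjective[OF l i] by simp
    then show ?thesis by (metis surjD)
  qed
  define w1 where "w1 y = tang c f' y (e1 (g y))" for y
  define w2 where "w2 y = tang c f' y (e2 (g y))" for y
  have lift: "dd f' y (tang c f' y (dd f (g y) z)) = dd f (g y) z" if y: "y \<in> U" for y z
  proof -
    obtain v where "dd g y v = z" using surj[OF y] by blast
    then have v: "dd f' y v = dd f (g y) z" using chain[OF y] by simp
    have "tang c f' y (dd f (g y) z) = v"
      unfolding v[symmetric] by (rule P.metric_unique[OF y], unfold P.metric_tang[OF y]) (simp add: P.metric_eq)
    then show ?thesis using v by simp
  qed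
  have e12: "dd f' y (w1 y) = e1 (g y)" "dd f' y (w2 y) = e2 (g y)" if y: "y \<in> U" for y
    using lift[OF y] by (simp_all add: w1_def w2_def e1_def e2_def)
  have sm: "smooth_on U (\<lambda>y. Z (g y))" if "smooth_on D Z" for Z :: "plane \<Rightarrow> ambient"
    by (rule smooth_on_compose[OF that g(1) U(1) g(2)])
  have "frame c U f' w1 w2 (\<lambda>y. e3 (g y)) (\<lambda>y. e4 (g y))"
  proof (intro frame.intro P.patch_axioms frame_axioms.intro)
    show "smooth_on U w1" "smooth_on U w2"
      unfolding w1_def[abs_def] w2_def[abs_def] by (intro P.tang_smooth sm e_smooth)+
    show "smooth_on U (\<lambda>y. e3 (g y))" "smooth_on U (\<lambda>y. e4 (g y))" by (intro sm e_smooth)+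
    show "metric c f' y (w1 y) (w1 y) = 1" "metric c f' y (w2 y) (w2 y) = 1" "metric c f' y (w1 y) (w2 y) = 0"
      if y: "y \<in> U" for y
      by (simp_all add: P.metric_eq e12[OF y] onb[OF gD[OF y]])
  qed (simp_all add: onb onb' gD chain e_tan fg)
  then interpret Q: frame c U f' w1 w2 "\<lambda>y. e3 (g y)" "\<lambda>y. e4 (g y)" .
  have Qe: "Q.e1 y = e1 (g y)" "Q.e2 y = e2 (g y)" if "y \<in> U" for y
    using e12[OF that] by (simp_all add: Q.e1_def Q.e2_def)
  have dQ: "dd Q.e1 y v = dd e1 (g y) (dd g y v)" "dd Q.e2 y v = dd e2 (g y) (dd g y v)" if y: "y \<in> U" for y v
  proof -
    have "dd Q.e1 y v = dd (\<lambda>y. e1 (g y)) y v" "dd Q.e2 y v = dd (\<lambda>y. e2 (g y)) y v"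
      by (rule dd_cong[OF U(1) y], rule Qe, assumption)+
    then show "dd Q.e1 y v = dd e1 (g y) (dd g y v)" "dd Q.e2 y v = dd e2 (g y) (dd g y v)"
      using dd_compose[OF gd[OF y] e_diff(1)[OF gD[OF y]], of v]
        dd_compose[OF gd[OF y] e_diff(2)[OF gD[OF y]], of v] by simp_all
  qed
  have gw: "dd g y (w1 y) = u1 (g y)" "dd g y (w2 y) = u2 (g y)" if y: "y \<in> U" for y
    using e12[OF y] unfolding chain[OF y] e1_def e2_def by (auto intro: df_inj[OF gD[OF y]])
  have S: "ip c (P.ddf y (w1 y) (w1 y)) (e3 (g y)) = ip c (dd e1 (g y) (u1 (g y))) (e3 (g y))"
    "ip c (P.ddf y (w1 y) (w1 y)) (e4 (g y)) = ip c (dd e1 (g y) (u1 (g y))) (e4 (g y))"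
    "ip c (P.ddf y (w2 y) (w2 y)) (e3 (g y)) = ip c (dd e2 (g y) (u2 (g y))) (e3 (g y))"
    "ip c (P.ddf y (w2 y) (w2 y)) (e4 (g y)) = ip c (dd e2 (g y) (u2 (g y))) (e4 (g y))" if y: "y \<in> U" for y
    using arg_cong[OF Q.de_eq(1)[OF y, of "w1 y"], of "\<lambda>w. ip c w (e3 (g y))"]
      arg_cong[OF Q.de_eq(1)[OF y, of "w1 y"], of "\<lambda>w. ip c w (e4 (g y))"]
      arg_cong[OF Q.de_eq(2)[OF y, of "w2 y"], of "\<lambda>w. ip c w (e3 (g y))"]
      arg_cong[OF Q.de_eq(2)[OF y, of "w2 y"], of "\<lambda>w. ip c w (e4 (g y))"]
    by (simp_all add: Q.e_tan[OF y] dQ[OF y] gw[OF y])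
  have "cmc c U f' w1 w2 (\<lambda>y. e3 (g y)) (\<lambda>y. e4 (g y)) (\<lambda>y. \<tau> (g y)) (\<lambda>y. n (g y)) h"
  proof (intro cmc.intro Q.frame_axioms cmc_axioms.intro)
    fix y assume y: "y \<in> U"
    show "\<xi> = \<tau> (g y) *\<^sub>R Q.e1 y + n (g y) *\<^sub>R e4 (g y)" using \<xi>_eq[OF gD[OF y]] Qe[OF y] by simp
    show "mean_curv c f' y = h *\<^sub>R e3 (g y)"
      unfolding Q.mean_curv_eq[OF y] S[OF y] trace_eq[OF gD[OF y]] by simp
  qed (use h_pos \<tau>_pos n_pos gD bi in auto)
  then interpret C: cmc c U f' w1 w2 "\<lambda>y. e3 (g y)" "\<lambda>y. e4 (g y)" "\<lambda>y. \<tau> (g y)" "\<lambda>y. n (g y)" h .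
  have "C.A11 x = A11 (g x)" unfolding C.A11_def A11_def dQ[OF x] gw[OF x] by simp
  then show ?thesis using C.intrinsic_eq[OF x] intrinsic_eq[OF gD[OF x]] by simp
qed

lemma umbilical:
  assumes x: "x \<in> D" and A: "A11 x = h" "A12 x = 0"
  shows "shape c f x (mean_curv c f x) v = (len c (mean_curv c f x))\<^sup>2 *\<^sub>R v"
proof (rule metric_unique[OF x])
  fix w
  have l: "linear (\<lambda>w. ip c (sff c f x v w) (mean_curv c f x))"
    by (rule linearI) (simp_all add: sff_eq[OF x] ddf_lin[OF x] algebra_simps)
  have len: "len c (mean_curv c f x) = h" using h_pos by (simp add: mc[OF x] len_def onb[OF x])
  have "ip c (dd e3 x v) (dd f x w) = - h * (\<theta>1 x v * \<theta>1 x w + \<theta>2 x v * \<theta>2 x w)"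
    by (subst df_expand[OF x, of w]) (simp add: d_onb(6,7)[OF x] \<alpha>_A[OF x] A algebra_simps)
  then have "ip c (ddf x v w) (e3 x) = h * metric c f x v w"
    unfolding S_eq(1)[OF x] metric_frame[OF x] by simp
  then show "metric c f x (shape c f x (mean_curv c f x) v) w = metric c f x ((len c (mean_curv c f x))\<^sup>2 *\<^sub>R v) w"
    unfolding shape_def metric_sharp[OF x l] len metric_bilinear(3)[OF x]
    by (simp add: sff_eq[OF x] mc[OF x] onb[OF x] onb'[OF x] power2_eq_square)
qed

end

section \<open>Parametrisations\<close>

lemma parametrisation_open: "parametrisation S (D, \<phi>) \<Longrightarrow> open D"
  by (simp add: parametrisation_def)

lemma parametrisation_inj: "parametrisation S (D, \<phi>) \<Longrightarrow> inj_on \<phi> D"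
  using homeomorphic_imp_injective_map unfolding parametrisation_def by fastforce

lemma parametrisation_openin:
  assumes "parametrisation S (D, \<phi>)" "open U" "U \<subseteq> D" shows "openin S (\<phi> ` U)"
proof -
  have "open_map (top_of_set D) (subtopology S (\<phi> ` D)) \<phi>"
    using assms(1) homeomorphic_imp_open_map unfolding parametrisation_def by blast
  moreover have "openin (top_of_set D) U" using assms(2,3) by (simp add: openin_open_eq parametrisation_open[OF assms(1)])
  ultimately have "openin (subtopology S (\<phi> ` D)) (\<phi> ` U)" unfolding open_map_def by blast
  then show ?thesis using assms(1) openin_trans_full unfolding parametrisation_def by blast
qed

lemma parametrisation_preimage:
  assumes "parametrisation S (D, \<phi>)" "openin S W" shows "open {x \<in> D. \<phi> x \<in> W}"
proof -
  have "continuous_map (top_of_set D) S \<phi>"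
    using assms(1) homeomorphic_imp_continuous_map continuous_map_into_fulltopology unfolding parametrisation_def by blast
  then have "openin (top_of_set D) {x \<in> D. \<phi> x \<in> W}"
    using openin_continuous_map_preimage[OF _ assms(2)] by fastforce
  then show ?thesis using parametrisation_open[OF assms(1)] openin_open_eq by blast
qed

lemma parametrisation_compose:
  assumes P: "parametrisation S (D, \<phi>)" and UV: "open U" "U \<subseteq> D" "open V" "homeomorphism U V F G"
  shows "parametrisation S (V, \<phi> \<circ> G)"
proof -
  have GV: "G ` V = U" using UV(4) by (simp add: homeomorphism_def)
  have im: "(\<phi> \<circ> G) ` V = \<phi> ` U" using GV by (metis image_comp)
  have oU: "openin S (\<phi> ` U)" by (rule parametrisation_openin[OF P UV(1,2)])
  have top: "topspace (subtopology S (\<phi> ` D)) = \<phi> ` D" "topspace (subtopology S (\<phi> ` U)) = \<phi> ` U"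
    using P oU openin_subset unfolding parametrisation_def by (fastforce simp: topspace_subtopology)+
  have "homeomorphic_maps (top_of_set V) (top_of_set U) G F"
    using UV(4) unfolding homeomorphic_maps_def homeomorphism_def by (auto simp: continuous_map_in_subtopology)
  then have 1: "homeomorphic_map (top_of_set V) (top_of_set U) G"
    using homeomorphic_map_maps by blast
  have "homeomorphic_map (subtopology (top_of_set D) U) (subtopology (subtopology S (\<phi> ` D)) (\<phi> ` U)) \<phi>"
    by (rule homeomorphic_map_subtopologies)
      (use P UV(2) top parametrisation_inj[OF P] in \<open>auto simp: parametrisation_def inj_on_def\<close>)
  moreover have "subtopology (top_of_set D) U = top_of_set U" "subtopology (subtopology S (\<phi> ` D)) (\<phi> ` U) = subtopology S (\<phi> ` U)"
    using UV(2) by (simp_all add: subtopology_subtopology Int_absorb1 image_mono)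
  ultimately have "homeomorphic_map (top_of_set U) (subtopology S (\<phi> ` U)) \<phi>" by simp
  then show ?thesis unfolding parametrisation_def prod.case im
    using homeomorphic_map_compose[OF 1] oU UV(3) by blast
qed

text \<open>A transition from the new parametrisation is the old one preceded by \<open>G\<close>,
  and a transition into it is the old one followed by \<open>F\<close>.\<close>

lemma smooth_transition_compose:
  assumes P: "parametrisation S (D, \<phi>)" and Q: "parametrisation S (D', \<phi>')"
    and UV: "open U" "U \<subseteq> D" "open V" "homeomorphism U V F G" and sm: "smooth_on U F" "smooth_on V G"
    and tr: "smooth_transition (D, \<phi>) (D', \<phi>')" "smooth_transition (D', \<phi>') (D, \<phi>)"
  shows "smooth_transition (V, \<phi> \<circ> G) (D', \<phi>')" "smooth_transition (D', \<phi>') (V, \<phi> \<circ> G)"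
proof -
  have GF: "G ` V = U" "\<And>z. z \<in> V \<Longrightarrow> F (G z) = z" using UV(4) by (simp_all add: homeomorphism_def)
  have R: "parametrisation S (V, \<phi> \<circ> G)" by (rule parametrisation_compose[OF P UV])
  have o: "openin S (\<phi>' ` D')" "openin S ((\<phi> \<circ> G) ` V)"
    using Q R by (auto simp: parametrisation_def)
  have "smooth_on {x \<in> V. (\<phi> \<circ> G) x \<in> \<phi>' ` D'} (\<lambda>x. inv_into D' \<phi>' (\<phi> (G x)))"
    by (rule smooth_on_compose[OF tr(1)[unfolded smooth_transition_def prod.case] smooth_on_subset[OF sm(2)]
        parametrisation_preimage[OF R o(1)]]) (use GF UV(2) in auto)
  then show "smooth_transition (V, \<phi> \<circ> G) (D', \<phi>')" by (simp add: smooth_transition_def)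
  let ?W = "{x \<in> D'. \<phi>' x \<in> (\<phi> \<circ> G) ` V}"
  have oW: "open ?W" by (rule parametrisation_preimage[OF Q o(2)])
  have key: "inv_into D \<phi> (\<phi>' x) \<in> U \<and> F (inv_into D \<phi> (\<phi>' x)) = inv_into V (\<phi> \<circ> G) (\<phi>' x)" if "x \<in> ?W" for x
  proof -
    have "\<phi>' x \<in> (\<phi> \<circ> G) ` V" using that by simp
    then obtain z where z: "\<phi>' x = (\<phi> \<circ> G) z" "z \<in> V" by (rule imageE)
    have "inv_into V (\<phi> \<circ> G) (\<phi>' x) = z" unfolding z(1) by (rule inv_into_f_f[OF parametrisation_inj[OF R] z(2)])
    moreover have GU: "G z \<in> U" using z(2) GF(1) by blast
    moreover have "inv_into D \<phi> (\<phi>' x) = G z"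
      unfolding z(1) comp_apply by (rule inv_into_f_f[OF parametrisation_inj[OF P]]) (use GU UV(2) in blast)
    ultimately show ?thesis using GF(2)[OF z(2)] by metis
  qed
  have "smooth_on ?W (\<lambda>x. inv_into D \<phi> (\<phi>' x))"
    by (rule smooth_on_subset[OF tr(2)[unfolded smooth_transition_def prod.case]]) (use GF UV(2) in auto)
  then have "smooth_on ?W (\<lambda>x. F (inv_into D \<phi> (\<phi>' x)))"
    using smooth_on_compose[OF sm(1) _ oW] key by blast
  then have "smooth_on ?W (\<lambda>x. inv_into V (\<phi> \<circ> G) (\<phi>' x))"
    by (rule smooth_on_cong[OF oW, rotated]) (use key in blast)
  then show "smooth_transition (D', \<phi>') (V, \<phi> \<circ> G)" by (simp add: smooth_transition_def)
qed

text \<open>Level sets and their complements are unions of the given neighbourhoods, so a level set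
  is both open and closed.\<close>

lemma connected_space_locally_constant:
  assumes S: "connected_space S" and loc: "\<And>s. s \<in> topspace S \<Longrightarrow> \<exists>N. openin S N \<and> s \<in> N \<and> (\<forall>t\<in>N. g t = g s)"
    and s: "s \<in> topspace S" "t \<in> topspace S"
  shows "g s = g t"
proof -
  let ?A = "{t \<in> topspace S. g t = g s}"
  have o: "openin S {t \<in> topspace S. P (g t)}" for P
  proof (subst openin_subopen, intro ballI)
    fix x assume x: "x \<in> {t \<in> topspace S. P (g t)}"
    then have "x \<in> topspace S" by simp
    from loc[OF this] obtain N where N: "openin S N" "x \<in> N" "\<forall>t\<in>N. g t = g x" by (elim exE conjE)
    have "t \<in> topspace S \<and> P (g t)" if "t \<in> N" for t
    proof -
      have "g t = g x" using N(3) that by (rule bspec)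
      then show ?thesis using x that openin_subset[OF N(1)] by (metis (mono_tags) mem_Collect_eq subsetD)
    qed
    then show "\<exists>T. openin S T \<and> x \<in> T \<and> T \<subseteq> {t \<in> topspace S. P (g t)}"
      using N(1,2) by (intro exI[of _ N] conjI subsetI CollectI) simp_all
  qed
  have "topspace S - ?A = {t \<in> topspace S. g t \<noteq> g s}" by blast
  then have "openin S ?A" "openin S (topspace S - ?A)" using o[of "\<lambda>z. z = g s"] o[of "\<lambda>z. z \<noteq> g s"] by simp_all
  then have "?A = {} \<or> ?A = topspace S"
    using S unfolding connected_space_clopen_in closedin_def by auto
  moreover have "s \<in> ?A" using s(1) by simp
  ultimately have "t \<in> ?A" using s(2) by (metis empty_iff)
  then show ?thesis by simp
qed

section \<open>The global statement\<close>

locale biconservative_cmc_surface =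
  fixes c h :: real and S :: "'p topology" and \<A> :: "'p param set" and \<psi> :: "'p \<Rightarrow> ambient"
  assumes c_nz: "c \<noteq> 0"
    and surf: "immersed_surface c S \<A> \<psi>"
    and bi: "biconservative c \<A> \<psi>"
    and H: "everywhere \<A> \<psi> (\<lambda>f x. len c (mean_curv c f x) = h)"
      "everywhere \<A> \<psi> (\<lambda>f x. mean_curv c f x \<noteq> 0)"
      "everywhere \<A> \<psi> (\<lambda>f x. ip c (mean_curv c f x) \<xi> = 0)"
    and T: "everywhere \<A> \<psi> (\<lambda>f x. 0 < len c (tan_xi c f x) \<and> len c (tan_xi c f x) < 1)"
begin

lemma atlas_param: "(D, \<phi>) \<in> \<A> \<Longrightarrow> parametrisation S (D, \<phi>)"
  using surf unfolding immersed_surface_def smooth_surface_def by blast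

lemma atlas_transition: "P \<in> \<A> \<Longrightarrow> Q \<in> \<A> \<Longrightarrow> smooth_transition P Q"
  using surf unfolding immersed_surface_def smooth_surface_def by blast

lemma atlas_covers:
  assumes "p \<in> topspace S" obtains D \<phi> x where "(D, \<phi>) \<in> \<A>" "x \<in> D" "p = \<phi> x"
proof -
  have "p \<in> (\<Union>(D, \<phi>)\<in>\<A>. \<phi> ` D)" using surf assms unfolding immersed_surface_def smooth_surface_def by simp
  then show ?thesis using that by auto
qed

lemma atlas_topspace: "(D, \<phi>) \<in> \<A> \<Longrightarrow> x \<in> D \<Longrightarrow> \<phi> x \<in> topspace S"
  using surf unfolding immersed_surface_def smooth_surface_def by blast

lemma atlas_patch: "(D, \<phi>) \<in> \<A> \<Longrightarrow> patch c D (\<psi> \<circ> \<phi>)"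
  using surf c_nz parametrisation_open[OF atlas_param] unfolding immersed_surface_def patch_def by blast

lemma atlas_bi: "(D, \<phi>) \<in> \<A> \<Longrightarrow> x \<in> D \<Longrightarrow>
    df (\<psi> \<circ> \<phi>) x (tang c (\<psi> \<circ> \<phi>) x (bitension c (\<psi> \<circ> \<phi>) x)) = 0"
  using bi unfolding biconservative_def everywhere_def by blast

lemma atlas_cmc:
  assumes P: "(D, \<phi>) \<in> \<A>" and B: "open B" "B \<subseteq> D" "B \<noteq> {}"
  obtains u1 u2 e3 e4 \<tau> n where "cmc c B (\<psi> \<circ> \<phi>) u1 u2 e3 e4 \<tau> n h"
proof -
  interpret patch c B "\<psi> \<circ> \<phi>" by (rule patch_subset[OF atlas_patch[OF P] B(1,2)])
  have E: "Q (\<psi> \<circ> \<phi>) x" if "everywhere \<A> \<psi> Q" "x \<in> B" for Q x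
    using that P B(2) unfolding everywhere_def by blast
  show ?thesis
    using cmc_frame[OF E[OF H(1)] E[OF H(2)] E[OF H(3)] E[OF T] atlas_bi[OF P subsetD[OF B(2)]] B(3)] that by blast
qed

lemma intrinsic_transition:
  assumes P: "(D, \<phi>) \<in> \<A>" "x \<in> D" and Q: "(D', \<phi>') \<in> \<A>" "x' \<in> D'" and eq: "\<phi> x = \<phi>' x'"
  shows "intrinsic c (\<psi> \<circ> \<phi>) x = intrinsic c (\<psi> \<circ> \<phi>') x'"
proof -
  note Pp = atlas_param[OF P(1)] and Qp = atlas_param[OF Q(1)]
  let ?U = "{y \<in> D. \<phi> y \<in> \<phi>' ` D'}" and ?g = "\<lambda>y. inv_into D' \<phi>' (\<phi> y)"
  have "D' \<noteq> {}" using Q(2) by blast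
  then obtain u1 u2 e3 e4 \<tau> n where "cmc c D' (\<psi> \<circ> \<phi>') u1 u2 e3 e4 \<tau> n h"
    using atlas_cmc[OF Q(1) parametrisation_open[OF Qp] order_refl] by blast
  then interpret cmc c D' "\<psi> \<circ> \<phi>'" u1 u2 e3 e4 \<tau> n h .
  have "openin S (\<phi>' ` D')" by (rule parametrisation_openin[OF Qp parametrisation_open[OF Qp] order_refl])
  then have oU: "open ?U" by (rule parametrisation_preimage[OF Pp])
  have sg: "smooth_on ?U ?g" using atlas_transition[OF P(1) Q(1)] by (simp add: smooth_transition_def)
  have g: "?g y \<in> D'" "\<phi>' (?g y) = \<phi> y" if "y \<in> ?U" for y
    using that by (auto simp: inv_into_into f_inv_into_f)
  have "intrinsic c (\<psi> \<circ> \<phi>) x = intrinsic c (\<psi> \<circ> \<phi>') (?g x)"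
  proof (rule intrinsic_pullback[OF atlas_patch[OF P(1)] oU _ sg])
    show "?g ` ?U \<subseteq> D'" using g(1) by blast
    show "x \<in> ?U" using P(2) Q(2) eq by simp
    show "(\<psi> \<circ> \<phi>) y = (\<psi> \<circ> \<phi>') (?g y)" if "y \<in> ?U" for y using g(2)[OF that] by simp
  qed (use atlas_bi[OF P(1)] in auto)
  also have "?g x = x'" unfolding eq by (rule inv_into_f_f[OF parametrisation_inj[OF Qp] Q(2)])
  finally show ?thesis .
qed

text \<open>By \<open>intrinsic_transition\<close> the value depends only on the point, so it
  defines a function on the surface. It is constant on images of balls, which unlike chart domains
  are connected, and the surface itself is connected.\<close>

lemma intrinsic_const:
  obtains v where "\<And>D \<phi> x. (D, \<phi>) \<in> \<A> \<Longrightarrow> x \<in> D \<Longrightarrow> intrinsic c (\<psi> \<circ> \<phi>) x = v"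
proof -
  define g where "g s = (SOME v. \<exists>D \<phi> x. (D, \<phi>) \<in> \<A> \<and> x \<in> D \<and> \<phi> x = s \<and> v = intrinsic c (\<psi> \<circ> \<phi>) x)" for s
  have g: "g (\<phi> x) = intrinsic c (\<psi> \<circ> \<phi>) x" if P: "(D, \<phi>) \<in> \<A>" "x \<in> D" for D \<phi> x
  proof -
    have "\<exists>v. \<exists>D' \<phi>' x'. (D', \<phi>') \<in> \<A> \<and> x' \<in> D' \<and> \<phi>' x' = \<phi> x \<and> v = intrinsic c (\<psi> \<circ> \<phi>') x'"
      using P by blast
    from someI_ex[OF this] show ?thesis unfolding g_def[symmetric] using intrinsic_transition P by metis
  qed
  have loc: "\<exists>N. openin S N \<and> s \<in> N \<and> (\<forall>t\<in>N. g t = g s)" if s: "s \<in> topspace S" for s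
  proof -
    obtain D \<phi> x where P: "(D, \<phi>) \<in> \<A>" "x \<in> D" "s = \<phi> x" using atlas_covers[OF s] .
    obtain r where r: "r > 0" "ball x r \<subseteq> D"
      using parametrisation_open[OF atlas_param[OF P(1)]] P(2) open_contains_ball by blast
    have xb: "x \<in> ball x r" using r by simp
    then obtain u1 u2 e3 e4 \<tau> n where "cmc c (ball x r) (\<psi> \<circ> \<phi>) u1 u2 e3 e4 \<tau> n h"
      using atlas_cmc[OF P(1) open_ball r(2)] by blast
    then interpret cmc c "ball x r" "\<psi> \<circ> \<phi>" u1 u2 e3 e4 \<tau> n h .
    have "intrinsic c (\<psi> \<circ> \<phi>) y = intrinsic c (\<psi> \<circ> \<phi>) x" if y: "y \<in> ball x r" for y
      using \<tau>_const[OF connected_ball y xb] A_const(1)[OF connected_ball y xb]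
      by (simp add: intrinsic_eq[OF y] intrinsic_eq[OF xb])
    then have "\<forall>t\<in>\<phi> ` ball x r. g t = g s" using g[OF P(1)] P(2,3) r(2) by auto
    then show ?thesis
      using parametrisation_openin[OF atlas_param[OF P(1)] open_ball r(2)] xb P(3) by blast
  qed
  have con: "connected_space S" and ne: "topspace S \<noteq> {}" using surf by (simp_all add: immersed_surface_def)
  obtain s where s: "s \<in> topspace S" using ne by blast
  have "intrinsic c (\<psi> \<circ> \<phi>) x = g s" if P: "(D, \<phi>) \<in> \<A>" "x \<in> D" for D \<phi> x
    using connected_space_locally_constant[OF con loc atlas_topspace[OF P] s] g[OF P] by metis
  then show ?thesis using that by blast
qed

text \<open>The invariant determines \<open>A11\<close> after division by
  \<open>\<tau> * \<tau> * h\<close>, so \<open>a\<close> is the same for every adapted frame on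
  every chart. Only \<open>A12\<close> is left out, as its sign depends on \<open>u2\<close>. The
  inequality is Gauss after completing the square, with the square of \<open>A12\<close>
  dropped.\<close>

lemma constants:
  obtains \<tau> a where "0 < \<tau>" "\<tau> < 1" "h > 0"
    "\<And>D \<phi> x. (D, \<phi>) \<in> \<A> \<Longrightarrow> x \<in> D \<Longrightarrow> len c (tan_xi c (\<psi> \<circ> \<phi>) x) = \<tau>"
    "\<And>D \<phi> B u1 u2 e3 e4 t n x. (D, \<phi>) \<in> \<A> \<Longrightarrow> B \<subseteq> D \<Longrightarrow> cmc c B (\<psi> \<circ> \<phi>) u1 u2 e3 e4 t n h \<Longrightarrow> x \<in> B \<Longrightarrow>
       t x = \<tau> \<and> cmc.A11 c (\<psi> \<circ> \<phi>) u1 e3 x = a"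
    "(a - h) * (a - h) \<le> h * h + c * (1 - \<tau> * \<tau>)"
proof -
  obtain \<tau> P where v: "\<And>D \<phi> x. (D, \<phi>) \<in> \<A> \<Longrightarrow> x \<in> D \<Longrightarrow> intrinsic c (\<psi> \<circ> \<phi>) x = (\<tau>, P)"
    using intrinsic_const by (metis surj_pair)
  have len: "len c (tan_xi c (\<psi> \<circ> \<phi>) x) = \<tau>" if "(D, \<phi>) \<in> \<A>" "x \<in> D" for D \<phi> x
    using v[OF that] by (simp add: intrinsic_def)
  obtain s where s: "s \<in> topspace S" using surf unfolding immersed_surface_def by blast
  obtain D \<phi> x where P: "(D, \<phi>) \<in> \<A>" "x \<in> D" using atlas_covers[OF s] .
  have \<tau>: "0 < \<tau>" "\<tau> < 1" using T len[OF P] P unfolding everywhere_def by blast+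
  have "D \<noteq> {}" using P(2) by blast
  then obtain u1 u2 e3 e4 t n where "cmc c D (\<psi> \<circ> \<phi>) u1 u2 e3 e4 t n h"
    using atlas_cmc[OF P(1) parametrisation_open[OF atlas_param[OF P(1)]] order_refl] by blast
  then interpret cmc c D "\<psi> \<circ> \<phi>" u1 u2 e3 e4 t n h .
  define a where "a = P / (\<tau> * \<tau> * h)"
  have cA: "t' x = \<tau> \<and> cmc.A11 c (\<psi> \<circ> \<phi>') w1 e3' x = a"
    if "(D', \<phi>') \<in> \<A>" "B \<subseteq> D'" "cmc c B (\<psi> \<circ> \<phi>') w1 w2 e3' e4' t' n' h" "x \<in> B" for D' \<phi>' B w1 w2 e3' e4' t' n' x
  proof -
    interpret C: cmc c B "\<psi> \<circ> \<phi>'" w1 w2 e3' e4' t' n' h by fact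
    have "(t' x, t' x * t' x * h * C.A11 x) = (\<tau>, P)" using C.intrinsic_eq[OF that(4)] v[OF that(1) subsetD[OF that(2,4)]] by simp
    then show ?thesis using \<tau> h_pos by (auto simp: a_def)
  qed
  have "A12 x * A12 x = a * (2 * h - a) + c * (1 - \<tau> * \<tau>)"
    using gauss[OF P(2)] cA[OF P(1) order_refl cmc_axioms P(2)] by simp
  then have "(a - h) * (a - h) + A12 x * A12 x = h * h + c * (1 - \<tau> * \<tau>)" by algebra
  then have "(a - h) * (a - h) \<le> h * h + c * (1 - \<tau> * \<tau>)" using zero_le_square[of "A12 x"] by linarith
  note disc = this
  show ?thesis
  proof (rule that[of \<tau> a])
    show "t x = \<tau> \<and> cmc.A11 c (\<psi> \<circ> \<phi>) u1 e3 x = a"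
      if "(D, \<phi>) \<in> \<A>" "B \<subseteq> D" "cmc c B (\<psi> \<circ> \<phi>) u1 u2 e3 e4 t n h" "x \<in> B" for D \<phi> B u1 u2 e3 e4 t n x
      by (rule cA[OF that])
  qed (use \<tau> h_pos len disc in blast)+
qed

lemma surface_flat: "flat c \<A> \<psi>"
  unfolding flat_def everywhere_def
proof clarify
  fix D \<phi> and x v w z :: plane
  assume P: "(D, \<phi>) \<in> \<A>" "x \<in> D"
  then have "D \<noteq> {}" by blast
  then obtain u1 u2 e3 e4 t n where "cmc c D (\<psi> \<circ> \<phi>) u1 u2 e3 e4 t n h"
    using atlas_cmc[OF P(1) parametrisation_open[OF atlas_param[OF P(1)]] order_refl] by blast
  then interpret cmc c D "\<psi> \<circ> \<phi>" u1 u2 e3 e4 t n h .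
  show "surf_curv c (\<psi> \<circ> \<phi>) x v w z = 0" by (rule flat[OF P(2)])
qed

end

text \<open>\<open>C\<close> and \<open>Sn\<close> are the cosine and, up to sign, the sine of the angle from \<open>T/|T|\<close> to the first principal
  direction.  The sign depends on the patch, but the second direction is oriented so that its component
  \<open>\<tau> * Sn\<close> along \<open>\<xi>\<close> does not.\<close>

lemma (in biconservative_cmc_surface) principal_parametrisation:
  assumes const: "\<And>D \<phi> B u1 u2 e3 e4 t n x. (D, \<phi>) \<in> \<A> \<Longrightarrow> B \<subseteq> D \<Longrightarrow> cmc c B (\<psi> \<circ> \<phi>) u1 u2 e3 e4 t n h \<Longrightarrow> x \<in> B \<Longrightarrow>
       t x = \<tau> \<and> cmc.A11 c (\<psi> \<circ> \<phi>) u1 e3 x = a"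
    and \<tau>: "0 < \<tau>" "\<tau> < 1" and \<delta>: "\<delta> * \<delta> = h * h + c * (1 - \<tau> * \<tau>)" "0 \<le> \<delta>" and h: "h > 0"
    and C: "0 \<le> C" "0 \<le> Sn" "C * C + Sn * Sn = 1" "\<delta> * (C * C - Sn * Sn) = a - h"
  shows "locally_given c S \<A> \<psi> (\<lambda>D X.
     (\<forall>q\<in>D. ip c (df X q e\<^sub>1) \<xi> = \<tau> * C \<and> ip c (df X q e\<^sub>2) \<xi> = \<tau> * Sn) \<and>
     integral_curves_satisfy D X e\<^sub>1 (helix_or_circle c \<bar>h + \<delta>\<bar> (\<bar>\<tau> * C\<bar> / sqrt (1 - \<tau> * \<tau>) * \<bar>h + \<delta>\<bar>)) \<and>
     integral_curves_satisfy D X e\<^sub>2 (helix_or_circle c \<bar>h - \<delta>\<bar> (\<bar>\<tau> * Sn\<bar> / sqrt (1 - \<tau> * \<tau>) * \<bar>h - \<delta>\<bar>)))"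
  unfolding locally_given_def
proof
  fix s assume "s \<in> topspace S"
  then obtain D \<phi> x0 where P: "(D, \<phi>) \<in> \<A>" "x0 \<in> D" "s = \<phi> x0" using atlas_covers by blast
  note Pp = atlas_param[OF P(1)]
  obtain r where r: "r > 0" "ball x0 r \<subseteq> D" using parametrisation_open[OF Pp] P(2) open_contains_ball by blast
  let ?B = "ball x0 r"
  have xb: "x0 \<in> ?B" using r by simp
  then obtain u1 u2 e3 e4 t n where cm: "cmc c ?B (\<psi> \<circ> \<phi>) u1 u2 e3 e4 t n h"
    using atlas_cmc[OF P(1) open_ball r(2)] by blast
  then interpret cmc c ?B "\<psi> \<circ> \<phi>" u1 u2 e3 e4 t n h .
  have tA: "t x = \<tau>" "A11 x = a" if "x \<in> ?B" for x using const[OF P(1) r(2) cm that] by auto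
  define a12 where "a12 = A12 x0"
  have A12: "A12 x = a12" if "x \<in> ?B" for x using A_const(2)[OF connected_ball that xb] by (simp add: a12_def)
  define \<sigma> :: real where "\<sigma> = (if a12 \<ge> 0 then 1 else -1)"
  have "a12 * a12 = a * (2 * h - a) + c * (1 - \<tau> * \<tau>)" using gauss[OF xb] tA[OF xb] A12[OF xb] by simp
  \<comment> \<open>Double-angle formulas: the trace-free part of the matrix is \<delta> times a
    reflection, with entries \<delta> cos and \<delta> sin of twice the principal angle. Gauss
    recovers the sine up to sign.\<close>
  then have "a12 * a12 = (2 * \<delta> * C * Sn) * (2 * \<delta> * C * Sn)" using C(3,4) \<delta>(1) by algebra
  moreover have "2 * \<delta> * C * Sn \<ge> 0" using C(1,2) \<delta>(2) by simp
  ultimately have "\<bar>a12\<bar> = 2 * \<delta> * C * Sn" by (metis real_sqrt_abs2 abs_of_nonneg)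
  then have a12: "a12 = \<sigma> * (2 * \<delta> * C * Sn)" and \<sigma>: "\<sigma> * \<sigma> = 1" by (auto simp: \<sigma>_def)
  \<comment> \<open>The product of the principal curvatures is the determinant prescribed by Gauss.
    It is non-zero because \<open>c\<close> is non-zero and |T| < 1, so both families of curves have
    a first curvature.\<close>
  have "(h + \<delta>) * (h - \<delta>) = - c * (1 - \<tau> * \<tau>)" using \<delta>(1) by algebra
  moreover have "1 - \<tau> * \<tau> > 0" using mult_strict_mono[of \<tau> 1 \<tau> 1] \<tau> by simp
  ultimately have k: "h + \<delta> \<noteq> 0" "h - \<delta> \<noteq> 0" using c_nz by auto
  obtain U V F G where UV: "open U" "x0 \<in> U" "U \<subseteq> ?B" "open V" "homeomorphism U V F G" "smooth_on U F" "smooth_on V G"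
    and iso: "isometric_immersion c V (\<psi> \<circ> \<phi> \<circ> G)"
    and ang: "\<And>z. z \<in> V \<Longrightarrow> ip c (df (\<psi> \<circ> \<phi> \<circ> G) z e\<^sub>1) \<xi> = \<tau> * C \<and> ip c (df (\<psi> \<circ> \<phi> \<circ> G) z e\<^sub>2) \<xi> = \<tau> * Sn"
    and ic: "integral_curves_satisfy V (\<psi> \<circ> \<phi> \<circ> G) e\<^sub>1 (helix_or_circle c \<bar>h + \<delta>\<bar> (\<bar>\<tau> * C\<bar> / sqrt (1 - \<tau> * \<tau>) * \<bar>h + \<delta>\<bar>))"
    "integral_curves_satisfy V (\<psi> \<circ> \<phi> \<circ> G) e\<^sub>2 (helix_or_circle c \<bar>h - \<delta>\<bar> (\<bar>\<tau> * Sn\<bar> / sqrt (1 - \<tau> * \<tau>) * \<bar>h - \<delta>\<bar>))"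
  proof (rule principal_coordinates[OF tA A12, of C "\<sigma> * Sn" "h + \<delta>" Sn "- \<sigma> * C" "h - \<delta>" x0])
    show "a * C + a12 * (\<sigma> * Sn) = (h + \<delta>) * C" "a12 * C + (2 * h - a) * (\<sigma> * Sn) = (h + \<delta>) * (\<sigma> * Sn)"
      "a * Sn + a12 * (- \<sigma> * C) = (h - \<delta>) * Sn" "a12 * Sn + (2 * h - a) * (- \<sigma> * C) = (h - \<delta>) * (- \<sigma> * C)"
      "C * C + \<sigma> * Sn * (\<sigma> * Sn) = 1" "Sn * Sn + - \<sigma> * C * (- \<sigma> * C) = 1" "C * Sn + \<sigma> * Sn * (- \<sigma> * C) = 0"
      using C(3,4) \<sigma> a12 by algebra+
  qed (use k xb in blast)+
  have UD: "U \<subseteq> D" using UV(3) r(2) by blast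
  have "s \<in> (\<phi> \<circ> G) ` V"
  proof
    show "F x0 \<in> V" "s = (\<phi> \<circ> G) (F x0)" using UV(2,5) P(3) by (auto simp: homeomorphism_def)
  qed
  moreover have "parametrisation S (V, \<phi> \<circ> G)" by (rule parametrisation_compose[OF Pp UV(1) UD UV(4,5)])
  moreover have "smooth_transition (V, \<phi> \<circ> G) Q \<and> smooth_transition Q (V, \<phi> \<circ> G)" if Q: "Q \<in> \<A>" for Q
    using smooth_transition_compose[OF Pp _ UV(1) UD UV(4-7), of "fst Q" "snd Q"] Q atlas_param[of "fst Q" "snd Q"]
      atlas_transition[OF P(1) Q] atlas_transition[OF Q P(1)] by simp
  ultimately show "\<exists>D \<theta>. s \<in> \<theta> ` D \<and> parametrisation S (D, \<theta>) \<and>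
      (\<forall>P\<in>\<A>. smooth_transition (D, \<theta>) P \<and> smooth_transition P (D, \<theta>)) \<and> isometric_immersion c D (\<psi> \<circ> \<theta>) \<and>
      (\<forall>q\<in>D. ip c (df (\<psi> \<circ> \<theta>) q e\<^sub>1) \<xi> = \<tau> * C \<and> ip c (df (\<psi> \<circ> \<theta>) q e\<^sub>2) \<xi> = \<tau> * Sn) \<and>
     integral_curves_satisfy D (\<psi> \<circ> \<theta>) e\<^sub>1 (helix_or_circle c \<bar>h + \<delta>\<bar> (\<bar>\<tau> * C\<bar> / sqrt (1 - \<tau> * \<tau>) * \<bar>h + \<delta>\<bar>)) \<and>
     integral_curves_satisfy D (\<psi> \<circ> \<theta>) e\<^sub>2 (helix_or_circle c \<bar>h - \<delta>\<bar> (\<bar>\<tau> * Sn\<bar> / sqrt (1 - \<tau> * \<tau>) * \<bar>h - \<delta>\<bar>))"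
    using iso ang ic by (intro exI[of _ V] exI[of _ "\<phi> \<circ> G"]) (auto simp: o_assoc)
qed

section \<open>The umbilic and the non-umbilic case\<close>

theorem theorem4p1:
  fixes c h :: real
    and S :: "'p topology"
    and \<A> :: "'p param set"
    and \<psi> :: "'p \<Rightarrow> ambient"
  assumes "c \<noteq> 0"
    and "immersed_surface c S \<A> \<psi>"
    and "biconservative c \<A> \<psi>"
    and "everywhere \<A> \<psi> (\<lambda>f x. len c (mean_curv c f x) = h)"
    and "everywhere \<A> \<psi> (\<lambda>f x. mean_curv c f x \<noteq> 0)"
    and "everywhere \<A> \<psi> (\<lambda>f x. ip c (mean_curv c f x) \<xi> = 0)"
    and "everywhere \<A> \<psi> (\<lambda>f x. 0 < len c (tan_xi c f x) \<and> len c (tan_xi c f x) < 1)"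
  shows "flat c \<A> \<psi> \<and>
    (\<exists>\<tau>. everywhere \<A> \<psi> (\<lambda>f x. len c (tan_xi c f x) = \<tau>) \<and>
      ((pseudo_umbilical c \<A> \<psi> \<and> c < 0 \<and> h\<^sup>2 = - c * (1 - \<tau>\<^sup>2) \<and>
        locally_given c S \<A> \<psi> (\<lambda>D X.
          (\<forall>q\<in>D. ip c (df X q e\<^sub>1) \<xi> = \<tau> \<and> ip c (df X q e\<^sub>2) \<xi> = 0) \<and>
          integral_curves_satisfy D X e\<^sub>1 (helix c h (sqrt (- c) * \<tau>)) \<and>
          integral_curves_satisfy D X e\<^sub>2 (circle c h)))
      \<or>
       (h\<^sup>2 > - c * (1 - \<tau>\<^sup>2) \<and>
        (\<exists>a b. 0 < a\<^sup>2 + b\<^sup>2 \<and> a\<^sup>2 + b\<^sup>2 = \<tau>\<^sup>2 \<and> \<tau>\<^sup>2 < 1 \<and> h\<^sup>2 + c * (1 - a\<^sup>2 - b\<^sup>2) > 0 \<and>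
          (let \<delta> = sqrt (h\<^sup>2 + c * (1 - a\<^sup>2 - b\<^sup>2));
               n = sqrt (1 - a\<^sup>2 - b\<^sup>2);
               \<kappa>1 = h + \<delta>;
               \<kappa>2 = \<bar>h - \<delta>\<bar>
           in locally_given c S \<A> \<psi> (\<lambda>D X.
                (\<forall>q\<in>D. ip c (df X q e\<^sub>1) \<xi> = a \<and> ip c (df X q e\<^sub>2) \<xi> = b) \<and>
                integral_curves_satisfy D X e\<^sub>1 (helix_or_circle c \<kappa>1 (\<bar>a\<bar> / n * \<kappa>1)) \<and>
                integral_curves_satisfy D X e\<^sub>2 (helix_or_circle c \<kappa>2 (\<bar>b\<bar> / n * \<kappa>2))))))))"
proof -
  interpret biconservative_cmc_surface c h S \<A> \<psi> by unfold_locales fact+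
  obtain \<tau> a where \<tau>: "0 < \<tau>" "\<tau> < 1" and h: "h > 0"
    and len: "\<And>D \<phi> x. (D, \<phi>) \<in> \<A> \<Longrightarrow> x \<in> D \<Longrightarrow> len c (tan_xi c (\<psi> \<circ> \<phi>) x) = \<tau>"
    and const: "\<And>D \<phi> B u1 u2 e3 e4 t n x. (D, \<phi>) \<in> \<A> \<Longrightarrow> B \<subseteq> D \<Longrightarrow> cmc c B (\<psi> \<circ> \<phi>) u1 u2 e3 e4 t n h \<Longrightarrow> x \<in> B \<Longrightarrow>
       t x = \<tau> \<and> cmc.A11 c (\<psi> \<circ> \<phi>) u1 e3 x = a"
    and disc: "(a - h) * (a - h) \<le> h * h + c * (1 - \<tau> * \<tau>)"
    by (rule constants, rule that, assumption+)
  define \<delta> where "\<delta> = sqrt (h * h + c * (1 - \<tau> * \<tau>))"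
  have \<delta>: "\<delta> * \<delta> = h * h + c * (1 - \<tau> * \<tau>)" "0 \<le> \<delta>"
    using order_trans[OF zero_le_square disc] unfolding \<delta>_def by simp_all
  have \<tau>2: "\<tau> * \<tau> < 1" using mult_strict_mono[of \<tau> 1 \<tau> 1] \<tau> by simp
  have pp: "locally_given c S \<A> \<psi> (\<lambda>D X.
     (\<forall>q\<in>D. ip c (df X q e\<^sub>1) \<xi> = \<tau> * C \<and> ip c (df X q e\<^sub>2) \<xi> = \<tau> * Sn) \<and>
     integral_curves_satisfy D X e\<^sub>1 (helix_or_circle c \<bar>h + \<delta>\<bar> (\<bar>\<tau> * C\<bar> / sqrt (1 - \<tau> * \<tau>) * \<bar>h + \<delta>\<bar>)) \<and>
     integral_curves_satisfy D X e\<^sub>2 (helix_or_circle c \<bar>h - \<delta>\<bar> (\<bar>\<tau> * Sn\<bar> / sqrt (1 - \<tau> * \<tau>) * \<bar>h - \<delta>\<bar>)))"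
    if C: "0 \<le> C" "0 \<le> Sn" "C * C + Sn * Sn = 1" "\<delta> * (C * C - Sn * Sn) = a - h" for C Sn
  proof (rule principal_parametrisation[where \<tau> = \<tau> and a = a and \<delta> = \<delta>])
    show "t x = \<tau> \<and> cmc.A11 c (\<psi> \<circ> \<phi>) u1 e3 x = a"
      if "(D, \<phi>) \<in> \<A>" "B \<subseteq> D" "cmc c B (\<psi> \<circ> \<phi>) u1 u2 e3 e4 t n h" "x \<in> B" for D \<phi> B u1 u2 e3 e4 t n x
      by (rule const[OF that])
  qed (fact \<tau> \<delta> h C)+
  have ev: "everywhere \<A> \<psi> (\<lambda>f x. len c (tan_xi c f x) = \<tau>)" using len unfolding everywhere_def by blast
  show ?thesis
  proof (cases "\<delta> = 0")
    \<comment> \<open>The gap \<open>2 * \<delta>\<close> between the principal curvatures closes,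
      so every direction is principal.\<close>
    case True
    then have hh: "h * h = - c * (1 - \<tau> * \<tau>)" using \<delta>(1) by simp
    have "c * (1 - \<tau> * \<tau>) < 0" using mult_pos_pos[OF h h] hh by simp
    then have c: "c < 0" using \<tau>2 by (simp add: mult_less_0_iff)
    have "(a - h) * (a - h) \<le> 0" using disc \<delta>(1) True by simp
    then have a: "a = h" using zero_le_square[of "a - h"] by (metis antisym eq_iff_diff_eq_0 mult_eq_0_iff)
    have "sqrt (h * h) = sqrt (- c) * sqrt (1 - \<tau> * \<tau>)" unfolding hh by (rule real_sqrt_mult)
    then have "h = sqrt (- c) * sqrt (1 - \<tau> * \<tau>)" using h by simp
    then have k: "\<bar>\<tau>\<bar> / sqrt (1 - \<tau> * \<tau>) * \<bar>h\<bar> = sqrt (- c) * \<tau>" using \<tau> \<tau>2 h by (simp add: field_simps)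
    have pu: "pseudo_umbilical c \<A> \<psi>"
      unfolding pseudo_umbilical_def everywhere_def
    proof clarify
      fix D \<phi> and x v :: plane
      assume P: "(D, \<phi>) \<in> \<A>" "x \<in> D"
      then have "D \<noteq> {}" by blast
      then obtain u1 u2 e3 e4 t n where cm: "cmc c D (\<psi> \<circ> \<phi>) u1 u2 e3 e4 t n h"
        using atlas_cmc[OF P(1) parametrisation_open[OF atlas_param[OF P(1)]] order_refl] by blast
      then interpret cmc c D "\<psi> \<circ> \<phi>" u1 u2 e3 e4 t n h .
      have A: "A11 x = h" "t x = \<tau>" using const[OF P(1) order_refl cm P(2)] a by auto
      then have "A12 x * A12 x = 0" using gauss[OF P(2)] hh by simp
      then show "shape c (\<psi> \<circ> \<phi>) x (mean_curv c (\<psi> \<circ> \<phi>) x) v = (len c (mean_curv c (\<psi> \<circ> \<phi>) x))\<^sup>2 *\<^sub>R v"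
        using umbilical[OF P(2) A(1)] by simp
    qed
    have "sqrt (- c) * \<tau> \<noteq> 0" using c \<tau> by simp
    then have fn: "helix_or_circle c h (sqrt (- c) * \<tau>) = helix c h (sqrt (- c) * \<tau>)" "helix_or_circle c h 0 = circle c h"
      by (auto simp: helix_or_circle_def fun_eq_iff)
    have "locally_given c S \<A> \<psi> (\<lambda>D X. (\<forall>q\<in>D. ip c (df X q e\<^sub>1) \<xi> = \<tau> \<and> ip c (df X q e\<^sub>2) \<xi> = 0) \<and>
          integral_curves_satisfy D X e\<^sub>1 (helix c h (sqrt (- c) * \<tau>)) \<and>
          integral_curves_satisfy D X e\<^sub>2 (circle c h))"
      \<comment> \<open>Among the principal directions \<open>T/|T|\<close> is selected; its
        orthogonal complement is perpendicular to \<xi>, so the second family has no torsion and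
        consists of circles.\<close>
      using pp[of 1 0] True a h k fn by simp
    then show ?thesis using surface_flat ev pu c hh
      by (intro conjI exI[of _ \<tau>] disjI1) (simp_all add: power2_eq_square)
  next
    case False
    then have dp: "\<delta> > 0" using \<delta>(2) by simp
    \<comment> \<open>The cosine of twice the angle from \<open>T/|T|\<close> to the first principal
      direction; \<open>disc\<close> puts it into the range of the cosine.\<close>
    define r where "r = (a - h) / \<delta>"
    have "\<bar>a - h\<bar> \<le> \<delta>" using real_sqrt_le_mono[OF disc] unfolding \<delta>_def real_sqrt_abs2 .
    then have r: "-1 \<le> r" "r \<le> 1" "\<delta> * r = a - h" using dp by (auto simp: r_def field_simps)
    \<comment> \<open>Half-angle formulas with non-negative roots. They depend only on global
      constants, which makes the components of \<xi> along both families uniform over the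
      surface.\<close>
    define C where "C = sqrt ((1 + r) / 2)"
    define Sn where "Sn = sqrt ((1 - r) / 2)"
    have C: "0 \<le> C" "0 \<le> Sn" "C * C = (1 + r) / 2" "Sn * Sn = (1 - r) / 2" using r by (simp_all add: C_def Sn_def)
    have lg: "locally_given c S \<A> \<psi> (\<lambda>D X.
     (\<forall>q\<in>D. ip c (df X q e\<^sub>1) \<xi> = \<tau> * C \<and> ip c (df X q e\<^sub>2) \<xi> = \<tau> * Sn) \<and>
     integral_curves_satisfy D X e\<^sub>1 (helix_or_circle c \<bar>h + \<delta>\<bar> (\<bar>\<tau> * C\<bar> / sqrt (1 - \<tau> * \<tau>) * \<bar>h + \<delta>\<bar>)) \<and>
     integral_curves_satisfy D X e\<^sub>2 (helix_or_circle c \<bar>h - \<delta>\<bar> (\<bar>\<tau> * Sn\<bar> / sqrt (1 - \<tau> * \<tau>) * \<bar>h - \<delta>\<bar>)))"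
    proof (rule pp[OF C(1,2)])
      show "C * C + Sn * Sn = 1" using C(3,4) by simp
      have "C * C - Sn * Sn = r" using C(3,4) by simp
      then show "\<delta> * (C * C - Sn * Sn) = a - h" using r(3) by metis
    qed
    have ab: "(\<tau> * C)\<^sup>2 + (\<tau> * Sn)\<^sup>2 = \<tau>\<^sup>2"
    proof -
      have "(\<tau> * C)\<^sup>2 + (\<tau> * Sn)\<^sup>2 = \<tau>\<^sup>2 * (C * C + Sn * Sn)" by (simp add: power2_eq_square algebra_simps)
      then show ?thesis using C(3,4) by (simp add: field_simps)
    qed
    have pos: "h\<^sup>2 + c * (1 - \<tau>\<^sup>2) > 0" using \<delta>(1) mult_pos_pos[OF dp dp] by (simp add: power2_eq_square)
    have eq: "1 - (\<tau> * C)\<^sup>2 - (\<tau> * Sn)\<^sup>2 = 1 - \<tau> * \<tau>" using ab by (simp add: power2_eq_square)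
    have \<delta>eq: "sqrt (h\<^sup>2 + c * (1 - \<tau> * \<tau>)) = \<delta>" by (simp add: \<delta>_def power2_eq_square)
    have hd: "\<bar>h + \<delta>\<bar> = h + \<delta>" using h dp by simp
    show ?thesis
    proof (intro conjI surface_flat, rule exI[of _ \<tau>], intro conjI ev disjI2, goal_cases)
      case 1
      show ?case using pos by (simp add: algebra_simps)
    next
      case 2
      show ?case
        by (rule exI[of _ "\<tau> * C"], rule exI[of _ "\<tau> * Sn"], unfold Let_def eq \<delta>eq, intro conjI ab lg[unfolded hd])
          (use ab pos \<tau> \<tau>2 in \<open>simp_all add: power2_eq_square\<close>)
    qed
  qed
qed

end
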